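(* Let $(\eta,\mathbf q)$ be an entropy pair for $\partial_t\mathbf u+\nabla\cdot\mathbf f(\mathbf u)=0$. Let $n\in\mathbb N$ and $i\in\{1,\dots,N\}$, and consider one time step, from $t^n$ to $t^{n+1}=t^n+\tau$, of the ALE scheme version 1 or version 2 (defined in the context). Let $$\lambda_{i,\max}^n:=\max_{j\in\mathcal I(S_i^n)}\ \max\big(\lambda_{\max}(\mathbf g_j^n,\mathbf n_{ij}^n,\mathbf U_i^n,\mathbf U_j^n),\ \lambda_{\max}(\mathbf g_i^n,\mathbf n_{ji}^n,\mathbf U_j^n,\mathbf U_i^n)\big)$$ and assume, depending on the version of the algorithm, that $$2\tau\frac{\lambda_{i,\max}^n}{\underline h_i^n}\,\kappa_i^n\,\frac{\sum_{l\in\mathcal L}\omega_l m_i(t_l^n)}{m_i^{n+1}}\le 1\quad\text{(for version 2)},\qquad\text{or}\qquad 2\tau\frac{\lambda_{i,\max}^n}{\underline h_i^n}\,\kappa_i^n\,\frac{\mathfrak m_i^n}{\mathfrak m_i^{n+1}}\le 1\quad\text{(for version 1)},$$ and that $\{\mathbf U_j^n: j\in\mathcal I(S_i^n)\}\subset B$ for some convex invariant set $B\subset\mathcal A_{\mathbf f}$ for the flux $\mathbf f$. Then the following discrete entropy inequality holds for version 1: $$\frac1\tau\big(\mathfrak m_i^{n+1}\eta(\mathbf U_i^{n+1})-\mathfrak m_i^n\eta(\mathbf U_i^n)\big)\le\sum_{j\in\mathcal I(S_i^n)}d_{ij}^n\eta(\mathbf U_j^n)-\int_{\mathbb R^d}\nabla\cdot\Big(\sum_{j\in\mathcal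 I(S_i^n)}(\mathbf q(\mathbf U_j^n)-\eta(\mathbf U_j^n)\mathbf W_j^n)\psi_j^n(\mathbf x)\Big)\psi_i^n(\mathbf x)\,d\mathbf x,$$ and the following holds for version 2: $$\frac1\tau\big(m_i^{n+1}\eta(\mathbf U_i^{n+1})-m_i^n\eta(\mathbf U_i^n)\big)\le\sum_{j\in\mathcal I(S_i^n)}d_{ij}^n\eta(\mathbf U_j^n)-\sum_{l\in\mathcal L}\omega_l\int_{\mathbb R^d}\nabla\cdot\Big(\sum_{j\in\mathcal I(S_i^n)}(\mathbf q(\mathbf U_j^n)-\eta(\mathbf U_j^n)\mathbf W_j^n)\varphi_j(\mathbf x,t_l^n)\Big)\varphi_i(\mathbf x,t_l^n)\,d\mathbf x.$$
   Context: **Hyperbolic system.** Consider $\partial_t\mathbf u+\nabla\cdot\mathbf f(\mathbf u)=0$ on $\mathbb R^d\times\mathbb R_+$, $\mathbf u\in\mathbb R^m$, $\mathbf f(\mathbf u)\in\mathbb R^{m\times d}$. For $A\in\mathbb R^{m\times d}$ and $\mathbf n\in\mathbb R^d$, $A\cdot\mathbf n\in\mathbb R^m$ has entries $\sum_l A_{il}n_l$; $(\mathbf u\otimes\mathbf v)_{ij}=u_iv_j$; the divergence of an $m\times d$ matrix field is taken row by row. For a flux $\mathbf h$ (with values in $\mathbb R^{m\times d}$), $(\eta,\mathbf q)$ is an entropy pair if $\eta$ is convex and $\partial_{v_k}(\mathbf q(\mathbf v)\cdot\mathbf n)=\sum_{i=1}^m\partial_{v_i}\eta(\mathbf v)\,\partial_{v_k}(\mathbf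 h_i(\mathbf v)\cdot\mathbf n)$ for all $k$ and all unit $\mathbf n$ ($\mathbf h_i$ is the $i$-th row); an entropy pair for the system is an entropy pair for $\mathbf f$. Standing assumption: there is a nonempty admissible set $\mathcal A_{\mathbf h}\subset\mathbb R^m$ such that for all $\mathbf u_L,\mathbf u_R\in\mathcal A_{\mathbf h}$ and every unit vector $\mathbf n$ the Riemann problem $\partial_t\mathbf u+\partial_x(\mathbf h(\mathbf u)\cdot\mathbf n)=0$, $\mathbf u(x,0)=\mathbf u_L$ if $x<0$, $\mathbf u_R$ if $x>0$, has a unique entropy satisfying solution $\mathbf u(\mathbf h,\mathbf n,\mathbf u_L,\mathbf u_R)$ (i.e. $\partial_t\eta(\mathbf u)+\partial_x(\mathbf q(\mathbf u)\cdot\mathbf n)\le 0$ in the distribution sense for every entropy pair), and this solution has finite speed of propagation: there are $\lambda_L\le\lambda_R$ (depending on $\mathbf h,\mathbf n,\mathbf u_L,\mathbf u_R$) such that it equals $\mathbf u_L$ for $x\le t\lambda_L$ and $\mathbf u_R$ for $x\ge t\lambda_R$. Set $\lambda_{\max}(\mathbf h,\mathbf n,\mathbf u_L,\mathbf u_R)=\max(|\lambda_L|,|\lambda_R|)$. **Invariant set.** A convex set $A\subset\mathcal A_{\mathbf h}$ is invariant for the flux $\mathbf h$ if for all $\mathbf v_L,\mathbf v_R\in A$, all unit $\mathbf n$ and all $t>0$, the average $\frac{1}{t(\lambda_R-\lambda_L)}\int_{\lambda_Lt}^{\lambda_Rt}\mathbf v(\mathbf h,\mathbf n,\mathbf v_L,\mathbf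 v_R)(x,t)\,dx$ of the entropy solution over the Riemann fan belongs to $A$. **Boundary conditions.** The problem is the Cauchy problem in $\mathbb R^d$ with data constant outside a compact set, or periodic boundary conditions are used (integrals over $\mathbb R^d$ then being over the periodic domain); no boundary terms arise in integrations by parts. **Finite elements.** $\mathcal T_h^n$ is a matching mesh at time $t^n$ with fixed connectivity. Every cell $K$ is $T_K^n(\widehat K)$, where $\widehat K$ is one of finitely many reference elements, $T_K^n(\widehat{\mathbf x})=\sum_{i=1}^{n_f^{geo}}\mathbf a^n_{\mathsf j^{geo}(i,K)}\widehat\theta_i^{geo}(\widehat{\mathbf x})$ is a diffeomorphism, $\{\mathbf a_i^n\}_{1\le i\le N_{geo}}$ are the geometric Lagrange nodes, $\widehat\theta_i^{geo}$ the reference Lagrange shape functions spanning $\widehat P^{geo}$, and $\mathsf j^{geo}$ the (time independent) geometric connectivity array. The approximation uses reference shape functions $\widehat\theta_i$ ($1\le i\le n_f$), spanning $\widehat P$, with $\widehat\theta_i\ge0$ and $\sum_i\widehat\theta_i=1$ on $\widehat K$. $P(\mathcal T_h^n)$ is the space of continuous scalar functions $v$ with $v|_K\circ T_K^n\in\widehat P$ for all $K$; $\mathbf P_d=[P]^d$, $\mathbf P_m=[P]^m$. Its global shape functions $\{\psi_i^n\}_{1\le i\le N}$ satisfy $\psi^n_{\mathsf j(i,K)}=\widehat\theta_i\circ(T_K^n)^{-1}$ on $K$, with time independent connectivity array $\mathsf j$, so $\psi_i^n\ge0$, $\sum_i\psi_i^n=1$. $S_i^n$ is the support of $\psi_i^n$,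 $S_{ij}^n=S_i^n\cap S_j^n$, and for a union of cells $E$, $\mathcal I(E)=\{j: |S_j^n\cap E|\ne0\}$ (independent of $n$). $m_i^n:=\int\psi_i^n\,d\mathbf x$. The approximate solution is $\mathbf u_h^n=\sum_i\mathbf U_i^n\psi_i^n\in\mathbf P_m(\mathcal T_h^n)$. **Version 1.** Given an ALE velocity $\mathbf w^n=\sum_i\mathbf W_i^n\psi_i^n\in\mathbf P_d(\mathcal T_h^n)$, nodes move by $\mathbf a_i^{n+1}=\mathbf a_i^n+\tau\mathbf w^n(\mathbf a_i^n)$, defining $\mathcal T_h^{n+1}$. Approximate masses: $\mathfrak m_i^0=m_i^0$, $\mathfrak m_i^{n+1}=\mathfrak m_i^n+\tau\int_{S_i^n}\psi_i^n\,\nabla\cdot\mathbf w^n\,d\mathbf x$, assumed positive. With $\mathbf c_{ij}^n=\int_{S_i^n}\psi_i^n\nabla\psi_j^n\,d\mathbf x$, $$\frac{\mathfrak m_i^{n+1}\mathbf U_i^{n+1}-\mathfrak m_i^n\mathbf U_i^n}{\tau}+\sum_{j\in\mathcal I(S_i^n)}\Big[(\mathbf f(\mathbf U_j^n)-\mathbf U_j^n\otimes\mathbf W_j^n)\cdot\mathbf c_{ij}^n-d_{ij}^n\mathbf U_j^n\Big]=0.$$ **Version 2.** Assume $\widehat P^{geo}\subset\widehat P$. The ALE velocity $\mathbf w^n=\sum_{i=1}^{N_{geo}}\mathbf W_i^{geo,n}\psi_i^{geo,n}$ is in $[P^{geo}(\mathcal T_h^n)]^d$ (defined like $P$ with $\widehat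 P^{geo}$ and the geometric shape functions $\psi^{geo,n}_{\mathsf j^{geo}(i,K)}=\widehat\theta_i^{geo}\circ(T_K^n)^{-1}$); $\mathbf W_j^n$ are its coefficients in the basis $\{\psi_j^n\}$: $\mathbf w^n=\sum_j\mathbf W_j^n\psi_j^n$. For $t\in[t^n,t^{n+1}]$, $\mathbf a_i(t)=\mathbf a_i^n+(t-t^n)\mathbf W_i^{geo,n}$ defines a mesh $\mathcal T_h(t)$, geometric maps $T_K(t)$, and shape functions $\varphi_i(\cdot,t)$ with $\varphi_{\mathsf j(i,K)}(\cdot,t)=\widehat\theta_i\circ T_K(t)^{-1}$ on the cell $T_K(t)(\widehat K)$, with supports $S_i(t)$, $S_{ij}(t)=S_i(t)\cap S_j(t)$; the mesh motion map $\boldsymbol\Phi_t$ ($=T_K(t)\circ(T_K^n)^{-1}$ on $K$) is assumed invertible for $t\in[t^n,t^{n+1}]$; $\mathcal T_h^{n+1}=\mathcal T_h(t^{n+1})$ and $\psi_i^{n+1}=\varphi_i(\cdot,t^{n+1})$. $(\omega_l,\zeta_l)_{l\in\mathcal L}$ is a quadrature such that $\int_0^1 f(\zeta)\,d\zeta\simeq\sum_{l\in\mathcal L}\omega_l f(\zeta_l)$ is exact for all polynomials $f$ of degree at most $d-1$; $t_l^n=t^n+\tau\zeta_l$. Put $m_i(t)=\int\varphi_i(\mathbf x,t)\,d\mathbf x$, $m_i^{n+1}=\int\psi_i^{n+1}\,d\mathbf x$, $\mathbf c_{ij}(t_l^n)=\int\varphi_i(\mathbf x,t_l^n)\nabla\varphi_j(\mathbf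 x,t_l^n)\,d\mathbf x$, $\mathbf c_{ij}^n=\sum_{l}\omega_l\mathbf c_{ij}(t_l^n)$, and $$\frac{m_i^{n+1}\mathbf U_i^{n+1}-m_i^n\mathbf U_i^n}{\tau}+\sum_{j\in\mathcal I(S_i^n)}\Big[(\mathbf f(\mathbf U_j^n)-\mathbf U_j^n\otimes\mathbf W_j^n)\cdot\mathbf c_{ij}^n-d_{ij}^n\mathbf U_j^n\Big]=0.$$ **Artificial viscosity (both versions).** $\mathbf g_j^n(\mathbf v)=\mathbf f(\mathbf v)-\mathbf v\otimes\mathbf W_j^n$ (its Riemann solutions are translates of those of $\mathbf f$: $\mathcal A_{\mathbf g_j^n}=\mathcal A_{\mathbf f}$ and $\lambda_{L}(\mathbf g_j^n,\mathbf n,\cdot,\cdot)=\lambda_{L}(\mathbf f,\mathbf n,\cdot,\cdot)-\mathbf W_j^n\cdot\mathbf n$, likewise for $\lambda_R$), $\mathbf n_{ij}^n=\mathbf c_{ij}^n/\|\mathbf c_{ij}^n\|_{\ell^2}$ (terms with $\mathbf c_{ij}^n=0$ are omitted or counted as zero). For $i\neq j$, $j\in\mathcal I(S_i^n)$, $$d_{ij}^n=\max\big(\lambda_{\max}(\mathbf g_j^n,\mathbf n_{ij}^n,\mathbf U_i^n,\mathbf U_j^n)\|\mathbf c_{ij}^n\|_{\ell^2},\ \lambda_{\max}(\mathbf g_i^n,\mathbf n_{ji}^n,\mathbf U_j^n,\mathbf U_i^n)\|\mathbf c_{ji}^n\|_{\ell^2}\big),$$ $d_{ij}^n=0$ if $j\notin\mathcal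 I(S_i^n)$, and $d_{ii}^n=-\sum_{i\ne j\in\mathcal I(S_i^n)}d_{ji}^n$. **Mesh parameters.** For shape functions at time $t$ ($\varphi_i(\cdot,t)$, with $\varphi_i(\cdot,t^n)=\psi_i^n$), $\underline h_{ij}(t)=1/\big\|\,\|\nabla\varphi_j\|_{\ell^2}\big\|_{L^\infty(S_{ij}(t))}$ and $\underline h_i(t)=\min_{j\in\mathcal I(S_i(t))}\underline h_{ij}(t)$. Version 2: $\underline h_i^n=\min_{l\in\mathcal L}\underline h_i(t_l^n)$ and $\kappa_i^n=\frac{\sum_{i\ne j\in\mathcal I(S_i^n)}\sum_{l}\omega_l\int_{S_{ij}(t_l^n)}\varphi_i(\mathbf x,t_l^n)\,d\mathbf x}{\sum_{l}\omega_l m_i(t_l^n)}$. Version 1: $\underline h_i^n=\underline h_i(t^n)$ and $\kappa_i^n=\frac{\sum_{i\ne j\in\mathcal I(S_i^n)}\int_{S_{ij}^n}\psi_i^n\,d\mathbf x}{\int_{S_i^n}\psi_i^n\,d\mathbf x}$.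
   Formalization: For version 1 the CFL condition is also required with the exact mass m_i^n in place of the approximate mass 𝔪_i^n, and for version 2 the quadrature weights are assumed nonnegative; without these the stated inequality can fail. *)

theory Defs
  imports "HOL-Probability.Essential_Supremum" "HOL-Computational_Algebra.Polynomial"
begin

section \<open>Calculus\<close>

definition C1_near :: "('a::real_normed_vector \<Rightarrow> 'b::real_normed_vector) \<Rightarrow> 'a set \<Rightarrow> bool" where
  "C1_near g S \<longleftrightarrow> (\<exists>V. open V \<and> S \<subseteq> V \<and> (\<forall>x\<in>V. g differentiable (at x)) \<and>
     (\<forall>v. continuous_on V (\<lambda>x. frechet_derivative g (at x) v)))"

definition diffeomorphism_on :: "('a::real_normed_vector \<Rightarrow> 'a) \<Rightarrow> 'a set \<Rightarrow> bool" where
  "diffeomorphism_on T S \<longleftrightarrow>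
     C1_near T S \<and> (\<exists>T'. C1_near T' (T ` S) \<and> (\<forall>y\<in>S. T' (T y) = y))"

definition partial_deriv :: "(real^'n \<Rightarrow> real) \<Rightarrow> 'n \<Rightarrow> real^'n \<Rightarrow> real" where
  "partial_deriv g k x = frechet_derivative g (at x) (axis k 1)"

text \<open>Finite element functions are differentiable off the cell boundaries only. The values that
  \<open>grad\<close> and \<open>dvg\<close> take on this null set are irrelevant; all integrals and essential suprema below
  are with respect to the complete measure \<open>lebesgue\<close>.\<close>

definition grad :: "(real^'n \<Rightarrow> real) \<Rightarrow> real^'n \<Rightarrow> real^'n" where
  "grad g x = (\<chi> k. partial_deriv g k x)"

definition dvg :: "(real^'n \<Rightarrow> real^'n) \<Rightarrow> real^'n \<Rightarrow> real" where
  "dvg w x = (\<Sum>k\<in>UNIV. frechet_derivative w (at x) (axis k 1) $ k)"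

definition outer :: "real^'m \<Rightarrow> real^'d \<Rightarrow> real^'d^'m" where
  "outer u v = (\<chi> i j. u $ i * v $ j)"


section \<open>Entropy pairs, Riemann problems, invariant sets\<close>

definition entropy_pair ::
  "(real^'m \<Rightarrow> real^'d^'m) \<Rightarrow> (real^'m \<Rightarrow> real) \<Rightarrow> (real^'m \<Rightarrow> real^'d) \<Rightarrow> bool" where
  "entropy_pair h \<eta> q \<longleftrightarrow>
     convex_on UNIV \<eta> \<and>
     (\<forall>v. \<eta> differentiable (at v)) \<and> (\<forall>v. q differentiable (at v)) \<and>
     (\<forall>v n k. norm n = 1 \<longrightarrow>
        partial_deriv (\<lambda>w. q w \<bullet> n) k v =
        (\<Sum>i\<in>UNIV. partial_deriv \<eta> i v * partial_deriv (\<lambda>w. (h w $ i) \<bullet> n) k v))"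

definition riemann_data :: "'a \<Rightarrow> 'a \<Rightarrow> real \<Rightarrow> 'a" where
  "riemann_data uL uR x = (if x < 0 then uL else uR)"

text \<open>Functions of \<open>(x,t)\<close> are functions on \<open>real \<times> real\<close>, with \<open>x\<close> the first component. Test
  functions need not vanish at \<open>t = 0\<close>, so that the inequality below contains the initial
  condition; the entropies \<open>\<eta>(v) = \<plusminus> v $ k\<close> with fluxes \<open>\<plusminus> h v $ k\<close> give the weak form of the
  conservation law itself.\<close>

definition test_function :: "(real \<times> real \<Rightarrow> real) \<Rightarrow> bool" where
  "test_function \<phi> \<longleftrightarrow> C1_near \<phi> UNIV \<and> (\<forall>z. 0 \<le> \<phi> z) \<and> compact (closure {z. \<phi> z \<noteq> 0})"

definition entropy_solution ::
  "(real^'m \<Rightarrow> real^'d^'m) \<Rightarrow> real^'d \<Rightarrow> real^'m \<Rightarrow> real^'m \<Rightarrow> (real \<times> real \<Rightarrow> real^'m) \<Rightarrow> bool" where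
  "entropy_solution h n uL uR u \<longleftrightarrow>
     u \<in> borel_measurable borel \<and> bounded (u ` {z. 0 < snd z}) \<and>
     (\<forall>\<eta> q \<phi>. entropy_pair h \<eta> q \<longrightarrow> test_function \<phi> \<longrightarrow>
        0 \<le> (LINT z:{z. 0 < snd z}|lborel.
                \<eta> (u z) * frechet_derivative \<phi> (at z) (0, 1)
                + (q (u z) \<bullet> n) * frechet_derivative \<phi> (at z) (1, 0))
            + (LINT x|lborel. \<eta> (riemann_data uL uR x) * \<phi> (x, 0)))"

record ('m::finite, 'd::finite) riemann =
  adm :: "(real^'m) set"
  sol :: "real^'d \<Rightarrow> real^'m \<Rightarrow> real^'m \<Rightarrow> real \<times> real \<Rightarrow> real^'m"
  lamL :: "real^'d \<Rightarrow> real^'m \<Rightarrow> real^'m \<Rightarrow> real"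
  lamR :: "real^'d \<Rightarrow> real^'m \<Rightarrow> real^'m \<Rightarrow> real"

definition riemann_solvable :: "(real^'m \<Rightarrow> real^'d^'m) \<Rightarrow> ('m::finite, 'd::finite) riemann \<Rightarrow> bool" where
  "riemann_solvable h R \<longleftrightarrow>
     adm R \<noteq> {} \<and>
     (\<forall>uL\<in>adm R. \<forall>uR\<in>adm R. \<forall>n. norm n = 1 \<longrightarrow>
        entropy_solution h n uL uR (sol R n uL uR) \<and>
        (\<forall>v. entropy_solution h n uL uR v \<longrightarrow>
           (AE z in lborel. 0 < snd z \<longrightarrow> v z = sol R n uL uR z)) \<and>
        lamL R n uL uR \<le> lamR R n uL uR \<and>
        (\<forall>t>0. AE x in lborel.
           (x \<le> t * lamL R n uL uR \<longrightarrow> sol R n uL uR (x, t) = uL) \<and>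
           (t * lamR R n uL uR \<le> x \<longrightarrow> sol R n uL uR (x, t) = uR)))"

definition lam_max :: "('m::finite, 'd::finite) riemann \<Rightarrow> real^'d \<Rightarrow> real^'m \<Rightarrow> real^'m \<Rightarrow> real" where
  "lam_max R n uL uR = max \<bar>lamL R n uL uR\<bar> \<bar>lamR R n uL uR\<bar>"

definition ale_flux :: "(real^'m \<Rightarrow> real^'d^'m) \<Rightarrow> real^'d \<Rightarrow> real^'m \<Rightarrow> real^'d^'m" where
  "ale_flux f w v = f v - outer v w"

text \<open>If \<open>R\<close> are the Riemann solutions for \<open>f\<close>, then \<open>ale_riemann w R\<close> are those for \<open>ale_flux f w\<close>.\<close>

definition ale_riemann :: "real^'d \<Rightarrow> ('m::finite, 'd::finite) riemann \<Rightarrow> ('m::finite, 'd::finite) riemann" where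
  "ale_riemann w R = R\<lparr>
     sol := (\<lambda>n uL uR (x, t). sol R n uL uR (x + t * (w \<bullet> n), t)),
     lamL := (\<lambda>n uL uR. lamL R n uL uR - w \<bullet> n),
     lamR := (\<lambda>n uL uR. lamR R n uL uR - w \<bullet> n)\<rparr>"

text \<open>There is no fan to average over when the two speeds coincide.\<close>

definition invariant_set :: "('m::finite, 'd::finite) riemann \<Rightarrow> (real^'m) set \<Rightarrow> bool" where
  "invariant_set R A \<longleftrightarrow>
     convex A \<and> A \<subseteq> adm R \<and>
     (\<forall>vL\<in>A. \<forall>vR\<in>A. \<forall>n t. norm n = 1 \<longrightarrow> 0 < t \<longrightarrow> lamL R n vL vR < lamR R n vL vR \<longrightarrow>
        (1 / (t * (lamR R n vL vR - lamL R n vL vR))) *\<^sub>R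
          (LINT x:{lamL R n vL vR * t..lamR R n vL vR * t}|lborel. sol R n vL vR (x, t)) \<in> A)"


section \<open>Meshes\<close>

text \<open>A periodic problem is posed on \<open>\<real>\<^sup>d\<close> modulo the lattice spanned by a basis \<open>b\<close>. Functions on
  this domain are represented by periodic functions on \<open>\<real>\<^sup>d\<close> and are integrated over the fundamental
  parallelotope. For the Cauchy problem the lattice is trivial.\<close>

datatype ('d::finite) bdry = Cauchy | Periodic "'d \<Rightarrow> real^'d"

fun periods :: "'d::finite bdry \<Rightarrow> (real^'d) set" where
  "periods Cauchy = {0}"
| "periods (Periodic b) = range (\<lambda>z::'d \<Rightarrow> int. \<Sum>k\<in>UNIV. of_int (z k) *\<^sub>R b k)"

fun fundamental_domain :: "'d::finite bdry \<Rightarrow> (real^'d) set" where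
  "fundamental_domain Cauchy = UNIV"
| "fundamental_domain (Periodic b) =
     {(\<Sum>k\<in>UNIV. s k *\<^sub>R b k) | s. \<forall>k. 0 \<le> s k \<and> s k < 1}"

text \<open>The time independent part of the discretization. Cells, degrees of freedom, geometric nodes
  and reference elements are numbered by natural numbers, local shape functions of the reference
  element \<open>r\<close> by \<open>{1..nsh r}\<close> and \<open>{1..ngeo r}\<close>; \<open>con i K\<close> and \<open>geo_con i K\<close> are the connectivity
  arrays. A periodic mesh consists of one representative of each cell modulo the lattice, and
  \<open>geo_shift i K\<close> is the lattice vector leading from the stored position of the geometric node
  \<open>geo_con i K\<close> to the copy of it that belongs to this representative.\<close>

record ('d::finite) discretization =
  bdry :: "'d bdry"
  cells :: "nat set"
  ref :: "nat \<Rightarrow> nat"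
  elt :: "nat \<Rightarrow> (real^'d) set"
  ngeo :: "nat \<Rightarrow> nat"
  geo_shape :: "nat \<Rightarrow> nat \<Rightarrow> real^'d \<Rightarrow> real"
  geo_node :: "nat \<Rightarrow> nat \<Rightarrow> real^'d"
  geo_con :: "nat \<Rightarrow> nat \<Rightarrow> nat"
  geo_shift :: "nat \<Rightarrow> nat \<Rightarrow> real^'d"
  nsh :: "nat \<Rightarrow> nat"
  shape :: "nat \<Rightarrow> nat \<Rightarrow> real^'d \<Rightarrow> real"
  con :: "nat \<Rightarrow> nat \<Rightarrow> nat"

abbreviation Omega :: "'d::finite discretization \<Rightarrow> (real^'d) set" where
  "Omega M \<equiv> fundamental_domain (bdry M)"

abbreviation pers :: "'d::finite discretization \<Rightarrow> (real^'d) set" where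
  "pers M \<equiv> periods (bdry M)"

abbreviation cell_elt :: "'d::finite discretization \<Rightarrow> nat \<Rightarrow> (real^'d) set" where
  "cell_elt M K \<equiv> elt M (ref M K)"

definition dofs :: "'d::finite discretization \<Rightarrow> nat set" where
  "dofs M = {con M i K | i K. K \<in> cells M \<and> i \<in> {1..nsh M (ref M K)}}"

definition geo_dofs :: "'d::finite discretization \<Rightarrow> nat set" where
  "geo_dofs M = {geo_con M i K | i K. K \<in> cells M \<and> i \<in> {1..ngeo M (ref M K)}}"

definition reference_element :: "'d::finite discretization \<Rightarrow> nat \<Rightarrow> bool" where
  "reference_element M r \<longleftrightarrow>
     polytope (elt M r) \<and> interior (elt M r) \<noteq> {} \<and>
     (\<forall>i\<in>{1..ngeo M r}. C1_near (geo_shape M r i) (elt M r) \<and> geo_node M r i \<in> elt M r) \<and>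
     (\<forall>i\<in>{1..ngeo M r}. \<forall>j\<in>{1..ngeo M r}.
        geo_shape M r i (geo_node M r j) = (if i = j then 1 else 0)) \<and>
     (\<forall>i\<in>{1..nsh M r}. C1_near (shape M r i) (elt M r)) \<and>
     (\<forall>i\<in>{1..nsh M r}. \<forall>y\<in>elt M r. 0 \<le> shape M r i y) \<and>
     (\<forall>y\<in>elt M r. (\<Sum>i=1..nsh M r. shape M r i y) = 1) \<and>
     (\<forall>c. (\<forall>y\<in>elt M r. (\<Sum>i=1..nsh M r. c i * shape M r i y) = 0) \<longrightarrow>
        (\<forall>i\<in>{1..nsh M r}. c i = 0))"

text \<open>A mesh of the whole space has infinitely many cells; each shape function lives on finitely many.\<close>

definition admissible_discretization :: "'d::finite discretization \<Rightarrow> bool" where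
  "admissible_discretization M \<longleftrightarrow>
     (case bdry M of Cauchy \<Rightarrow> True
      | Periodic b \<Rightarrow> inj b \<and> independent (range b) \<and> finite (cells M)) \<and>
     finite (ref M ` cells M) \<and>
     (\<forall>K\<in>cells M. reference_element M (ref M K)) \<and>
     (\<forall>K\<in>cells M. inj_on (\<lambda>i. con M i K) {1..nsh M (ref M K)}) \<and>
     (\<forall>K\<in>cells M. inj_on (\<lambda>i. geo_con M i K) {1..ngeo M (ref M K)}) \<and>
     (\<forall>K\<in>cells M. \<forall>i\<in>{1..ngeo M (ref M K)}. geo_shift M i K \<in> pers M) \<and>
     (\<forall>j. finite {K \<in> cells M. j \<in> (\<lambda>i. con M i K) ` {1..nsh M (ref M K)}})"

definition geo_in_approx :: "'d::finite discretization \<Rightarrow> bool" where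
  "geo_in_approx M \<longleftrightarrow> (\<forall>r \<in> ref M ` cells M. \<forall>i\<in>{1..ngeo M r}. \<exists>c. \<forall>y\<in>elt M r.
     geo_shape M r i y = (\<Sum>j=1..nsh M r. c j * shape M r j y))"

text \<open>From here on, \<open>a\<close> gives the positions of the geometric nodes and thereby determines the mesh.\<close>

definition geo_map :: "'d::finite discretization \<Rightarrow> (nat \<Rightarrow> real^'d) \<Rightarrow> nat \<Rightarrow> real^'d \<Rightarrow> real^'d" where
  "geo_map M a K y =
     (\<Sum>i=1..ngeo M (ref M K). geo_shape M (ref M K) i y *\<^sub>R (a (geo_con M i K) + geo_shift M i K))"

text \<open>\<open>F K\<close> is the pullback to the reference element of the restriction of a function to the cell \<open>K\<close>.\<close>

definition continuous_across_cells ::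
  "'d::finite discretization \<Rightarrow> (nat \<Rightarrow> real^'d) \<Rightarrow> (nat \<Rightarrow> real^'d \<Rightarrow> real) \<Rightarrow> bool" where
  "continuous_across_cells M a F \<longleftrightarrow>
     (\<forall>K\<in>cells M. \<forall>K'\<in>cells M. \<forall>p\<in>pers M. \<forall>y\<in>cell_elt M K. \<forall>y'\<in>cell_elt M K'.
        geo_map M a K y = p + geo_map M a K' y' \<longrightarrow> F K y = F K' y')"

definition glue ::
  "'d::finite discretization \<Rightarrow> (nat \<Rightarrow> real^'d) \<Rightarrow> (nat \<Rightarrow> real^'d \<Rightarrow> real) \<Rightarrow> real^'d \<Rightarrow> real" where
  "glue M a F x = (THE v. \<exists>K\<in>cells M. \<exists>p\<in>pers M. \<exists>y\<in>cell_elt M K.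
     x = p + geo_map M a K y \<and> v = F K y)"

definition local_shape :: "'d::finite discretization \<Rightarrow> nat \<Rightarrow> nat \<Rightarrow> real^'d \<Rightarrow> real" where
  "local_shape M j K y = (\<Sum>i | i \<in> {1..nsh M (ref M K)} \<and> con M i K = j. shape M (ref M K) i y)"

definition local_geo_shape :: "'d::finite discretization \<Rightarrow> nat \<Rightarrow> nat \<Rightarrow> real^'d \<Rightarrow> real" where
  "local_geo_shape M j K y =
     (\<Sum>i | i \<in> {1..ngeo M (ref M K)} \<and> geo_con M i K = j. geo_shape M (ref M K) i y)"

definition psi :: "'d::finite discretization \<Rightarrow> (nat \<Rightarrow> real^'d) \<Rightarrow> nat \<Rightarrow> real^'d \<Rightarrow> real" where
  "psi M a j = glue M a (local_shape M j)"

definition psi_geo :: "'d::finite discretization \<Rightarrow> (nat \<Rightarrow> real^'d) \<Rightarrow> nat \<Rightarrow> real^'d \<Rightarrow> real" where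
  "psi_geo M a j = glue M a (local_geo_shape M j)"

text \<open>Two different cells, or different translates of the same cell, meet in a common proper face,
  which may be empty.\<close>

definition matching_mesh :: "'d::finite discretization \<Rightarrow> (nat \<Rightarrow> real^'d) \<Rightarrow> bool" where
  "matching_mesh M a \<longleftrightarrow>
     (\<forall>K\<in>cells M. diffeomorphism_on (geo_map M a K) (cell_elt M K)) \<and>
     (\<Union>K\<in>cells M. \<Union>p\<in>pers M. (+) p ` geo_map M a K ` cell_elt M K) = UNIV \<and>
     (\<forall>S. bounded S \<longrightarrow>
        finite {(K, p). K \<in> cells M \<and> p \<in> pers M \<and>
                        ((+) p ` geo_map M a K ` cell_elt M K) \<inter> S \<noteq> {}}) \<and>
     (\<forall>K\<in>cells M. \<forall>K'\<in>cells M. \<forall>p\<in>pers M. (K, 0) \<noteq> (K', p) \<longrightarrow>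
        (\<exists>E E'. E face_of cell_elt M K \<and> E \<noteq> cell_elt M K \<and>
                E' face_of cell_elt M K' \<and> E' \<noteq> cell_elt M K' \<and>
                geo_map M a K ` cell_elt M K \<inter> ((+) p ` geo_map M a K' ` cell_elt M K')
                  = geo_map M a K ` E \<and>
                geo_map M a K ` E = (+) p ` geo_map M a K' ` E')) \<and>
     (\<forall>j\<in>dofs M. continuous_across_cells M a (local_shape M j))"

definition supp :: "'d::finite discretization \<Rightarrow> (nat \<Rightarrow> real^'d) \<Rightarrow> nat \<Rightarrow> (real^'d) set" where
  "supp M a i = closure {x. psi M a i x \<noteq> 0}"

definition nbh :: "'d::finite discretization \<Rightarrow> (nat \<Rightarrow> real^'d) \<Rightarrow> (real^'d) set \<Rightarrow> nat set" where
  "nbh M a E = {j \<in> dofs M. emeasure lebesgue (Omega M \<inter> (supp M a j \<inter> E)) \<noteq> 0}"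

abbreviation nb :: "'d::finite discretization \<Rightarrow> (nat \<Rightarrow> real^'d) \<Rightarrow> nat \<Rightarrow> nat set" where
  "nb M a i \<equiv> nbh M a (supp M a i)"

definition mass :: "'d::finite discretization \<Rightarrow> (nat \<Rightarrow> real^'d) \<Rightarrow> nat \<Rightarrow> real" where
  "mass M a i = (LINT x:Omega M|lebesgue. psi M a i x)"

definition cvec :: "'d::finite discretization \<Rightarrow> (nat \<Rightarrow> real^'d) \<Rightarrow> nat \<Rightarrow> nat \<Rightarrow> real^'d" where
  "cvec M a i j = (LINT x:Omega M|lebesgue. psi M a i x *\<^sub>R grad (psi M a j) x)"

definition overlap_mass :: "'d::finite discretization \<Rightarrow> (nat \<Rightarrow> real^'d) \<Rightarrow> nat \<Rightarrow> nat \<Rightarrow> real" where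
  "overlap_mass M a i j = (LINT x:(Omega M \<inter> (supp M a i \<inter> supp M a j))|lebesgue. psi M a i x)"

text \<open>Only finitely many terms of these sums are nonzero, but the index set may be infinite.\<close>

definition velocity ::
  "'d::finite discretization \<Rightarrow> (nat \<Rightarrow> real^'d) \<Rightarrow> (nat \<Rightarrow> real^'d) \<Rightarrow> real^'d \<Rightarrow> real^'d" where
  "velocity M a W x = (\<Sum>j | j \<in> dofs M \<and> psi M a j x \<noteq> 0. psi M a j x *\<^sub>R W j)"

definition geo_velocity ::
  "'d::finite discretization \<Rightarrow> (nat \<Rightarrow> real^'d) \<Rightarrow> (nat \<Rightarrow> real^'d) \<Rightarrow> real^'d \<Rightarrow> real^'d" where
  "geo_velocity M a W x = (\<Sum>j | j \<in> geo_dofs M \<and> psi_geo M a j x \<noteq> 0. psi_geo M a j x *\<^sub>R W j)"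

text \<open>Extended real, since a shape function may be constant on an overlap: \<open>1 / 0 = \<infinity>\<close> there.\<close>

definition hloc :: "'d::finite discretization \<Rightarrow> (nat \<Rightarrow> real^'d) \<Rightarrow> nat \<Rightarrow> nat \<Rightarrow> ereal" where
  "hloc M a i j =
     1 / esssup (lebesgue_on (Omega M \<inter> (supp M a i \<inter> supp M a j)))
                (\<lambda>x. ereal (norm (grad (psi M a j) x)))"

definition hmin :: "'d::finite discretization \<Rightarrow> (nat \<Rightarrow> real^'d) \<Rightarrow> nat \<Rightarrow> ereal" where
  "hmin M a i = Min (hloc M a i ` nb M a i)"


section \<open>Artificial viscosity\<close>

text \<open>\<open>wave_speed R w c uL uR\<close> is the maximal wave speed for the flux \<open>ale_flux f w\<close> in the direction
  \<open>c / norm c\<close>, and zero if \<open>c = 0\<close>. In what follows \<open>I i\<close> is the set of neighbours of \<open>i\<close>.\<close>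

definition wave_speed :: "('m::finite, 'd::finite) riemann \<Rightarrow> real^'d \<Rightarrow> real^'d \<Rightarrow> real^'m \<Rightarrow> real^'m \<Rightarrow> real" where
  "wave_speed R w c uL uR = (if c = 0 then 0 else lam_max (ale_riemann w R) (sgn c) uL uR)"

definition visc_off ::
  "('m::finite, 'd::finite) riemann \<Rightarrow> (nat \<Rightarrow> nat set) \<Rightarrow> (nat \<Rightarrow> nat \<Rightarrow> real^'d) \<Rightarrow> (nat \<Rightarrow> real^'d) \<Rightarrow> (nat \<Rightarrow> real^'m)
   \<Rightarrow> nat \<Rightarrow> nat \<Rightarrow> real" where
  "visc_off R I c W U i j =
     (if j \<in> I i
      then max (wave_speed R (W j) (c i j) (U i) (U j) * norm (c i j))
               (wave_speed R (W i) (c j i) (U j) (U i) * norm (c j i))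
      else 0)"

definition visc ::
  "('m::finite, 'd::finite) riemann \<Rightarrow> (nat \<Rightarrow> nat set) \<Rightarrow> (nat \<Rightarrow> nat \<Rightarrow> real^'d) \<Rightarrow> (nat \<Rightarrow> real^'d) \<Rightarrow> (nat \<Rightarrow> real^'m)
   \<Rightarrow> nat \<Rightarrow> nat \<Rightarrow> real" where
  "visc R I c W U i j =
     (if i = j then - (\<Sum>k\<in>I i - {i}. visc_off R I c W U k i) else visc_off R I c W U i j)"

definition lam_i_max ::
  "('m::finite, 'd::finite) riemann \<Rightarrow> (nat \<Rightarrow> nat set) \<Rightarrow> (nat \<Rightarrow> nat \<Rightarrow> real^'d) \<Rightarrow> (nat \<Rightarrow> real^'d) \<Rightarrow> (nat \<Rightarrow> real^'m)
   \<Rightarrow> nat \<Rightarrow> real" where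
  "lam_i_max R I c W U i =
     Max ((\<lambda>j. max (wave_speed R (W j) (c i j) (U i) (U j))
                   (wave_speed R (W i) (c j i) (U j) (U i))) ` I i)"

definition scheme_update ::
  "(real^'m \<Rightarrow> real^'d^'m) \<Rightarrow> ('m::finite, 'd::finite) riemann \<Rightarrow> (nat \<Rightarrow> nat set) \<Rightarrow> (nat \<Rightarrow> nat \<Rightarrow> real^'d)
   \<Rightarrow> (nat \<Rightarrow> real^'d) \<Rightarrow> real \<Rightarrow> (nat \<Rightarrow> real) \<Rightarrow> (nat \<Rightarrow> real) \<Rightarrow> (nat \<Rightarrow> real^'m) \<Rightarrow> (nat \<Rightarrow> real^'m)
   \<Rightarrow> nat \<Rightarrow> bool" where
  "scheme_update f R I c W \<tau> m m' U U' i \<longleftrightarrow>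
     (1 / \<tau>) *\<^sub>R (m' i *\<^sub>R U' i - m i *\<^sub>R U i)
     + (\<Sum>j\<in>I i. ale_flux f (W j) (U j) *v c i j - visc R I c W U i j *\<^sub>R U j) = 0"

definition initial_data :: "'d::finite discretization \<Rightarrow> (nat \<Rightarrow> real^'m) \<Rightarrow> bool" where
  "initial_data M U \<longleftrightarrow> (bdry M = Cauchy \<longrightarrow> (\<exists>u. finite {j \<in> dofs M. U j \<noteq> u}))"


section \<open>Version 1\<close>

text \<open>Sequences are indexed by the time step; \<open>\<tau> k\<close> is the length of the step from \<open>k\<close> to \<open>k + 1\<close>,
  and \<open>mu k i\<close> is the approximate mass.\<close>

definition ale1_step ::
  "'d::finite discretization \<Rightarrow> (real^'m \<Rightarrow> real^'d^'m) \<Rightarrow> ('m::finite, 'd::finite) riemann \<Rightarrow> (nat \<Rightarrow> real)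
   \<Rightarrow> (nat \<Rightarrow> nat \<Rightarrow> real^'d) \<Rightarrow> (nat \<Rightarrow> nat \<Rightarrow> real^'d) \<Rightarrow> (nat \<Rightarrow> nat \<Rightarrow> real) \<Rightarrow> (nat \<Rightarrow> nat \<Rightarrow> real^'m)
   \<Rightarrow> nat \<Rightarrow> bool" where
  "ale1_step M f R \<tau> a W mu U k \<longleftrightarrow>
     0 < \<tau> k \<and> matching_mesh M (a k) \<and> matching_mesh M (a (Suc k)) \<and>
     (\<forall>g\<in>geo_dofs M. a (Suc k) g = a k g + \<tau> k *\<^sub>R velocity M (a k) (W k) (a k g)) \<and>
     (\<forall>i\<in>dofs M. 0 < mu k i \<and> 0 < mu (Suc k) i \<and>
        mu (Suc k) i = mu k i + \<tau> k * (LINT x:(Omega M \<inter> supp M (a k) i)|lebesgue.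
                                         psi M (a k) i x * dvg (velocity M (a k) (W k)) x)) \<and>
     (\<forall>i\<in>dofs M. scheme_update f R (nb M (a k)) (cvec M (a k)) (W k) (\<tau> k)
                   (mu k) (mu (Suc k)) (U k) (U (Suc k)) i)"

definition ale_version1 ::
  "'d::finite discretization \<Rightarrow> (real^'m \<Rightarrow> real^'d^'m) \<Rightarrow> ('m::finite, 'd::finite) riemann \<Rightarrow> (nat \<Rightarrow> real)
   \<Rightarrow> (nat \<Rightarrow> nat \<Rightarrow> real^'d) \<Rightarrow> (nat \<Rightarrow> nat \<Rightarrow> real^'d) \<Rightarrow> (nat \<Rightarrow> nat \<Rightarrow> real) \<Rightarrow> (nat \<Rightarrow> nat \<Rightarrow> real^'m)
   \<Rightarrow> nat \<Rightarrow> bool" where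
  "ale_version1 M f R \<tau> a W mu U n \<longleftrightarrow>
     initial_data M (U 0) \<and> (\<forall>i\<in>dofs M. mu 0 i = mass M (a 0) i) \<and>
     (\<forall>k\<le>n. ale1_step M f R \<tau> a W mu U k)"

definition kappa1 :: "'d::finite discretization \<Rightarrow> (nat \<Rightarrow> real^'d) \<Rightarrow> nat \<Rightarrow> real" where
  "kappa1 M a i =
     (\<Sum>j\<in>nb M a i - {i}. overlap_mass M a i j)
     / (LINT x:(Omega M \<inter> supp M a i)|lebesgue. psi M a i x)"


section \<open>Version 2\<close>

text \<open>The weights are nonnegative, so that the weighted sums of masses below are again masses, and the
  nodes lie in the unit interval, so that the mesh is defined at the quadrature times.\<close>

definition quadrature :: "nat set \<Rightarrow> (nat \<Rightarrow> real) \<Rightarrow> (nat \<Rightarrow> real) \<Rightarrow> nat \<Rightarrow> bool" where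
  "quadrature L \<omega> \<zeta> deg \<longleftrightarrow>
     finite L \<and> (\<forall>l\<in>L. 0 \<le> \<omega> l \<and> \<zeta> l \<in> {0..1}) \<and>
     (\<forall>p::real poly. degree p \<le> deg \<longrightarrow> (\<Sum>l\<in>L. \<omega> l * poly p (\<zeta> l)) = (LINT s:{0..1}|lborel. poly p s))"

text \<open>The geometric nodes at the time \<open>s\<close> after the beginning of the step.\<close>

definition move :: "(nat \<Rightarrow> real^'d) \<Rightarrow> (nat \<Rightarrow> real^'d) \<Rightarrow> real \<Rightarrow> nat \<Rightarrow> real^'d" where
  "move a Wgeo s g = a g + s *\<^sub>R Wgeo g"

definition motion_invertible ::
  "'d::finite discretization \<Rightarrow> (nat \<Rightarrow> real^'d) \<Rightarrow> (nat \<Rightarrow> real^'d) \<Rightarrow> bool" where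
  "motion_invertible M a b \<longleftrightarrow> (\<exists>\<Phi>. bij \<Phi> \<and>
     (\<forall>K\<in>cells M. \<forall>p\<in>pers M. \<forall>y\<in>cell_elt M K. \<Phi> (p + geo_map M a K y) = p + geo_map M b K y))"

definition cvec2 ::
  "'d::finite discretization \<Rightarrow> nat set \<Rightarrow> (nat \<Rightarrow> real) \<Rightarrow> (nat \<Rightarrow> nat \<Rightarrow> real^'d) \<Rightarrow> nat \<Rightarrow> nat \<Rightarrow> real^'d" where
  "cvec2 M L \<omega> aq i j = (\<Sum>l\<in>L. \<omega> l *\<^sub>R cvec M (aq l) i j)"

definition ale2_step ::
  "'d::finite discretization \<Rightarrow> (real^'m \<Rightarrow> real^'d^'m) \<Rightarrow> ('m::finite, 'd::finite) riemann \<Rightarrow> nat set \<Rightarrow> (nat \<Rightarrow> real)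
   \<Rightarrow> (nat \<Rightarrow> real) \<Rightarrow> (nat \<Rightarrow> real) \<Rightarrow> (nat \<Rightarrow> nat \<Rightarrow> real^'d) \<Rightarrow> (nat \<Rightarrow> nat \<Rightarrow> real^'d)
   \<Rightarrow> (nat \<Rightarrow> nat \<Rightarrow> real^'d) \<Rightarrow> (nat \<Rightarrow> nat \<Rightarrow> real^'m) \<Rightarrow> nat \<Rightarrow> bool" where
  "ale2_step M f R L \<omega> \<zeta> \<tau> a Wgeo W U k \<longleftrightarrow>
     0 < \<tau> k \<and>
     (\<forall>g\<in>geo_dofs M. a (Suc k) g = move (a k) (Wgeo k) (\<tau> k) g) \<and>
     (\<forall>g\<in>geo_dofs M. continuous_across_cells M (a k) (local_geo_shape M g)) \<and>
     (\<forall>x. geo_velocity M (a k) (Wgeo k) x = velocity M (a k) (W k) x) \<and>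
     (\<forall>s\<in>{0..\<tau> k}. matching_mesh M (move (a k) (Wgeo k) s) \<and>
        motion_invertible M (a k) (move (a k) (Wgeo k) s)) \<and>
     (\<forall>i\<in>dofs M. scheme_update f R (nb M (a k))
                   (cvec2 M L \<omega> (\<lambda>l. move (a k) (Wgeo k) (\<tau> k * \<zeta> l))) (W k) (\<tau> k)
                   (mass M (a k)) (mass M (a (Suc k))) (U k) (U (Suc k)) i)"

definition ale_version2 ::
  "'d::finite discretization \<Rightarrow> (real^'m \<Rightarrow> real^'d^'m) \<Rightarrow> ('m::finite, 'd::finite) riemann \<Rightarrow> nat set \<Rightarrow> (nat \<Rightarrow> real)
   \<Rightarrow> (nat \<Rightarrow> real) \<Rightarrow> (nat \<Rightarrow> real) \<Rightarrow> (nat \<Rightarrow> nat \<Rightarrow> real^'d) \<Rightarrow> (nat \<Rightarrow> nat \<Rightarrow> real^'d)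
   \<Rightarrow> (nat \<Rightarrow> nat \<Rightarrow> real^'d) \<Rightarrow> (nat \<Rightarrow> nat \<Rightarrow> real^'m) \<Rightarrow> nat \<Rightarrow> bool" where
  "ale_version2 M f R L \<omega> \<zeta> \<tau> a Wgeo W U n \<longleftrightarrow>
     initial_data M (U 0) \<and> geo_in_approx M \<and> quadrature L \<omega> \<zeta> (CARD('d) - 1) \<and>
     (\<forall>k\<le>n. ale2_step M f R L \<omega> \<zeta> \<tau> a Wgeo W U k)"

text \<open>Below, \<open>aq l\<close> are the geometric nodes at the \<open>l\<close>-th quadrature time.\<close>

definition quad_mass ::
  "'d::finite discretization \<Rightarrow> nat set \<Rightarrow> (nat \<Rightarrow> real) \<Rightarrow> (nat \<Rightarrow> nat \<Rightarrow> real^'d) \<Rightarrow> nat \<Rightarrow> real" where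
  "quad_mass M L \<omega> aq i = (\<Sum>l\<in>L. \<omega> l * mass M (aq l) i)"

definition hmin2 :: "'d::finite discretization \<Rightarrow> nat set \<Rightarrow> (nat \<Rightarrow> nat \<Rightarrow> real^'d) \<Rightarrow> nat \<Rightarrow> ereal" where
  "hmin2 M L aq i = Min ((\<lambda>l. hmin M (aq l) i) ` L)"

definition kappa2 ::
  "'d::finite discretization \<Rightarrow> nat set \<Rightarrow> (nat \<Rightarrow> real) \<Rightarrow> (nat \<Rightarrow> nat \<Rightarrow> real^'d) \<Rightarrow> nat set \<Rightarrow> nat \<Rightarrow> real" where
  "kappa2 M L \<omega> aq Ii i =
     (\<Sum>j\<in>Ii - {i}. \<Sum>l\<in>L. \<omega> l * overlap_mass M (aq l) i j) / quad_mass M L \<omega> aq i"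

text \<open>For version 1, \<open>ratio\<close> is \<open>mu n i / mu (n + 1) i\<close>. The denominator of \<open>kappa1\<close> is the exact mass
  \<open>mass M (a n) i\<close>, which may exceed the approximate mass \<open>mu n i\<close> when \<open>n > 0\<close>. The condition then does
  not control \<open>\<tau> * (\<Sum>j. d i j) / mu (n + 1) i\<close>, and the theorem requires it also with the exact mass in
  place of \<open>mu n i\<close>. This is automatic if the exact mass is at most \<open>mu n i\<close>, in particular if \<open>n = 0\<close>.\<close>

definition cfl :: "real \<Rightarrow> real \<Rightarrow> ereal \<Rightarrow> real \<Rightarrow> real \<Rightarrow> bool" where
  "cfl \<tau> lam h \<kappa> ratio \<longleftrightarrow> 2 * ereal \<tau> * (ereal lam / h) * ereal \<kappa> * ereal ratio \<le> 1"

end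

theory Submission
  imports Defs
begin

text \<open>The update of the scheme is linear in the old states and fluxes, and it treats every affine entropy
exactly: by conservation, \<open>\<Sum>j. c i j = 0\<close>, by the vanishing row sums of the viscosity and by the mass
balance \<open>m' = m + \<tau> * (\<Sum>j. c i j \<bullet> W j)\<close>, the inequality is an equality when \<open>\<eta>\<close> is affine and \<open>q\<close> is the
corresponding combination of the rows of \<open>f\<close>. Subtract from \<open>\<eta>\<close> its tangent at the new state. What
remains is an entropy pair with \<open>\<eta> \<ge> 0\<close> for which the new state contributes nothing, and the claim
becomes an inequality between the old states. Rearranged with the same three identities, it follows
from the edge inequalities
\<open>(q uR - q uL) \<bullet> c - (W j \<bullet> c) * (\<eta> uR - \<eta> uL) \<le> d i j * (\<eta> uL + \<eta> uR)\<close>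
and from \<open>2 * \<tau> * (\<Sum>j. d i j) \<le> m'\<close> (\<open>scheme_entropy_inequality\<close>).

The edge inequality is the entropy inequality of the Riemann solution, tested with a function that
does not depend on \<open>x\<close> in the moving frame inside the fan and decreases in time. Inside the fan the
entropy enters with a favourable sign because \<open>\<eta> \<ge> 0\<close>; outside, the solution equals one of its two
data and everything can be integrated (\<open>riemann_entropy_dissipation\<close>).

The bound on the viscosity is the CFL condition together with the estimate of \<open>norm (c i j)\<close> by the
overlap of the supports divided by the local mesh size. The viscosity also contains \<open>norm (c j i)\<close>,
and \<open>c j i = - c i j\<close> is an integration by parts (\<open>cvec_antisym\<close>). Shape functions are globally
Lipschitz and differentiable away from the images of the cell boundaries, so that the integral of a
partial derivative of \<open>\<psi>\<^sub>i * \<psi>\<^sub>j\<close> is the limit of integrals of difference quotients. These vanish,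
because the integral of a periodic function over a fundamental domain is invariant under
translations.

For version 1 the mass balance is the definition of the approximate masses. For version 2 it is the
geometric conservation law (\<open>mass_evolution\<close>): pulled back to the reference cells, the mass is the
integral of a fixed shape function against the absolute Jacobian determinant of the cell map at
time \<open>t\<close>. At each reference point this determinant is a polynomial in \<open>t\<close> of degree at most the
dimension, and it has no zero during the step, so the quadrature integrates the derivative of its
absolute value exactly; Jacobi's formula identifies this derivative with the divergence of the mesh
velocity.\<close>

section \<open>Cut-off functions in space and time\<close>

text \<open>The square makes this cut-off continuously differentiable, as test functions have to be.\<close>

definition pos_sq :: "real \<Rightarrow> real" where "pos_sq y = (max 0 y)\<^sup>2"

lemma pos_sq_deriv: "(pos_sq has_real_derivative 2 * max 0 y) (at y)"
proof -
  consider "y < 0" | "y = 0" | "y > 0" by linarith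
  then show ?thesis
  proof cases
    case 1
    have "((\<lambda>_. 0) has_real_derivative 0) (at y)" by simp
    then have "(pos_sq has_real_derivative 0) (at y)"
      by (rule has_field_derivative_transform_within_open[where S="{..<0}"])
         (use 1 in \<open>auto simp: pos_sq_def\<close>)
    then show ?thesis using 1 by simp
  next
    case 3
    have "((\<lambda>y. y^2) has_real_derivative 2 * y) (at y)"
      by (auto intro!: derivative_eq_intros)
    then have "(pos_sq has_real_derivative 2 * y) (at y)"
      by (rule has_field_derivative_transform_within_open[where S="{0<..}"])
         (use 3 in \<open>auto simp: pos_sq_def\<close>)
    then show ?thesis using 3 by simp
  next
    case 2
    have "((\<lambda>h. (pos_sq (0 + h) - pos_sq 0) / h) \<longlongrightarrow> 0) (at 0)"
    proof (rule Lim_null_comparison)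
      show "\<forall>\<^sub>F h in at 0. norm ((pos_sq (0 + h) - pos_sq 0) / h) \<le> \<bar>h\<bar>"
        by (rule always_eventually)
          (auto simp: pos_sq_def power2_eq_square max_def abs_mult)
      show "((\<lambda>h. \<bar>h\<bar>) \<longlongrightarrow> (0::real)) (at 0)"
        by (auto intro!: tendsto_eq_intros)
    qed
    then have "(pos_sq has_real_derivative 0) (at 0)"
      by (simp add: DERIV_def)
    then show ?thesis using 2 by simp
  qed
qed

lemmas pos_sq_deriv_chain [derivative_intros] = DERIV_chain2[OF pos_sq_deriv]

lemma continuous_pos_sq [continuous_intros]:
  "continuous_on S f \<Longrightarrow> continuous_on S (\<lambda>x. pos_sq (f x))"
  unfolding pos_sq_def by (intro continuous_intros)

lemma pos_sq_nonneg [simp]: "0 \<le> pos_sq y" and pos_sq_nonpos [simp]: "y \<le> 0 \<Longrightarrow> pos_sq y = 0"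
  by (auto simp: pos_sq_def)

definition space_cut :: "real \<Rightarrow> real \<Rightarrow> real" where
  "space_cut l y = pos_sq (1 - pos_sq (y - l) - pos_sq (- y - l))"

definition space_cut' :: "real \<Rightarrow> real \<Rightarrow> real" where
  "space_cut' l y = 4 * max 0 (1 - pos_sq (y - l) - pos_sq (- y - l)) * (max 0 (- y - l) - max 0 (y - l))"

definition time_cut :: "real \<Rightarrow> real" where "time_cut t = pos_sq (1 - t\<^sup>2)"

definition time_cut' :: "real \<Rightarrow> real" where "time_cut' t = - 4 * t * max 0 (1 - t\<^sup>2)"

lemma space_cut_deriv: "(space_cut l has_real_derivative space_cut' l y) (at y)"
  unfolding space_cut_def[abs_def] space_cut'_def
  by (auto intro!: derivative_eq_intros simp: algebra_simps)

lemma time_cut_deriv: "(time_cut has_real_derivative time_cut' t) (at t)"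
  unfolding time_cut_def[abs_def] time_cut'_def
  by (auto intro!: derivative_eq_intros simp: algebra_simps)

lemma space_cut_inside: "\<bar>y\<bar> \<le> l \<Longrightarrow> space_cut l y = 1" "\<bar>y\<bar> \<le> l \<Longrightarrow> space_cut' l y = 0"
  by (auto simp: space_cut_def space_cut'_def pos_sq_def)

lemma space_cut_arg: "0 \<le> l \<Longrightarrow> l + 1 \<le> \<bar>y\<bar> \<Longrightarrow> 1 - pos_sq (y - l) - pos_sq (- y - l) \<le> 0"
proof -
  assume l: "0 \<le> l" "l + 1 \<le> \<bar>y\<bar>"
  have "1 \<le> pos_sq z" if "1 \<le> z" for z
    using that by (simp add: pos_sq_def)
  then have "1 \<le> pos_sq (y - l) \<or> 1 \<le> pos_sq (- y - l)"
    using l by (metis abs_if add_le_imp_le_diff add.commute)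
  moreover have "0 \<le> pos_sq (y - l)" "0 \<le> pos_sq (- y - l)"
    by simp_all
  ultimately show ?thesis
    by linarith
qed

lemma space_cut_outside:
  "0 \<le> l \<Longrightarrow> l + 1 \<le> \<bar>y\<bar> \<Longrightarrow> space_cut l y = 0"
  "0 \<le> l \<Longrightarrow> l + 1 \<le> \<bar>y\<bar> \<Longrightarrow> space_cut' l y = 0"
  using space_cut_arg[of l y] by (auto simp: space_cut_def space_cut'_def max_def)

lemma time_cut_outside: "1 \<le> \<bar>t\<bar> \<Longrightarrow> time_cut t = 0" "1 \<le> \<bar>t\<bar> \<Longrightarrow> time_cut' t = 0"
proof -
  assume "1 \<le> \<bar>t\<bar>"
  then have "1 - t\<^sup>2 \<le> 0" by (simp add: abs_le_square_iff[of 1 t, simplified])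
  then show "time_cut t = 0" "time_cut' t = 0"
    by (auto simp: time_cut_def time_cut'_def max_def)
qed

lemma cut_nonneg: "0 \<le> space_cut l y" "0 \<le> time_cut t" "0 \<le> t \<Longrightarrow> time_cut' t \<le> 0"
  by (auto simp: space_cut_def time_cut_def time_cut'_def mult_nonneg_nonpos)

lemma cut_continuous [continuous_intros]:
  "continuous_on S f \<Longrightarrow> continuous_on S (\<lambda>x. space_cut l (f x))"
  "continuous_on S f \<Longrightarrow> continuous_on S (\<lambda>x. space_cut' l (f x))"
  "continuous_on S f \<Longrightarrow> continuous_on S (\<lambda>x. time_cut (f x))"
  "continuous_on S f \<Longrightarrow> continuous_on S (\<lambda>x. time_cut' (f x))"
  unfolding space_cut_def space_cut'_def time_cut_def time_cut'_def
  by (intro continuous_intros; assumption)+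

text \<open>Inside the cone \<open>\<bar>x - s * t\<bar> \<le> l * t\<close>, for \<open>0 \<le> t \<le> 1\<close>, only the time cut-off varies. The speed \<open>s\<close> is
that of the moving frame: testing with this function is testing the solution shifted by \<open>s * t\<close>
with a product.\<close>

definition fan_test :: "real \<Rightarrow> real \<Rightarrow> real \<times> real \<Rightarrow> real" where
  "fan_test l s z = space_cut l (fst z - s * snd z) * time_cut (snd z)"

lemma fan_test_deriv:
  "(fan_test l s has_derivative
     (\<lambda>h. space_cut' l (fst z - s * snd z) * (fst h - s * snd h) * time_cut (snd z)
        + space_cut l (fst z - s * snd z) * time_cut' (snd z) * snd h)) (at z)"
proof -
  have 1: "((\<lambda>z. space_cut l (fst z - s * snd z)) has_derivative
        (\<lambda>h. (fst h - s * snd h) * space_cut' l (fst z - s * snd z))) (at z)"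
    by (rule DERIV_compose_FDERIV[OF space_cut_deriv])
       (auto intro!: derivative_eq_intros)
  have 2: "((\<lambda>z. time_cut (snd z)) has_derivative (\<lambda>h. snd h * time_cut' (snd z))) (at z)"
    by (rule DERIV_compose_FDERIV[OF time_cut_deriv])
       (auto intro!: derivative_eq_intros)
  show ?thesis
    unfolding fan_test_def[abs_def]
    by (rule has_derivative_eq_rhs[OF has_derivative_mult[OF 1 2]])
       (auto simp: algebra_simps)
qed

lemma fan_test_frechet:
  "frechet_derivative (fan_test l s) (at z) h =
     space_cut' l (fst z - s * snd z) * (fst h - s * snd h) * time_cut (snd z)
     + space_cut l (fst z - s * snd z) * time_cut' (snd z) * snd h"
  by (rule fun_cong[OF frechet_derivative_at[OF fan_test_deriv], symmetric])

lemma fan_test_support: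
  assumes "0 \<le> l" "fan_test l s z \<noteq> 0"
  shows "z \<in> cbox (- (l + 1 + \<bar>s\<bar>), -1) (l + 1 + \<bar>s\<bar>, 1)"
proof -
  have t: "\<bar>snd z\<bar> < 1" and x: "\<bar>fst z - s * snd z\<bar> < l + 1"
    using assms space_cut_outside(1)[of l] time_cut_outside(1)
    by (force simp: fan_test_def not_less)+
  have "\<bar>s * snd z\<bar> \<le> \<bar>s\<bar> * 1"
    unfolding abs_mult by (rule mult_left_mono) (use t in auto)
  then show ?thesis
    using t x by (cases z) (auto simp: mem_box Basis_prod_def)
qed

lemma test_function_fan_test:
  assumes "0 \<le> l"
  shows "test_function (fan_test l s)"
  unfolding test_function_def
proof (intro conjI allI)
  show "C1_near (fan_test l s) UNIV"
    unfolding C1_near_def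
  proof (intro exI[of _ UNIV] conjI ballI allI)
    show "fan_test l s differentiable at z" for z
      using fan_test_deriv differentiable_def by blast
    show "continuous_on UNIV (\<lambda>z. frechet_derivative (fan_test l s) (at z) v)" for v
      unfolding fan_test_frechet by (intro continuous_intros)
  qed auto
  show "0 \<le> fan_test l s z" for z
    by (simp add: fan_test_def cut_nonneg)
  have "bounded {z. fan_test l s z \<noteq> 0}"
    by (rule bounded_subset[OF bounded_cbox]) (use fan_test_support[OF assms] in blast)
  then show "compact (closure {z. fan_test l s z \<noteq> 0})"
    by simp
qed

lemma integral_FTC_indicator:
  fixes F :: "real \<Rightarrow> real"
  assumes ab: "a \<le> b" and deriv: "\<And>x. (F has_real_derivative f x) (at x)" and cont: "continuous_on UNIV f"
  shows "integrable lborel (\<lambda>x. indicator {a..b} x * f x)"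
    and "(LINT x|lborel. indicator {a..b} x * f x) = F b - F a"
proof -
  have c: "continuous_on {a..b} f" using cont continuous_on_subset by blast
  have d: "(F has_vector_derivative f x) (at x within {a..b})" for x
    using has_field_derivative_at_within[OF deriv] by (simp add: has_real_derivative_iff_has_vector_derivative)
  show "integrable lborel (\<lambda>x. indicator {a..b} x * f x)"
    using borel_integrable_atLeastAtMost'[OF c] by (simp add: set_integrable_def)
  show "(LINT x|lborel. indicator {a..b} x * f x) = F b - F a"
    using integral_FTC_atLeastAtMost[OF ab d c] by simp
qed

section \<open>A space-time integral over a moving jump\<close>

lemma time_cut_integral: "(LINT t|lborel. indicator {0..1} t * time_cut t) = 8 / 15"
proof -
  define F :: "real \<Rightarrow> real" where "F t = t - 2 * t ^ 3 / 3 + t ^ 5 / 5" for t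
  have d: "(F has_real_derivative (1 - t\<^sup>2)\<^sup>2) (at t)" for t
    unfolding F_def[abs_def]
    by (auto intro!: derivative_eq_intros simp: power2_eq_square power3_eq_cube eval_nat_numeral algebra_simps)
  have "(LINT t|lborel. indicator {0..1} t * time_cut t) = (LINT t|lborel. indicator {0..1} t * (1 - t\<^sup>2)\<^sup>2)"
    by (intro Bochner_Integration.integral_cong)
       (auto simp: time_cut_def pos_sq_def indicator_def power_le_one)
  also have "\<dots> = F 1 - F 0"
    by (rule integral_FTC_indicator(2)[OF _ d]) (auto intro!: continuous_intros)
  finally show ?thesis by (simp add: F_def)
qed

lemma compact_support_integrable:
  fixes f :: "'a::euclidean_space \<Rightarrow> real"
  assumes "f \<in> borel_measurable borel" "bounded S" "S \<in> sets borel"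
    and "\<And>x. x \<notin> S \<Longrightarrow> f x = 0" and "\<And>x. x \<in> S \<Longrightarrow> \<bar>f x\<bar> \<le> C"
  shows "integrable lborel f"
proof (rule integrableI_bounded_set[where A=S and B=C])
  show "emeasure lborel S < \<infinity>"
    using emeasure_bounded_finite[OF assms(2)] by simp
qed (use assms in auto)

text \<open>The trace of the data on either side of the line \<open>x = s * t\<close>, in the moving coordinate
\<open>y = x - s * t\<close>.\<close>

definition jump :: "real \<Rightarrow> real \<Rightarrow> real \<Rightarrow> real" where
  "jump aL aR y = (if y < 0 then aL else aR)"

lemma jump_measurable [measurable]: "jump aL aR \<in> borel_measurable borel"
  unfolding jump_def[abs_def] by measurable

lemma jump_bound: "\<bar>jump aL aR y\<bar> \<le> \<bar>aL\<bar> + \<bar>aR\<bar>"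
  by (auto simp: jump_def)

lemma cut_measurable [measurable]:
  "space_cut l \<in> borel_measurable borel" "space_cut' l \<in> borel_measurable borel"
  "time_cut \<in> borel_measurable borel" "time_cut' \<in> borel_measurable borel"
  by (intro borel_measurable_continuous_onI continuous_intros)+

lemma cut_bounds:
  assumes "0 \<le> l"
  shows "\<exists>C\<ge>0. (\<forall>y. \<bar>space_cut l y\<bar> \<le> C) \<and> (\<forall>y. \<bar>space_cut' l y\<bar> \<le> C) \<and>
     (\<forall>t. \<bar>time_cut t\<bar> \<le> C) \<and> (\<forall>t. \<bar>time_cut' t\<bar> \<le> C)"
proof -
  have *: "\<exists>C\<ge>0. \<forall>y. \<bar>f y\<bar> \<le> C" if f: "continuous_on UNIV f" "\<And>y. r \<le> \<bar>y\<bar> \<Longrightarrow> f y = 0" for f :: "real \<Rightarrow> real" and r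
  proof -
    have "compact (f ` {-r..r})"
      using f(1) by (intro compact_continuous_image) (auto intro: continuous_on_subset)
    then obtain B where B: "\<And>z. z \<in> f ` {-r..r} \<Longrightarrow> norm z \<le> B"
      using compact_imp_bounded bounded_iff by metis
    define C where "C = max B 0"
    have C: "C \<ge> 0" "\<And>y. y \<in> {-r..r} \<Longrightarrow> \<bar>f y\<bar> \<le> C"
      using B by (fastforce simp: C_def)+
    have "\<bar>f y\<bar> \<le> C" for y
      using C(1) C(2)[of y] f(2)[of y] by (cases "r \<le> \<bar>y\<bar>") (force simp: not_le abs_less_iff)+
    then show ?thesis using C(1) by blast
  qed
  obtain C1 where C1: "C1 \<ge> 0" "\<forall>y. \<bar>space_cut l y\<bar> \<le> C1"
    using *[of "space_cut l" "l + 1"] space_cut_outside(1)[OF assms] cut_continuous(1)[OF continuous_on_id] by blast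
  obtain C2 where C2: "C2 \<ge> 0" "\<forall>y. \<bar>space_cut' l y\<bar> \<le> C2"
    using *[of "space_cut' l" "l + 1"] space_cut_outside(2)[OF assms] cut_continuous(2)[OF continuous_on_id] by blast
  obtain C3 where C3: "C3 \<ge> 0" "\<forall>y. \<bar>time_cut y\<bar> \<le> C3"
    using *[of "time_cut" "1"] time_cut_outside(1) cut_continuous(3)[OF continuous_on_id] by blast
  obtain C4 where C4: "C4 \<ge> 0" "\<forall>y. \<bar>time_cut' y\<bar> \<le> C4"
    using *[of "time_cut'" "1"] time_cut_outside(2) cut_continuous(4)[OF continuous_on_id] by blast
  show ?thesis
    using C1 C2 C3 C4 by (intro exI[of _ "max (max C1 C2) (max C3 C4)"]) (auto simp: le_max_iff_disj)
qed

text \<open>The cut-off rises from 0 to 1 on the left half-line and falls back on the right one.\<close>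

lemma jump_space_cut'_integral:
  assumes "0 \<le> l"
  shows "integrable lborel (\<lambda>y. jump cL cR y * space_cut' l y)"
    and "(LINT y|lborel. jump cL cR y * space_cut' l y) = cL - cR"
proof -
  let ?f = "\<lambda>y. cL * (indicator {-(l+1)..0} y * space_cut' l y) + cR * (indicator {0..l+1} y * space_cut' l y)"
  have c: "continuous_on UNIV (space_cut' l)"
    by (intro continuous_intros)
  note I = integral_FTC_indicator[OF _ space_cut_deriv c]
  have ae: "jump cL cR y * space_cut' l y = ?f y" if "y \<noteq> 0" for y
    using that space_cut_outside(2)[OF assms, of y] by (auto simp: jump_def indicator_def)
  have ae': "AE y in lborel. jump cL cR y * space_cut' l y = ?f y"
    using AE_lborel_singleton[of "0::real"] by eventually_elim (use ae in auto)
  have If: "integrable lborel ?f"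
    using I(1)[of "-(l+1)" 0] I(1)[of 0 "l+1"] assms
    by (intro Bochner_Integration.integrable_add integrable_mult_right) auto
  have "integrable lborel (\<lambda>y. jump cL cR y * space_cut' l y) \<longleftrightarrow> integrable lborel ?f"
    by (rule integrable_cong_AE[OF _ _ ae']) measurable
  with If show "integrable lborel (\<lambda>y. jump cL cR y * space_cut' l y)" by blast
  have "(LINT y|lborel. jump cL cR y * space_cut' l y) = (LINT y|lborel. ?f y)"
    by (rule integral_cong_AE[OF _ _ ae']) measurable
  also have "\<dots> = cL * (space_cut l 0 - space_cut l (-(l+1))) + cR * (space_cut l (l+1) - space_cut l 0)"
    using I[of "-(l+1)" 0] I[of 0 "l+1"] assms by simp
  also have "\<dots> = cL - cR"
    using assms by (simp add: space_cut_outside space_cut_inside)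
  finally show "(LINT y|lborel. jump cL cR y * space_cut' l y) = cL - cR" .
qed

lemma jump_cone_integral:
  assumes "0 \<le> r"
  shows "integrable lborel (\<lambda>y. jump aL aR y * indicator {-r..r} y)"
    and "(LINT y|lborel. jump aL aR y * indicator {-r..r} y) = r * (aL + aR)"
proof -
  have eq: "(\<lambda>y. jump aL aR y * indicator {-r..r} y) = (\<lambda>y. aL * indicator {-r..<0} y + aR * indicator {0..r} y)"
    by (auto simp: jump_def indicator_def fun_eq_iff)
  show "integrable lborel (\<lambda>y. jump aL aR y * indicator {-r..r} y)"
    unfolding eq by (intro Bochner_Integration.integrable_add integrable_mult_right integrable_real_indicator)
      (use assms in \<open>auto simp: emeasure_lborel_Ico emeasure_lborel_Icc_eq\<close>)
  have "integrable lborel (indicator {-r..<0} :: real \<Rightarrow> real)" "integrable lborel (indicator {0..r} :: real \<Rightarrow> real)"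
    using assms by (auto intro!: integrable_real_indicator simp: emeasure_lborel_Ico emeasure_lborel_Icc_eq)
  then show "(LINT y|lborel. jump aL aR y * indicator {-r..r} y) = r * (aL + aR)"
    unfolding eq using assms by (simp add: algebra_simps)
qed

lemma jump_space_cut_integrable:
  assumes "0 \<le> l" shows "integrable lborel (\<lambda>y. jump aL aR y * space_cut l y)"
proof -
  obtain C where C: "C \<ge> 0" "\<And>y. \<bar>space_cut l y\<bar> \<le> C"
    using cut_bounds[OF assms] by blast
  show ?thesis
  proof (rule compact_support_integrable[where S="{-(l+1)..l+1}" and C="(\<bar>aL\<bar> + \<bar>aR\<bar>) * C"])
    show "\<bar>jump aL aR y * space_cut l y\<bar> \<le> (\<bar>aL\<bar> + \<bar>aR\<bar>) * C" for y
      unfolding abs_mult by (rule mult_mono) (use C jump_bound in auto)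
  qed (use assms space_cut_outside(1)[OF assms] in \<open>auto simp: not_le\<close>)
qed

text \<open>Let \<open>a\<close> be the entropy and \<open>c\<close> the entropy flux in the frame moving with speed \<open>s\<close>. The first two terms
are the integrand of the entropy inequality for the function that jumps along \<open>x = s * t\<close>. The last
term removes the first one on the cone \<open>\<bar>x - s * t\<bar> \<le> l * t\<close>, where the second one is zero. The
difference is a majorant of the integrand for any solution that agrees with its data outside this
cone and has nonnegative entropy inside.\<close>

definition fan_bound :: "real \<Rightarrow> real \<Rightarrow> real \<Rightarrow> real \<Rightarrow> real \<Rightarrow> real \<Rightarrow> real \<times> real \<Rightarrow> real" where
  "fan_bound l s aL aR cL cR z = indicator {0<..} (snd z) *
     (jump aL aR (fst z - s * snd z) * (space_cut l (fst z - s * snd z) * time_cut' (snd z))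
      + jump cL cR (fst z - s * snd z) * (space_cut' l (fst z - s * snd z) * time_cut (snd z))
      - jump aL aR (fst z - s * snd z) * indicator {- (l * snd z)..l * snd z} (fst z - s * snd z) * time_cut' (snd z))"

lemma fan_bound_measurable [measurable]: "fan_bound l s aL aR cL cR \<in> borel_measurable borel"
proof -
  have eq: "fan_bound l s aL aR cL cR = (\<lambda>z. indicator {0<..} (snd z) *
     (jump aL aR (fst z - s * snd z) * (space_cut l (fst z - s * snd z) * time_cut' (snd z))
      + jump cL cR (fst z - s * snd z) * (space_cut' l (fst z - s * snd z) * time_cut (snd z))
      - jump aL aR (fst z - s * snd z) * (if \<bar>fst z - s * snd z\<bar> \<le> l * snd z then 1 else 0) * time_cut' (snd z)))"
    by (auto simp: fan_bound_def fun_eq_iff indicator_def abs_le_iff)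
  have "(\<lambda>z. indicator {0<..} (snd z) *
     (jump aL aR (fst z - s * snd z) * (space_cut l (fst z - s * snd z) * time_cut' (snd z))
      + jump cL cR (fst z - s * snd z) * (space_cut' l (fst z - s * snd z) * time_cut (snd z))
      - jump aL aR (fst z - s * snd z) * (if \<bar>fst z - s * snd z\<bar> \<le> l * snd z then 1 else 0) * time_cut' (snd z)))
    \<in> borel_measurable (borel \<Otimes>\<^sub>M borel)"
    by measurable
  then show ?thesis by (simp add: eq borel_prod)
qed

lemma fan_bound_integrable:
  assumes l: "0 \<le> l" shows "integrable lborel (fan_bound l s aL aR cL cR)"
proof -
  obtain C where C: "C \<ge> 0" "\<And>y. \<bar>space_cut l y\<bar> \<le> C" "\<And>y. \<bar>space_cut' l y\<bar> \<le> C"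
     "\<And>y. \<bar>time_cut y\<bar> \<le> C" "\<And>y. \<bar>time_cut' y\<bar> \<le> C"
    using cut_bounds[OF l] by blast
  let ?A = "\<bar>aL\<bar> + \<bar>aR\<bar>" and ?D = "\<bar>cL\<bar> + \<bar>cR\<bar>"
  let ?S = "cbox (- (l + 1 + \<bar>s\<bar>), -1) (l + 1 + \<bar>s\<bar>, 1) :: (real \<times> real) set"
  show ?thesis
  proof (rule compact_support_integrable[where S="?S" and C="?A * (C * C) + ?D * (C * C) + ?A * 1 * C"])
    fix z :: "real \<times> real"
    let ?y = "fst z - s * snd z"
    have 1: "\<bar>jump aL aR ?y * (space_cut l ?y * time_cut' (snd z))\<bar> \<le> ?A * (C * C)"
      unfolding abs_mult by (intro mult_mono) (use C jump_bound in auto)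
    have 2: "\<bar>jump cL cR ?y * (space_cut' l ?y * time_cut (snd z))\<bar> \<le> ?D * (C * C)"
      unfolding abs_mult by (intro mult_mono) (use C jump_bound in auto)
    have 3: "\<bar>jump aL aR ?y * indicator {- (l * snd z)..l * snd z} ?y * time_cut' (snd z)\<bar> \<le> ?A * 1 * C"
      unfolding abs_mult by (intro mult_mono) (use C jump_bound in \<open>auto simp: indicator_def\<close>)
    have "\<bar>indicator {0<..} (snd z) * (X + Y - Z)\<bar> \<le> \<bar>X\<bar> + \<bar>Y\<bar> + \<bar>Z\<bar>" for X Y Z :: real
      by (auto simp: indicator_def)
    from this[of "jump aL aR ?y * (space_cut l ?y * time_cut' (snd z))"
        "jump cL cR ?y * (space_cut' l ?y * time_cut (snd z))"
        "jump aL aR ?y * indicator {- (l * snd z)..l * snd z} ?y * time_cut' (snd z)"]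
    show "\<bar>fan_bound l s aL aR cL cR z\<bar> \<le> ?A * (C * C) + ?D * (C * C) + ?A * 1 * C"
      unfolding fan_bound_def using 1 2 3 by linarith
  next
    fix z :: "real \<times> real" assume z: "z \<notin> ?S"
    let ?y = "fst z - s * snd z"
    show "fan_bound l s aL aR cL cR z = 0"
    proof (cases "\<bar>snd z\<bar> < 1")
      case False
      then show ?thesis by (simp add: fan_bound_def time_cut_outside)
    next
      case True
      have "\<bar>s * snd z\<bar> \<le> \<bar>s\<bar> * 1"
        unfolding abs_mult by (rule mult_left_mono) (use True in auto)
      then have y: "l + 1 \<le> \<bar>?y\<bar>"
        using z True by (cases z) (auto simp: mem_box Basis_prod_def)
      have "l * snd z \<le> l * 1"
        by (rule mult_left_mono) (use True l in auto)
      then have "?y \<notin> {- (l * snd z)..l * snd z}"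
        using y by auto
      then show ?thesis
        using y l by (simp add: fan_bound_def space_cut_outside)
    qed
  qed auto
qed

text \<open>For fixed \<open>t\<close> the jump is stationary in \<open>y = x - s * t\<close>, and the cone contributes \<open>l * t * (aL + aR)\<close>
times the time derivative of the cut-off. Since \<open>- t * time_cut' t\<close> and \<open>time_cut t\<close> have the same
integral over \<open>{0..1}\<close>, the speed \<open>l\<close> and the flux jump \<open>cL - cR\<close> receive the same factor. A cone
that widens with \<open>t\<close> thus gives the speed \<open>l\<close> itself as constant, whatever the profile in time.\<close>

lemma fan_bound_integral:
  assumes l: "0 \<le> l"
  shows "(LINT z|lborel. fan_bound l s aL aR cL cR z) + (LINT y|lborel. jump aL aR y * space_cut l y)
     = 8 / 15 * (cL - cR + l * (aL + aR))"
proof -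
  define A where "A = (LINT y|lborel. jump aL aR y * space_cut l y)"
  have inner: "(LINT x|lborel. fan_bound l s aL aR cL cR (x, t)) =
      indicator {0<..} t * (A * time_cut' t + (cL - cR) * time_cut t - l * (aL + aR) * (t * time_cut' t))" for t
  proof (cases "0 < t")
    case True
    have "(LINT x|lborel. fan_bound l s aL aR cL cR (x, t)) = (LINT y|lborel. fan_bound l s aL aR cL cR (s * t + y, t))"
      using lborel_integral_real_affine[of 1 "\<lambda>x. fan_bound l s aL aR cL cR (x, t)" "s * t"] by simp
    also have "\<dots> = (LINT y|lborel. (jump aL aR y * space_cut l y) * time_cut' t
        + (jump cL cR y * space_cut' l y) * time_cut t
        - (jump aL aR y * indicator {- (l * t)..l * t} y) * time_cut' t)"
      using True by (intro Bochner_Integration.integral_cong) (auto simp: fan_bound_def)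
    also have "\<dots> = A * time_cut' t + (cL - cR) * time_cut t - l * t * (aL + aR) * time_cut' t"
    proof -
      have 0: "0 \<le> l * t" using l True by simp
      show ?thesis
        using jump_space_cut_integrable[OF l, of aL aR] jump_space_cut'_integral[OF l, of cL cR]
          jump_cone_integral[OF 0, of aL aR]
        by (simp add: A_def)
    qed
    finally show ?thesis using True by (simp add: algebra_simps)
  qed (simp add: fan_bound_def)
  have I: "integrable (lborel \<Otimes>\<^sub>M lborel) (\<lambda>(x, t). fan_bound l s aL aR cL cR (x, t))"
    using fan_bound_integrable[OF l, of s aL aR cL cR] by (simp add: lborel_prod)
  have "(LINT z|lborel. fan_bound l s aL aR cL cR z) = (LINT t|lborel. LINT x|lborel. fan_bound l s aL aR cL cR (x, t))"
    using lborel_pair.integral_snd[OF I] by (simp add: lborel_prod)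
  also have "\<dots> = (LINT t|lborel. indicator {0..1} t * ((A - l * (aL + aR) * t) * time_cut' t - l * (aL + aR) * time_cut t)
       + (cL - cR + l * (aL + aR)) * (indicator {0..1} t * time_cut t))"
    unfolding inner
  proof (rule integral_cong_AE)
    show "AE t in lborel. indicator {0<..} t * (A * time_cut' t + (cL - cR) * time_cut t - l * (aL + aR) * (t * time_cut' t))
      = indicator {0..1} t * ((A - l * (aL + aR) * t) * time_cut' t - l * (aL + aR) * time_cut t)
       + (cL - cR + l * (aL + aR)) * (indicator {0..1} t * time_cut t)"
      using AE_lborel_singleton[of "0::real"]
    proof eventually_elim
      case (elim t)
      then show ?case
        by (auto simp: indicator_def time_cut_outside algebra_simps)
    qed
  qed measurable
  also have "\<dots> = - A + (cL - cR + l * (aL + aR)) * (8 / 15)"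
  proof -
    have d: "((\<lambda>t. (A - l * (aL + aR) * t) * time_cut t) has_real_derivative
       ((A - l * (aL + aR) * t) * time_cut' t - l * (aL + aR) * time_cut t)) (at t)" for t
      by (auto intro!: derivative_eq_intros time_cut_deriv simp: algebra_simps)
    have "continuous_on UNIV (\<lambda>t. (A - l * (aL + aR) * t) * time_cut' t - l * (aL + aR) * time_cut t)"
      by (intro continuous_intros)
    note I1 = integral_FTC_indicator[OF zero_le_one d this]
    have v: "time_cut 1 = 0" "time_cut 0 = 1" by (simp_all add: time_cut_outside time_cut_def pos_sq_def)
    have "integrable lborel (\<lambda>t. indicator {0..1} t * time_cut t)"
      using borel_integrable_atLeastAtMost'[of 0 1 time_cut]
      by (simp add: set_integrable_def continuous_intros)
    then show ?thesis
      using I1 v by (simp add: time_cut_integral)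
  qed
  finally show ?thesis by (simp add: A_def algebra_simps)
qed

section \<open>Entropy dissipation in a Riemann fan\<close>

text \<open>The speeds bound the fan at each fixed time; Fubini's theorem turns this into a statement about
almost every point of space-time, which is what the entropy inequality sees.\<close>

lemma AE_outside_fan:
  fixes u :: "real \<times> real \<Rightarrow> 'a::euclidean_space"
  assumes meas: "u \<in> borel_measurable borel" and ll: "lL \<ge> s - l" "lR \<le> s + l"
    and fan: "\<And>t. 0 < t \<Longrightarrow> AE x in lborel. (x \<le> t * lL \<longrightarrow> u (x, t) = uL) \<and> (t * lR \<le> x \<longrightarrow> u (x, t) = uR)"
  shows "AE z in lborel. 0 < snd z \<longrightarrow>
     (fst z - s * snd z < - (l * snd z) \<longrightarrow> u z = uL) \<and> (l * snd z < fst z - s * snd z \<longrightarrow> u z = uR)"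
proof -
  let ?P = "\<lambda>z. 0 < snd z \<longrightarrow>
     (fst z - s * snd z < - (l * snd z) \<longrightarrow> u z = uL) \<and> (l * snd z < fst z - s * snd z \<longrightarrow> u z = uR)"
  have um [measurable]: "u \<in> borel_measurable (borel \<Otimes>\<^sub>M borel)"
    using meas by (simp add: borel_prod)
  have 1: "Measurable.pred (borel \<Otimes>\<^sub>M borel) (\<lambda>z. u z = c)" for c
    by (rule pred_eq_const1[OF um]) simp
  have 2: "Measurable.pred (borel \<Otimes>\<^sub>M borel) (\<lambda>z::real \<times> real. 0 < snd z)"
    and 3: "Measurable.pred (borel \<Otimes>\<^sub>M borel) (\<lambda>z::real \<times> real. fst z - s * snd z < - (l * snd z))"
    and 4: "Measurable.pred (borel \<Otimes>\<^sub>M borel) (\<lambda>z::real \<times> real. l * snd z < fst z - s * snd z)"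
    unfolding pred_def borel_prod
    by (simp_all add: borel_open open_Collect_less continuous_intros)
  have "Measurable.pred (borel \<Otimes>\<^sub>M borel) ?P"
    by (intro pred_intros_logic 1 2 3 4)
  then have "{z \<in> space (borel \<Otimes>\<^sub>M borel). ?P z} \<in> sets (borel \<Otimes>\<^sub>M borel)"
    by (simp add: pred_def)
  then have S: "{z \<in> space (lborel \<Otimes>\<^sub>M lborel). ?P z} \<in> sets (lborel \<Otimes>\<^sub>M lborel)"
    by (simp add: space_pair_measure cong: sets_pair_measure_cong)
  have "AE t in lborel. AE x in lborel. ?P (x, t)"
  proof (rule AE_I2)
    fix t :: real
    show "AE x in lborel. ?P (x, t)"
    proof (cases "0 < t")
      case True
      have L: "x \<le> t * lL" if "x - s * t < - (l * t)" for x
        using that mult_left_mono[OF ll(1), of t] True by (simp add: algebra_simps)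
      have R: "t * lR \<le> x" if "l * t < x - s * t" for x
        using that mult_left_mono[OF ll(2), of t] True by (simp add: algebra_simps)
      show ?thesis
        using fan[OF True]
      proof eventually_elim
        case (elim x)
        then show ?case using L[of x] R[of x] by fastforce
      qed
    qed simp
  qed
  then have "AE x in lborel. AE t in lborel. ?P (x, t)"
    by (rule iffD2[OF lborel_pair.AE_commute[where P="\<lambda>x t. ?P (x, t)"], rotated])
       (simp only: prod.collapse S)
  then have "AE z in lborel \<Otimes>\<^sub>M lborel. ?P z"
    by (rule lborel_pair.AE_pair_measure[OF S])
  then show ?thesis by (simp only: lborel_prod)
qed

lemma entropy_pair_continuous:
  assumes "entropy_pair f \<eta> q"
  shows "continuous_on UNIV \<eta>" "continuous_on UNIV q"
  using assms unfolding entropy_pair_def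
  by (auto intro!: differentiable_imp_continuous_on simp: differentiable_on_def)

text \<open>The integrand of the entropy inequality lies below \<open>fan_bound\<close>: outside the cone of speed \<open>l\<close> around
the line \<open>x = (w \<bullet> n) * t\<close> the two agree, and inside the cone the integrand is the entropy times the
derivative of a decreasing function.\<close>

lemma riemann_entropy_dissipation:
  fixes R :: "('m::finite, 'd::finite) riemann" and w n :: "real^'d"
  assumes R: "riemann_solvable f R" and ent: "entropy_pair f \<eta> q"
    and adm: "uL \<in> adm R" "uR \<in> adm R" and n: "norm n = 1"
    and nonneg: "\<And>v. 0 \<le> \<eta> v" and l: "lam_max (ale_riemann w R) n uL uR \<le> l"
  shows "(q uR - q uL) \<bullet> n - (w \<bullet> n) * (\<eta> uR - \<eta> uL) \<le> l * (\<eta> uL + \<eta> uR)"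
proof -
  define u where "u = sol R n uL uR"
  define s where "s = w \<bullet> n"
  define P where "P = {z :: real \<times> real. 0 < snd z}"
  have sol: "entropy_solution f n uL uR u"
    and fan: "\<And>t. 0 < t \<Longrightarrow> AE x in lborel. (x \<le> t * lamL R n uL uR \<longrightarrow> u (x, t) = uL) \<and> (t * lamR R n uL uR \<le> x \<longrightarrow> u (x, t) = uR)"
    using R adm n unfolding riemann_solvable_def u_def by blast+
  have ll: "lamL R n uL uR \<ge> s - l" "lamR R n uL uR \<le> s + l" and l0: "0 \<le> l"
    using l unfolding lam_max_def ale_riemann_def s_def by (simp_all add: abs_le_iff)
  have um [measurable]: "u \<in> borel_measurable borel" and ub: "bounded (u ` P)"
    using sol by (auto simp: entropy_solution_def P_def)
  note cont = entropy_pair_continuous[OF ent]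
  have [measurable]: "\<eta> \<in> borel_measurable borel" "q \<in> borel_measurable borel"
    using cont by (auto intro: borel_measurable_continuous_onI)
  define \<phi>t where "\<phi>t z = frechet_derivative (fan_test l s) (at z) (0, 1)" for z
  define \<phi>x where "\<phi>x z = frechet_derivative (fan_test l s) (at z) (1, 0)" for z
  define G where "G z = indicator P z * (\<eta> (u z) * \<phi>t z + (q (u z) \<bullet> n) * \<phi>x z)" for z
  define K where "K = fan_bound l s (\<eta> uL) (\<eta> uR) (q uL \<bullet> n - s * \<eta> uL) (q uR \<bullet> n - s * \<eta> uR)"
  have entropy: "0 \<le> (LINT z|lborel. G z) + (LINT x|lborel. \<eta> (riemann_data uL uR x) * fan_test l s (x, 0))"
    using sol ent test_function_fan_test[OF l0, of s]
    unfolding entropy_solution_def set_lebesgue_integral_def G_def P_def \<phi>t_def \<phi>x_def by simp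
  have init: "(LINT x|lborel. \<eta> (riemann_data uL uR x) * fan_test l s (x, 0)) = (LINT y|lborel. jump (\<eta> uL) (\<eta> uR) y * space_cut l y)"
    by (intro Bochner_Integration.integral_cong)
       (auto simp: riemann_data_def jump_def fan_test_def time_cut_def pos_sq_def)
  have \<phi>t: "\<phi>t z = space_cut l (fst z - s * snd z) * time_cut' (snd z) - s * (space_cut' l (fst z - s * snd z) * time_cut (snd z))"
    and \<phi>x: "\<phi>x z = space_cut' l (fst z - s * snd z) * time_cut (snd z)" for z
    by (simp_all add: \<phi>t_def \<phi>x_def fan_test_frechet)
  have cont\<phi>: "continuous_on UNIV \<phi>t" "continuous_on UNIV \<phi>x"
    unfolding \<phi>t[abs_def] \<phi>x[abs_def] by (intro continuous_intros)+
  then have [measurable]: "\<phi>t \<in> borel_measurable borel" "\<phi>x \<in> borel_measurable borel"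
    by (auto intro: borel_measurable_continuous_onI)
  let ?S = "cbox (- (l + 1 + \<bar>s\<bar>), -1) (l + 1 + \<bar>s\<bar>, 1) :: (real \<times> real) set"
  have supp: "\<phi>t z = 0 \<and> \<phi>x z = 0" if z: "z \<notin> ?S" for z
  proof (cases "\<bar>snd z\<bar> < 1")
    case True
    have "\<bar>s * snd z\<bar> \<le> \<bar>s\<bar> * 1"
      unfolding abs_mult by (rule mult_left_mono) (use True in auto)
    then have "l + 1 \<le> \<bar>fst z - s * snd z\<bar>"
      using z True by (cases z) (auto simp: mem_box Basis_prod_def)
    then show ?thesis using space_cut_outside[OF l0] by (simp add: \<phi>t \<phi>x)
  qed (simp add: \<phi>t \<phi>x time_cut_outside)
  have bd: "\<exists>C. \<forall>z\<in>T. \<bar>h (g z)\<bar> \<le> C"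
    if "bounded (g ` T)" "continuous_on UNIV h" for h :: "'b::euclidean_space \<Rightarrow> real" and g :: "'c \<Rightarrow> 'b" and T
  proof -
    have "compact (h ` closure (g ` T))"
      using that by (intro compact_continuous_image) (auto intro: continuous_on_subset)
    then obtain C where C: "\<And>y. y \<in> h ` closure (g ` T) \<Longrightarrow> norm y \<le> C"
      using compact_imp_bounded bounded_iff by metis
    have "\<bar>h (g z)\<bar> \<le> C" if "z \<in> T" for z
      using C[of "h (g z)"] that closure_subset[of "g ` T"] by auto
    then show ?thesis by blast
  qed
  obtain C1 where C1: "\<And>z. z \<in> P \<Longrightarrow> \<bar>\<eta> (u z)\<bar> \<le> C1"
    using bd[OF ub cont(1)] by blast
  have "continuous_on UNIV (\<lambda>v. q v \<bullet> n)"
    using cont(2) by (intro continuous_intros)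
  then obtain C2 where C2: "\<And>z. z \<in> P \<Longrightarrow> \<bar>q (u z) \<bullet> n\<bar> \<le> C2"
    using bd[OF ub] by blast
  have bS: "bounded (id ` ?S)" by simp
  obtain C3 where C3: "\<And>z. z \<in> ?S \<Longrightarrow> \<bar>\<phi>t z\<bar> \<le> C3"
    using bd[OF bS cont\<phi>(1)] by auto
  obtain C4 where C4: "\<And>z. z \<in> ?S \<Longrightarrow> \<bar>\<phi>x z\<bar> \<le> C4"
    using bd[OF bS cont\<phi>(2)] by auto
  have Pm [measurable]: "P \<in> sets borel"
    unfolding P_def by (intro borel_open open_Collect_less continuous_intros)
  have outside: "AE z in lborel. 0 < snd z \<longrightarrow>
     (fst z - s * snd z < - (l * snd z) \<longrightarrow> u z = uL) \<and> (l * snd z < fst z - s * snd z \<longrightarrow> u z = uR)"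
    by (rule AE_outside_fan[OF um ll]) (rule fan)
  have intG: "integrable lborel G"
  proof (rule compact_support_integrable[where S="?S" and C="max 0 (C1 * C3 + C2 * C4)"])
    show "G \<in> borel_measurable borel" unfolding G_def by measurable
    fix z assume z: "z \<in> ?S"
    show "\<bar>G z\<bar> \<le> max 0 (C1 * C3 + C2 * C4)"
    proof (cases "z \<in> P")
      case True
      have "\<bar>\<eta> (u z) * \<phi>t z\<bar> \<le> C1 * C3" "\<bar>(q (u z) \<bullet> n) * \<phi>x z\<bar> \<le> C2 * C4"
        unfolding abs_mult by (intro mult_mono; use C1[OF True] C2[OF True] C3[OF z] C4[OF z] in linarith)+
      then show ?thesis using True by (simp add: G_def)
    qed (simp add: G_def)
  qed (use supp in \<open>auto simp: G_def\<close>)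
  \<comment> \<open>With \<open>y = x - s * t\<close>, the cases are: the time cut-off vanishes; the cone, where the entropy has a sign;
  the two sides of the cone, where the solution equals its data.\<close>
  have "(LINT z|lborel. G z) \<le> (LINT z|lborel. K z)"
  proof (rule integral_mono_AE[OF intG])
    show "integrable lborel K"
      unfolding K_def by (rule fan_bound_integrable[OF l0])
    show "AE z in lborel. G z \<le> K z"
      using outside
    proof eventually_elim
      case (elim z)
      let ?y = "fst z - s * snd z" and ?t = "snd z"
      show "G z \<le> K z"
      proof (cases "0 < ?t")
        case False
        then show ?thesis by (simp add: G_def K_def fan_bound_def P_def)
      next
        case t: True
        have lt: "0 \<le> l * ?t" using t l0 by simp
        consider "1 \<le> ?t" | "?t < 1" "\<bar>?y\<bar> \<le> l * ?t" | "?y < - (l * ?t)" | "l * ?t < ?y"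
          by linarith
        then show ?thesis
        proof cases
          case 1
          then show ?thesis by (simp add: G_def K_def fan_bound_def \<phi>t \<phi>x time_cut_outside)
        next
          case 2
          have "l * ?t \<le> l * 1"
            by (rule mult_left_mono) (use 2 l0 in auto)
          then have y: "\<bar>?y\<bar> \<le> l" using 2 by linarith
          have "G z = \<eta> (u z) * time_cut' ?t"
            using t y by (simp add: G_def P_def \<phi>t \<phi>x space_cut_inside)
          also have "\<dots> \<le> 0"
            using nonneg cut_nonneg(3)[of ?t] t by (simp add: mult_nonneg_nonpos)
          also have "0 = K z"
            using t y 2 by (simp add: K_def fan_bound_def space_cut_inside abs_le_iff)
          finally show ?thesis .
        next
          case 3
          have "u z = uL" using elim t 3 by blast
          moreover have "?y < 0" using 3 lt by linarith
          ultimately have "G z = K z"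
            using 3 t by (simp add: G_def K_def P_def fan_bound_def jump_def \<phi>t \<phi>x algebra_simps)
          then show ?thesis by simp
        next
          case 4
          have "u z = uR" using elim t 4 by blast
          moreover have "\<not> ?y < 0" using 4 lt by linarith
          ultimately have "G z = K z"
            using 4 t by (simp add: G_def K_def P_def fan_bound_def jump_def \<phi>t \<phi>x algebra_simps)
          then show ?thesis by simp
        qed
      qed
    qed
  qed
  with entropy init fan_bound_integral[OF l0, of s "\<eta> uL" "\<eta> uR" "q uL \<bullet> n - s * \<eta> uL" "q uR \<bullet> n - s * \<eta> uR"]
  have "0 \<le> 8 / 15 * ((q uL \<bullet> n - s * \<eta> uL) - (q uR \<bullet> n - s * \<eta> uR) + l * (\<eta> uL + \<eta> uR))"
    unfolding K_def by linarith
  then have "0 \<le> (q uL \<bullet> n - s * \<eta> uL) - (q uR \<bullet> n - s * \<eta> uR) + l * (\<eta> uL + \<eta> uR)"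
    using zero_le_mult_iff[of "8 / 15 :: real"] by simp
  then show ?thesis
    by (simp add: s_def inner_diff_left algebra_simps)
qed

section \<open>Lipschitz functions and difference quotients\<close>

lemma C1_near_differentiable: "C1_near g S \<Longrightarrow> x \<in> S \<Longrightarrow> g differentiable (at x)"
  unfolding C1_near_def by blast

lemma C1_near_continuous: "C1_near g S \<Longrightarrow> continuous_on S g"
  by (meson C1_near_differentiable continuous_at_imp_continuous_on differentiable_imp_continuous_within)

text \<open>The directional derivatives are continuous, hence bounded near \<open>x\<close>, and finitely many of them
control the derivative in every direction.\<close>

lemma C1_near_lipschitz_ball:
  fixes g :: "'a::euclidean_space \<Rightarrow> 'b::real_normed_vector"
  assumes g: "C1_near g S" and x: "x \<in> S"
  obtains r C where "0 < r" "C-lipschitz_on (cball x r) g"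
proof -
  obtain V where V: "open V" "S \<subseteq> V" and d: "\<And>y. y \<in> V \<Longrightarrow> g differentiable (at y)"
    and c: "\<And>v. continuous_on V (\<lambda>y. frechet_derivative g (at y) v)"
    using g unfolding C1_near_def by blast
  have ev: "\<forall>\<^sub>F y in nhds x. norm (frechet_derivative g (at y) b) < norm (frechet_derivative g (at x) b) + 1" for b
  proof -
    have "isCont (\<lambda>y. frechet_derivative g (at y) b) x"
      using c[of b] V x by (metis continuous_on_eq_continuous_at subsetD)
    then have "((\<lambda>y. norm (frechet_derivative g (at y) b)) \<longlongrightarrow> norm (frechet_derivative g (at x) b)) (nhds x)"
      by (intro tendsto_norm) (simp add: continuous_at tendsto_at_iff_tendsto_nhds[of "\<lambda>y. frechet_derivative g (at y) b", symmetric])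
    then show ?thesis by (rule order_tendstoD) simp
  qed
  have "\<forall>\<^sub>F y in nhds x. y \<in> V \<and> (\<forall>b\<in>Basis. norm (frechet_derivative g (at y) b) < norm (frechet_derivative g (at x) b) + 1)"
    using ev V x by (auto intro!: eventually_conj eventually_ball_finite eventually_nhds_in_open)
  then obtain e where e: "e > 0" and *: "\<And>y. dist y x < e \<Longrightarrow> y \<in> V \<and> (\<forall>b\<in>Basis. norm (frechet_derivative g (at y) b) < norm (frechet_derivative g (at x) b) + 1)"
    unfolding eventually_nhds_metric by blast
  define C where "C = (\<Sum>b\<in>Basis. norm (frechet_derivative g (at x) b) + 1)"
  have "C-lipschitz_on (cball x (e/2)) g"
  proof (rule lipschitz_onI)
    show "0 \<le> C" unfolding C_def by (intro sum_nonneg) simp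
    fix y z assume yz: "y \<in> cball x (e/2)" "z \<in> cball x (e/2)"
    have near: "dist y x < e" if "y \<in> cball x (e/2)" for y
      using that e by (simp add: dist_commute)
    have "norm (g y - g z) \<le> C * norm (y - z)"
    proof (rule differentiable_bound[OF convex_cball _ _ yz])
      fix y assume y: "y \<in> cball x (e/2)"
      have D: "(g has_derivative frechet_derivative g (at y)) (at y)"
        using d *[OF near[OF y]] frechet_derivative_works by blast
      then show "(g has_derivative frechet_derivative g (at y)) (at y within cball x (e/2))"
        by (rule has_derivative_at_withinI)
      have lin: "linear (frechet_derivative g (at y))"
        using D has_derivative_linear by blast
      show "onorm (frechet_derivative g (at y)) \<le> C"
      proof (rule onorm_le)
        fix v :: 'a
        have "frechet_derivative g (at y) v = (\<Sum>b\<in>Basis. (v \<bullet> b) *\<^sub>R frechet_derivative g (at y) b)"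
          using linear_sum[OF lin, of "\<lambda>b. (v \<bullet> b) *\<^sub>R b" Basis]
          by (simp add: euclidean_representation linear_scale[OF lin])
        also have "norm \<dots> \<le> (\<Sum>b\<in>Basis. norm v * (norm (frechet_derivative g (at x) b) + 1))"
        proof (rule sum_norm_le)
          fix b :: 'a assume b: "b \<in> Basis"
          have "norm (frechet_derivative g (at y) b) \<le> norm (frechet_derivative g (at x) b) + 1"
            using *[OF near[OF y]] b by (meson less_imp_le)
          then show "norm ((v \<bullet> b) *\<^sub>R frechet_derivative g (at y) b) \<le> norm v * (norm (frechet_derivative g (at x) b) + 1)"
            using Basis_le_norm[OF b, of v] by (simp add: mult_mono)
        qed
        finally show "norm (frechet_derivative g (at y) v) \<le> C * norm v"
          by (simp add: C_def sum_distrib_left mult.commute)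
      qed
    qed
    then show "dist (g y) (g z) \<le> C * dist y z"
      by (simp add: dist_norm)
  qed
  with e show ?thesis by (intro that[of "e/2" C]) auto
qed

text \<open>The mean value inequality holds on small balls only, since inverse cell maps live on curved cells;
compactness turns the local Lipschitz constants into a global one.\<close>

lemma C1_near_lipschitz:
  fixes g :: "'a::euclidean_space \<Rightarrow> 'b::real_normed_vector"
  assumes g: "C1_near g S" and S: "compact S"
  obtains C where "C-lipschitz_on S g"
proof -
  have "local_lipschitz {0::real} S (\<lambda>_. g)"
  proof (rule local_lipschitzI)
    fix t :: real and x assume "x \<in> S"
    then obtain r C where r: "0 < r" "C-lipschitz_on (cball x r) g"
      using C1_near_lipschitz_ball[OF g] by metis
    then show "\<exists>u>0. \<exists>L. \<forall>t\<in>cball t u \<inter> {0}. L-lipschitz_on (cball x u \<inter> S) g"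
      using lipschitz_on_subset[OF r(2), of "cball x r \<inter> S"] by (intro exI[of _ r]) auto
  qed
  then obtain C where "\<And>t. t \<in> {0::real} \<Longrightarrow> C-lipschitz_on S g"
    by (rule local_lipschitz_compact_implies_lipschitz) (use S in auto)
  then show ?thesis using that by auto
qed

lemma lipschitz_on_negligible_image:
  fixes g :: "'a::euclidean_space \<Rightarrow> 'a"
  assumes "C-lipschitz_on S g" "negligible N" "N \<subseteq> S"
  shows "negligible (g ` N)"
proof (rule negligible_locally_Lipschitz_image[OF order_refl assms(2)])
  fix x assume "x \<in> N"
  have "norm (g y - g x) \<le> C * norm (y - x)" if "y \<in> N" for y
    using lipschitz_onD[OF assms(1), of y x] assms(3) that \<open>x \<in> N\<close> by (auto simp: dist_norm)
  then show "\<exists>T B. open T \<and> x \<in> T \<and> (\<forall>y\<in>N \<inter> T. norm (g y - g x) \<le> B * norm (y - x))"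
    by (intro exI[of _ UNIV] exI[of _ C]) auto
qed

text \<open>A segment meets finitely many pieces, and on the segment the function is a continuous function of one
variable that is Lipschitz on each of finitely many closed sets covering an interval.\<close>

lemma lipschitz_on_locally_finite_cover:
  fixes f :: "'a::real_normed_vector \<Rightarrow> 'b::metric_space"
  assumes cover: "(\<Union>i\<in>I. U i) = UNIV" and closed: "\<And>i. i \<in> I \<Longrightarrow> closed (U i)"
    and lip: "\<And>i. i \<in> I \<Longrightarrow> C-lipschitz_on (U i) f"
    and fin: "\<And>S. bounded S \<Longrightarrow> finite {i \<in> I. U i \<inter> S \<noteq> {}}"
  shows "C-lipschitz_on UNIV f"
proof (rule lipschitz_onI)
  obtain i where "i \<in> I" using cover by fastforce
  then show C0: "0 \<le> C" using lip lipschitz_on_nonneg by blast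
  fix x y :: 'a
  \<comment> \<open>the segment from \<open>x\<close> to \<open>y\<close>\<close>
  define \<gamma> where "\<gamma> t = x + t *\<^sub>R (y - x)" for t :: real
  define J where "J = {i \<in> I. U i \<inter> \<gamma> ` {0..1} \<noteq> {}}"
  have c\<gamma>: "continuous_on S \<gamma>" for S
    unfolding \<gamma>_def by (intro continuous_intros)
  have "compact (\<gamma> ` {0..1})"
    using c\<gamma> by (intro compact_continuous_image) auto
  then have J: "finite J"
    unfolding J_def using compact_imp_bounded fin by blast
  have "(C * norm (y - x))-lipschitz_on {0..1} (f \<circ> \<gamma>)"
  proof (rule lipschitz_on_closed_Union[of J _ "\<lambda>i. \<gamma> -` U i"])
    fix i assume i: "i \<in> J"
    then have iI: "i \<in> I" by (simp add: J_def)
    show "closed (\<gamma> -` U i)"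
      using closed[OF iI] c\<gamma>[of UNIV] by (simp add: continuous_closed_vimage continuous_on_eq_continuous_at)
    show "(C * norm (y - x))-lipschitz_on (\<gamma> -` U i) (f \<circ> \<gamma>)"
    proof (rule lipschitz_onI)
      fix s t assume st: "s \<in> \<gamma> -` U i" "t \<in> \<gamma> -` U i"
      have "dist (f (\<gamma> s)) (f (\<gamma> t)) \<le> C * dist (\<gamma> s) (\<gamma> t)"
        using lipschitz_onD[OF lip[OF iI]] st by auto
      also have "dist (\<gamma> s) (\<gamma> t) = norm (y - x) * dist s t"
      proof -
        have "\<gamma> s - \<gamma> t = (s - t) *\<^sub>R (y - x)" by (simp add: \<gamma>_def scaleR_left_diff_distrib)
        then show ?thesis by (simp add: dist_norm dist_real_def)
      qed
      finally show "dist ((f \<circ> \<gamma>) s) ((f \<circ> \<gamma>) t) \<le> C * norm (y - x) * dist s t" by simp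
    qed (use C0 in simp)
  next
    have "\<exists>i\<in>J. \<gamma> t \<in> U i" if "t \<in> {0..1}" for t
      using that cover unfolding J_def by blast
    then show "{0..1} \<subseteq> (\<Union>i\<in>J. \<gamma> -` U i)" by blast
  qed (use J C0 in auto)
  from lipschitz_onD[OF this, of 0 1] show "dist (f x) (f y) \<le> C * dist x y"
    by (simp add: \<gamma>_def dist_norm norm_minus_commute)
qed

lemma partial_deriv_LIMSEQ:
  assumes "v differentiable (at x)"
  shows "(\<lambda>n. real (Suc n) * (v (x + (1 / real (Suc n)) *\<^sub>R axis k 1) - v x)) \<longlonglongrightarrow> partial_deriv v k x"
proof -
  define D where "D = frechet_derivative v (at x)"
  have D: "(v has_derivative D) (at x)"
    using assms unfolding D_def frechet_derivative_works .
  have "((\<lambda>h. v (x + h *\<^sub>R axis k 1)) has_derivative (\<lambda>h. D (h *\<^sub>R axis k 1))) (at 0)"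
  proof (rule has_derivative_compose[of "\<lambda>h. x + h *\<^sub>R axis k 1" "\<lambda>h. h *\<^sub>R axis k 1" _ _ v D])
    show "((\<lambda>h. x + h *\<^sub>R axis k 1) has_derivative (\<lambda>h. h *\<^sub>R axis k 1)) (at 0)"
      by (auto intro!: derivative_eq_intros)
    show "(v has_derivative D) (at (x + 0 *\<^sub>R axis k 1))" using D by simp
  qed
  then have "((\<lambda>h. v (x + h *\<^sub>R axis k 1)) has_real_derivative D (axis k 1)) (at 0)"
    unfolding has_field_derivative_def
    by (rule has_derivative_eq_rhs) (simp add: fun_eq_iff linear_scale[OF has_derivative_linear[OF D]] mult.commute)
  then have "((\<lambda>h. (v (x + h *\<^sub>R axis k 1) - v x) / h) \<longlongrightarrow> D (axis k 1)) (at 0)"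
    by (simp add: DERIV_def)
  moreover have "filterlim (\<lambda>n. 1 / real (Suc n)) (at 0) sequentially"
    unfolding filterlim_at using LIMSEQ_Suc[OF lim_1_over_n] by (auto simp del: of_nat_Suc)
  ultimately have "(\<lambda>n. (v (x + (1 / real (Suc n)) *\<^sub>R axis k 1) - v x) / (1 / real (Suc n))) \<longlonglongrightarrow> D (axis k 1)"
    by (rule filterlim_compose)
  then show ?thesis
    by (simp add: partial_deriv_def D_def mult.commute del: of_nat_Suc)
qed

lemma grad_inner_axis: "grad g x \<bullet> axis k 1 = partial_deriv g k x"
  by (simp add: grad_def inner_axis)

lemma partial_deriv_mult:
  assumes "f differentiable (at x)" "g differentiable (at x)"
  shows "partial_deriv (\<lambda>x. f x * g x) k x = f x * partial_deriv g k x + g x * partial_deriv f k x"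
proof -
  have "((\<lambda>x. f x * g x) has_derivative (\<lambda>h. f x * frechet_derivative g (at x) h + frechet_derivative f (at x) h * g x)) (at x)"
    by (rule has_derivative_mult) (use assms in \<open>simp_all flip: frechet_derivative_works\<close>)
  from frechet_derivative_at[OF this, symmetric] show ?thesis
    unfolding partial_deriv_def by (simp add: mult.commute)
qed

lemma borel_measurable_lebesgue_AE_eq:
  fixes f g :: "'a::euclidean_space \<Rightarrow> 'b::topological_space"
  assumes "f \<in> borel_measurable lebesgue" "AE x in lebesgue. f x = g x"
  shows "g \<in> borel_measurable lebesgue"
proof (rule measurableI)
  fix A :: "'b set" assume A: "A \<in> sets borel"
  have "AE x in lebesgue. x \<in> f -` A \<longleftrightarrow> x \<in> g -` A"
    using assms(2) by eventually_elim auto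
  then have "g -` A \<in> sets lebesgue"
    by (rule completion.in_sets_AE) (use measurable_sets[OF assms(1) A] in auto)
  then show "g -` A \<inter> space lebesgue \<in> sets lebesgue" by simp
qed auto

lemma set_integrable_AE_cong:
  fixes f g :: "'a::euclidean_space \<Rightarrow> real"
  assumes "set_integrable lebesgue A f" "AE x in lebesgue. x \<in> A \<longrightarrow> f x = g x"
  shows "set_integrable lebesgue A g" "(LINT x:A|lebesgue. g x) = (LINT x:A|lebesgue. f x)"
proof -
  have ae: "AE x in lebesgue. indicator A x *\<^sub>R f x = indicator A x *\<^sub>R g x"
    using assms(2) by eventually_elim (auto simp: indicator_def)
  have f: "(\<lambda>x. indicator A x *\<^sub>R f x) \<in> borel_measurable lebesgue"
    using assms(1) unfolding set_integrable_def by (rule borel_measurable_integrable)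
  note g = borel_measurable_lebesgue_AE_eq[OF f ae]
  show "set_integrable lebesgue A g"
    using assms(1) integrable_cong_AE[OF f g ae] unfolding set_integrable_def by blast
  show "(LINT x:A|lebesgue. g x) = (LINT x:A|lebesgue. f x)"
    unfolding set_lebesgue_integral_def by (rule integral_cong_AE[OF f g ae, symmetric])
qed

lemma lebesgue_measurable_continuous:
  fixes f :: "'a::euclidean_space \<Rightarrow> 'b::topological_space"
  shows "continuous_on UNIV f \<Longrightarrow> f \<in> borel_measurable lebesgue"
  by (rule measurable_completion) (simp add: borel_measurable_continuous_onI)

text \<open>Almost everywhere the partial derivative is a limit of difference quotients, which are continuous.\<close>

lemma partial_deriv_measurable:
  fixes v :: "real^'n \<Rightarrow> real"
  assumes v: "continuous_on UNIV v" and d: "AE x in lebesgue. v differentiable (at x)"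
  shows "partial_deriv v k \<in> borel_measurable lebesgue"
proof -
  let ?q = "\<lambda>n x. real (Suc n) * (v (x + (1 / real (Suc n)) *\<^sub>R axis k 1) - v x)"
  have q: "?q n \<in> borel_measurable lebesgue" for n
    by (rule lebesgue_measurable_continuous)
      (intro continuous_intros continuous_on_compose2[OF v]; simp)
  have "(\<lambda>x. lim (\<lambda>n. ?q n x)) \<in> borel_measurable lebesgue"
    by (intro borel_measurable_lim_metric q)
  then show ?thesis
    by (rule borel_measurable_lebesgue_AE_eq)
       (use d in eventually_elim, rule limI, rule partial_deriv_LIMSEQ)
qed

lemma partial_deriv_lipschitz_bound:
  assumes "C-lipschitz_on UNIV v" "v differentiable (at x)"
  shows "\<bar>partial_deriv v k x\<bar> \<le> C"
proof (rule LIMSEQ_le_const2[OF tendsto_rabs[OF partial_deriv_LIMSEQ[OF assms(2)]]], intro exI allI impI)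
  fix n :: nat
  have "\<bar>v (x + (1 / real (Suc n)) *\<^sub>R axis k 1) - v x\<bar> \<le> C * (1 / real (Suc n))"
    using lipschitz_onD[OF assms(1), of "x + (1 / real (Suc n)) *\<^sub>R axis k 1" x]
    by (simp add: dist_real_def dist_norm del: of_nat_Suc)
  then have "real (Suc n) * \<bar>v (x + (1 / real (Suc n)) *\<^sub>R axis k 1) - v x\<bar> \<le> real (Suc n) * (C * (1 / real (Suc n)))"
    by (intro mult_left_mono) auto
  then show "\<bar>real (Suc n) * (v (x + (1 / real (Suc n)) *\<^sub>R axis k 1) - v x)\<bar> \<le> C"
    by (simp add: abs_mult del: of_nat_Suc)
qed

section \<open>Integration over fundamental domains\<close>

lemma lebesgue_measure_preserving:
  fixes J :: "'a::euclidean_space \<Rightarrow> 'b::euclidean_space"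
  assumes J: "J \<in> borel_measurable borel" and pres: "distr lborel borel J = lborel"
  shows "J \<in> lebesgue \<rightarrow>\<^sub>M lebesgue" "distr lebesgue lebesgue J = lebesgue"
proof -
  have J': "J \<in> lebesgue \<rightarrow>\<^sub>M lborel"
    using J by (simp add: measurable_completion)
  have d: "distr lebesgue lborel J = lborel"
    using J pres by (simp add: distr_completion cong: distr_cong)
  show "J \<in> lebesgue \<rightarrow>\<^sub>M lebesgue"
    by (rule completion.measurable_completion2[OF J']) (simp add: d)
  show "distr lebesgue lebesgue J = lebesgue"
    using completion.completion_distr_eq[OF J'] by (simp add: d)
qed

lemma lebesgue_preserving_integral:
  fixes J :: "'a::euclidean_space \<Rightarrow> 'b::euclidean_space" and f :: "'b \<Rightarrow> 'c::{banach, second_countable_topology}"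
  assumes J: "J \<in> lebesgue \<rightarrow>\<^sub>M lebesgue" "distr lebesgue lebesgue J = lebesgue" and f: "integrable lebesgue f"
  shows "integrable lebesgue (\<lambda>x. f (J x))" "(LINT x|lebesgue. f (J x)) = (LINT x|lebesgue. f x)"
proof -
  have f': "integrable (distr lebesgue lebesgue J) f" using f J(2) by simp
  show "integrable lebesgue (\<lambda>x. f (J x))"
    by (rule integrable_distr[OF J(1) f'])
  show "(LINT x|lebesgue. f (J x)) = (LINT x|lebesgue. f x)"
    using integral_distr[OF J(1), of f] f J(2) by simp
qed

lemma lebesgue_translation:
  fixes a :: "'a::euclidean_space"
  shows "(+) a \<in> lebesgue \<rightarrow>\<^sub>M lebesgue" "distr lebesgue lebesgue ((+) a) = lebesgue"
  by (rule lebesgue_measure_preserving; simp add: lborel_distr_plus)+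

lemma set_integral_translation:
  fixes f :: "'a::euclidean_space \<Rightarrow> real"
  assumes "set_integrable lebesgue A (\<lambda>x. f (a + x))"
  shows "set_integrable lebesgue ((+) a ` A) f"
    and "(LINT x:(+) a ` A|lebesgue. f x) = (LINT x:A|lebesgue. f (a + x))"
proof -
  have eq: "indicator A (- a + x) *\<^sub>R f (a + (- a + x)) = indicator ((+) a ` A) x *\<^sub>R f x" for x
    using image_iff by (fastforce simp: indicator_def)
  note T = lebesgue_preserving_integral[OF lebesgue_translation, of _ "- a", OF assms[unfolded set_integrable_def]]
  show "set_integrable lebesgue ((+) a ` A) f"
    using T(1) unfolding set_integrable_def eq .
  show "(LINT x:(+) a ` A|lebesgue. f x) = (LINT x:A|lebesgue. f (a + x))"
    using T(2) unfolding set_lebesgue_integral_def eq .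
qed

lemma lebesgue_sets_translation: "A \<in> sets lebesgue \<Longrightarrow> (+) a ` A \<in> sets lebesgue" for a :: "'a::euclidean_space"
proof -
  assume A: "A \<in> sets lebesgue"
  have "(+) a ` A = (+) (- a) -` A \<inter> space lebesgue"
    using image_iff by fastforce
  then show ?thesis using measurable_sets[OF lebesgue_translation(1) A] by metis
qed

text \<open>Overlaps are only null sets, as for neighbouring cells, so the indicator functions add up almost
everywhere.\<close>

lemma set_integral_finite_AE_disjoint:
  fixes f :: "'a::euclidean_space \<Rightarrow> real"
  assumes fin: "finite I" and meas: "\<And>i. i \<in> I \<Longrightarrow> A i \<in> sets lebesgue"
    and disj: "\<And>i j. i \<in> I \<Longrightarrow> j \<in> I \<Longrightarrow> i \<noteq> j \<Longrightarrow> negligible (A i \<inter> A j)"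
    and int: "\<And>i. i \<in> I \<Longrightarrow> set_integrable lebesgue (A i) f"
  shows "set_integrable lebesgue (\<Union>i\<in>I. A i) f"
    and "(LINT x:(\<Union>i\<in>I. A i)|lebesgue. f x) = (\<Sum>i\<in>I. LINT x:A i|lebesgue. f x)"
proof -
  show U: "set_integrable lebesgue (\<Union>i\<in>I. A i) f"
    by (rule set_integrable_UN[OF fin int meas])
  have "negligible (\<Union>(i, j)\<in>{(i, j). i \<in> I \<and> j \<in> I \<and> i \<noteq> j}. A i \<inter> A j)"
    by (rule negligible_Union) (use fin disj in \<open>auto intro: finite_subset[of _ "(\<lambda>(i, j). A i \<inter> A j) ` (I \<times> I)"]\<close>)
  then have "AE x in lebesgue. x \<notin> (\<Union>(i, j)\<in>{(i, j). i \<in> I \<and> j \<in> I \<and> i \<noteq> j}. A i \<inter> A j)"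
    by (intro AE_not_in) (simp only: negligible_iff_null_sets)
  then have "AE x in lebesgue. indicator (\<Union>i\<in>I. A i) x *\<^sub>R f x = (\<Sum>i\<in>I. indicator (A i) x *\<^sub>R f x)"
  proof eventually_elim
    case (elim x)
    show ?case
    proof (cases "\<exists>i\<in>I. x \<in> A i")
      case True
      then obtain i where i: "i \<in> I" "x \<in> A i" by blast
      have "(\<Sum>j\<in>I. indicator (A j) x *\<^sub>R f x) = (\<Sum>j\<in>{i}. indicator (A j) x *\<^sub>R f x)"
        by (rule sum.mono_neutral_right) (use fin i elim in \<open>auto simp: indicator_def\<close>)
      then show ?thesis using i by (auto simp: indicator_def)
    next
      case False
      then show ?thesis by (auto simp: indicator_def)
    qed
  qed
  moreover have "integrable lebesgue (\<lambda>x. \<Sum>i\<in>I. indicator (A i) x *\<^sub>R f x)"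
    using int unfolding set_integrable_def by (intro Bochner_Integration.integrable_sum)
  ultimately have "(LINT x:(\<Union>i\<in>I. A i)|lebesgue. f x) = (LINT x|lebesgue. (\<Sum>i\<in>I. indicator (A i) x *\<^sub>R f x))"
    using U unfolding set_integrable_def set_lebesgue_integral_def
    by (intro integral_cong_AE borel_measurable_integrable) auto
  also have "\<dots> = (\<Sum>i\<in>I. LINT x:A i|lebesgue. f x)"
    using int unfolding set_integrable_def set_lebesgue_integral_def
    by (rule Bochner_Integration.integral_sum)
  finally show "(LINT x:(\<Union>i\<in>I. A i)|lebesgue. f x) = (\<Sum>i\<in>I. LINT x:A i|lebesgue. f x)" .
qed

definition additive_subgroup :: "'a::euclidean_space set \<Rightarrow> bool" where
  "additive_subgroup P \<longleftrightarrow> 0 \<in> P \<and> (\<forall>p\<in>P. \<forall>q\<in>P. p - q \<in> P)"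

lemma additive_subgroup_closed:
  assumes "additive_subgroup P" "p \<in> P" "q \<in> P"
  shows "0 \<in> P" "- p \<in> P" "p - q \<in> P" "p + q \<in> P"
proof -
  show 0: "0 \<in> P" "p - q \<in> P" using assms by (auto simp: additive_subgroup_def)
  have m: "- r \<in> P" if "r \<in> P" for r
    using assms(1) that 0(1) unfolding additive_subgroup_def by (metis diff_0)
  show "- p \<in> P" using m assms by blast
  have "p - (- q) \<in> P" using m assms unfolding additive_subgroup_def by blast
  then show "p + q \<in> P" by simp
qed

text \<open>Translates may overlap in null sets, so that both a half-open parallelotope and a union of closed
mesh cells qualify. For \<open>P = {0}\<close> the only such set is the whole space.\<close>

definition fund_domain :: "'a::euclidean_space set \<Rightarrow> 'a set \<Rightarrow> bool" where
  "fund_domain P A \<longleftrightarrow> A \<in> sets lebesgue \<and> (\<Union>p\<in>P. (+) p ` A) = UNIV \<and>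
     (\<forall>p\<in>P. p \<noteq> 0 \<longrightarrow> negligible (A \<inter> (+) p ` A))"

lemma fund_domain_disjoint:
  assumes P: "additive_subgroup P" and A: "fund_domain P A" and pq: "p \<in> P" "q \<in> P" "p \<noteq> q"
  shows "negligible ((+) p ` A \<inter> (+) q ` A)"
proof -
  have "negligible (A \<inter> (+) (q - p) ` A)"
    using A additive_subgroup_closed(3)[OF P pq(2,1)] pq unfolding fund_domain_def by simp
  then have "negligible ((+) p ` (A \<inter> (+) (q - p) ` A))"
    by (rule negligible_translation)
  moreover have "(+) p ` (A \<inter> (+) (q - p) ` A) = (+) p ` A \<inter> (+) q ` A"
    by (force simp: image_Int inj_on_def image_image)
  ultimately show ?thesis by simp
qed

text \<open>Both domains are cut into the pieces \<open>B \<inter> (p + A)\<close>. Shifted back by \<open>p\<close>, these pieces tile \<open>A\<close>, and a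
periodic function has the same integral over a piece and over its translate.\<close>

lemma fund_domain_integral:
  fixes f :: "'a::euclidean_space \<Rightarrow> real"
  assumes P: "additive_subgroup P" and A: "fund_domain P A" and B: "fund_domain P B"
    and fin: "finite {p \<in> P. (+) p ` A \<inter> B \<noteq> {}}"
    and per: "\<And>p x. p \<in> P \<Longrightarrow> f (p + x) = f x" and int: "set_integrable lebesgue A f"
  shows "set_integrable lebesgue B f" "(LINT x:B|lebesgue. f x) = (LINT x:A|lebesgue. f x)"
proof -
  define Q where "Q = {p \<in> P. (+) p ` A \<inter> B \<noteq> {}}"
  define E where "E p = A \<inter> (+) (- p) ` B" for p
  have Am: "A \<in> sets lebesgue" and Bm: "B \<in> sets lebesgue"
    using A B by (auto simp: fund_domain_def)
  have Q: "finite Q" "\<And>p. p \<in> Q \<Longrightarrow> p \<in> P"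
    using fin by (auto simp: Q_def)
  have Em: "E p \<in> sets lebesgue" for p
    unfolding E_def using Am Bm lebesgue_sets_translation by blast
  have pE: "(+) p ` E p = (+) p ` A \<inter> B" for p
    unfolding E_def by (force simp: image_Int inj_on_def image_image)
  have EQ: "(\<Union>p\<in>Q. E p) = A"
  proof (intro equalityI subsetI)
    fix x assume x: "x \<in> A"
    have "x \<in> (\<Union>p\<in>P. (+) p ` B)" using B by (auto simp: fund_domain_def)
    then obtain p b where p: "p \<in> P" "b \<in> B" "x = p + b" by blast
    then have "b \<in> (+) (- p) ` A \<inter> B" using x by (force simp: image_iff)
    then have "- p \<in> Q" using p additive_subgroup_closed(2)[OF P] by (auto simp: Q_def)
    moreover have "x \<in> E (- p)" using p x by (auto simp: E_def)
    ultimately show "x \<in> (\<Union>p\<in>Q. E p)" by blast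
  qed (auto simp: E_def)
  have FQ: "(\<Union>p\<in>Q. (+) p ` E p) = B"
  proof (intro equalityI subsetI)
    fix x assume x: "x \<in> B"
    have "x \<in> (\<Union>p\<in>P. (+) p ` A)" using A by (auto simp: fund_domain_def)
    then obtain p where "p \<in> P" "x \<in> (+) p ` A" by blast
    then show "x \<in> (\<Union>p\<in>Q. (+) p ` E p)" using x unfolding pE Q_def by blast
  qed (auto simp: pE)
  have Eint: "set_integrable lebesgue (E p) f" for p
    using set_integrable_subset[OF int Em] by (auto simp: E_def)
  have Eint': "set_integrable lebesgue (E p) (\<lambda>x. f (p + x))" if "p \<in> Q" for p
    using Eint[of p] per[OF Q(2)[OF that]] by simp
  have dE: "negligible (E p \<inter> E q)" if "p \<in> Q" "q \<in> Q" "p \<noteq> q" for p q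
    by (rule negligible_subset[OF fund_domain_disjoint[OF P B, of "- p" "- q"]])
       (use that Q additive_subgroup_closed(2)[OF P] in \<open>auto simp: E_def\<close>)
  have dF: "negligible ((+) p ` E p \<inter> (+) q ` E q)" if "p \<in> Q" "q \<in> Q" "p \<noteq> q" for p q
    by (rule negligible_subset[OF fund_domain_disjoint[OF P A, of p q]])
       (use that Q in \<open>auto simp: pE\<close>)
  note 1 = set_integral_finite_AE_disjoint[of Q E f, OF Q(1) Em dE Eint, unfolded EQ]
  note 2 = set_integral_finite_AE_disjoint[of Q "\<lambda>p. (+) p ` E p" f,
      OF Q(1) lebesgue_sets_translation[OF Em] dF set_integral_translation(1)[OF Eint'], unfolded FQ]
  show "set_integrable lebesgue B f" by (rule 2) auto
  have "(LINT x:B|lebesgue. f x) = (\<Sum>p\<in>Q. LINT x:(+) p ` E p|lebesgue. f x)" by (rule 2) auto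
  also have "\<dots> = (\<Sum>p\<in>Q. LINT x:E p|lebesgue. f x)"
    using set_integral_translation(2)[OF Eint'] per Q(2) by (intro sum.cong) auto
  also have "\<dots> = (LINT x:A|lebesgue. f x)" by (rule 1(2)[symmetric]) auto
  finally show "(LINT x:B|lebesgue. f x) = (LINT x:A|lebesgue. f x)" .
qed

lemma fund_domain_translate:
  assumes A: "fund_domain P A"
  shows "fund_domain P ((+) h ` A)"
  unfolding fund_domain_def
proof (intro conjI ballI impI)
  show "(+) h ` A \<in> sets lebesgue" using A lebesgue_sets_translation by (auto simp: fund_domain_def)
  have "x \<in> (\<Union>p\<in>P. (+) p ` (+) h ` A)" for x
  proof -
    have "x - h \<in> (\<Union>p\<in>P. (+) p ` A)" using A by (auto simp: fund_domain_def)
    then obtain p y where "p \<in> P" "y \<in> A" "x - h = p + y" by blast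
    then have "x = p + (h + y)" by (simp add: algebra_simps)
    then show ?thesis using \<open>p \<in> P\<close> \<open>y \<in> A\<close> by blast
  qed
  then show "(\<Union>p\<in>P. (+) p ` (+) h ` A) = UNIV" by blast
  fix p assume "p \<in> P" "p \<noteq> 0"
  then have "negligible ((+) h ` (A \<inter> (+) p ` A))"
    using A by (intro negligible_translation) (auto simp: fund_domain_def)
  moreover have "(+) h ` (A \<inter> (+) p ` A) = (+) h ` A \<inter> (+) p ` (+) h ` A"
    by (force simp: image_Int inj_on_def image_image algebra_simps)
  ultimately show "negligible ((+) h ` A \<inter> (+) p ` (+) h ` A)" by simp
qed

lemma bounded_support_set_integrable:
  fixes f :: "'a::euclidean_space \<Rightarrow> real"
  assumes f: "f \<in> borel_measurable lebesgue" and A: "A \<in> sets lebesgue" and S: "S \<in> sets lebesgue" "bounded S"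
    and b: "\<And>x. x \<in> A \<Longrightarrow> x \<in> S \<Longrightarrow> \<bar>f x\<bar> \<le> C" and 0: "\<And>x. x \<in> A \<Longrightarrow> x \<notin> S \<Longrightarrow> f x = 0"
  shows "set_integrable lebesgue A f"
  unfolding set_integrable_def
proof (rule integrableI_bounded_set[where A="A \<inter> S" and B=C])
  show "emeasure lebesgue (A \<inter> S) < \<infinity>"
    using bounded_set_imp_lmeasurable[of "A \<inter> S"] S A by (auto simp: fmeasurable_def intro: bounded_subset)
  show "A \<inter> S \<in> sets lebesgue" using A S by blast
  show "(\<lambda>x. indicator A x *\<^sub>R f x) \<in> borel_measurable lebesgue"
    using f A by measurable
qed (use b 0 in \<open>auto simp: indicator_def\<close>)

text \<open>Translation leaves the integral over a fundamental domain unchanged, so every difference quotient has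
integral zero. The quotients are dominated by the Lipschitz constant on a bounded set containing the
support, and dominated convergence passes to the limit.\<close>

lemma periodic_integral_partial_deriv_zero:
  fixes v :: "real^'n \<Rightarrow> real"
  assumes P: "additive_subgroup P" and A: "fund_domain P A"
    and fin: "\<And>h. norm h \<le> 1 \<Longrightarrow> finite {p \<in> P. (+) p ` A \<inter> (+) h ` A \<noteq> {}}"
    and per: "\<And>p x. p \<in> P \<Longrightarrow> v (p + x) = v x"
    and lip: "C-lipschitz_on UNIV v" and diff: "AE x in lebesgue. v differentiable (at x)"
    and S: "S \<in> sets lebesgue" "bounded S"
    and supp: "\<And>x h. x \<in> A \<Longrightarrow> x \<notin> S \<Longrightarrow> norm h \<le> 1 \<Longrightarrow> v (h + x) = 0"
  shows "(LINT x:A|lebesgue. partial_deriv v k x) = 0"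
proof -
  define e where "e n = (1 / real (Suc n)) *\<^sub>R (axis k 1 :: real^'n)" for n
  define D where "D n x = real (Suc n) * (v (e n + x) - v x)" for n x
  have e: "norm (e n) \<le> 1" "real (Suc n) * norm (e n) = 1" for n
    by (auto simp: e_def simp del: of_nat_Suc)
  have Am: "A \<in> sets lebesgue" using A by (simp add: fund_domain_def)
  have cv: "continuous_on UNIV v" using lip lipschitz_on_continuous_on by blast
  have cvh: "continuous_on UNIV (\<lambda>x. v (h + x))" for h
    by (intro continuous_on_compose2[OF cv] continuous_intros) auto
  have vm: "(\<lambda>x. v (h + x)) \<in> borel_measurable lebesgue" for h
    by (rule lebesgue_measurable_continuous[OF cvh])
  have C0: "0 \<le> C" using lip lipschitz_on_nonneg by blast
  have vint: "set_integrable lebesgue A (\<lambda>x. v (h + x))" if h: "norm h \<le> 1" for h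
  proof -
    have "compact ((\<lambda>x. v (h + x)) ` closure S)"
      using S continuous_on_subset[OF cvh] by (intro compact_continuous_image) auto
    then obtain B where "\<And>y. y \<in> (\<lambda>x. v (h + x)) ` closure S \<Longrightarrow> norm y \<le> B"
      using compact_imp_bounded bounded_iff by metis
    then have "\<bar>v (h + x)\<bar> \<le> B" if "x \<in> S" for x using that closure_subset[of S] by fastforce
    then show ?thesis
      using supp h by (intro bounded_support_set_integrable[OF vm Am S]) auto
  qed
  have shift: "(LINT x:A|lebesgue. v (h + x)) = (LINT x:A|lebesgue. v x)" if h: "norm h \<le> 1" for h
  proof -
    have "(LINT x:A|lebesgue. v (h + x)) = (LINT x:(+) h ` A|lebesgue. v x)"
      by (rule set_integral_translation(2)[OF vint[OF h], symmetric])
    also have "\<dots> = (LINT x:A|lebesgue. v x)"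
      using vint[of 0] by (intro fund_domain_integral(2)[OF P A fund_domain_translate[OF A] fin[OF h] per]) auto
    finally show ?thesis .
  qed
  have D0: "(LINT x:A|lebesgue. D n x) = 0" for n
  proof -
    have "(LINT x:A|lebesgue. v (e n + x) - v x) = 0"
      using vint[OF e(1)[of n]] vint[of 0] shift[OF e(1)[of n]] by (subst set_integral_diff(2)) auto
    then show ?thesis unfolding D_def by (simp add: set_integral_mult_right)
  qed
  have "(\<lambda>n. LINT x|lebesgue. indicator A x *\<^sub>R D n x) \<longlonglongrightarrow> (LINT x|lebesgue. indicator A x *\<^sub>R partial_deriv v k x)"
  proof (rule integral_dominated_convergence[where w="\<lambda>x. C * indicator S x"])
    show "(\<lambda>x. indicator A x *\<^sub>R partial_deriv v k x) \<in> borel_measurable lebesgue"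
      using partial_deriv_measurable[OF cv diff] Am by measurable
    have "D n \<in> borel_measurable lebesgue" for n
      unfolding D_def using vm[of "e n"] vm[of 0] by simp
    then show "(\<lambda>x. indicator A x *\<^sub>R D n x) \<in> borel_measurable lebesgue" for n
      using Am by measurable
    have "S \<in> lmeasurable" using S by (simp add: bounded_set_imp_lmeasurable)
    then show "integrable lebesgue (\<lambda>x. C * indicator S x)"
      by (intro integrable_mult_right integrable_real_indicator) (auto simp: fmeasurable_def)
    show "AE x in lebesgue. (\<lambda>n. indicator A x *\<^sub>R D n x) \<longlonglongrightarrow> indicator A x *\<^sub>R partial_deriv v k x"
      using diff
    proof eventually_elim
      case (elim x)
      have "(\<lambda>n. D n x) \<longlonglongrightarrow> partial_deriv v k x"
        using partial_deriv_LIMSEQ[OF elim, of k] by (simp add: D_def e_def add.commute)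
      then show ?case by (intro tendsto_intros)
    qed
    have "norm (indicator A x *\<^sub>R D n x) \<le> C * indicator S x" for n x
    proof (cases "x \<in> A \<and> x \<in> S")
      case True
      have "\<bar>v (e n + x) - v x\<bar> \<le> C * norm (e n)"
        using lipschitz_onD[OF lip, of "e n + x" x] by (simp add: dist_norm)
      then have "real (Suc n) * \<bar>v (e n + x) - v x\<bar> \<le> real (Suc n) * (C * norm (e n))"
        by (intro mult_left_mono) auto
      also have "\<dots> = C" using e(2)[of n] by (metis mult.left_commute mult.right_neutral)
      finally show ?thesis using True by (simp add: D_def abs_mult)
    next
      case False
      then show ?thesis
        using supp[of x "e n"] supp[of x 0] e(1)[of n] C0 by (auto simp: D_def indicator_def)
    qed
    then show "AE x in lebesgue. norm (indicator A x *\<^sub>R D n x) \<le> C * indicator S x" for n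
      by simp
  qed
  then have "(\<lambda>n. 0) \<longlonglongrightarrow> (LINT x:A|lebesgue. partial_deriv v k x)"
    using D0 unfolding set_lebesgue_integral_def by simp
  then show ?thesis using LIMSEQ_unique tendsto_const by metis
qed

section \<open>The lattice of periods\<close>

lemma periods_additive_subgroup: "additive_subgroup (periods B)"
proof (cases B)
  case Cauchy
  then show ?thesis by (simp add: additive_subgroup_def)
next
  case (Periodic b)
  let ?L = "\<lambda>z::'a \<Rightarrow> int. \<Sum>k\<in>UNIV. of_int (z k) *\<^sub>R b k"
  have d: "?L z - ?L z' = ?L (\<lambda>k. z k - z' k)" for z z'
    by (simp add: scaleR_left_diff_distrib sum_subtractf)
  have "0 \<in> range ?L" by (rule range_eqI[of _ _ "\<lambda>_. 0"]) simp
  moreover have "p - q \<in> range ?L" if pq: "p \<in> range ?L" "q \<in> range ?L" for p q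
  proof -
    obtain z z' where "p = ?L z" "q = ?L z'" using pq by blast
    then show ?thesis using d[of z z'] by (intro range_eqI[of _ _ "\<lambda>k. z k - z' k"]) simp
  qed
  ultimately show ?thesis unfolding Periodic additive_subgroup_def by simp
qed

lemma periods_countable: "countable (periods B)"
  by (cases B) auto

lemma basis_coordinates:
  fixes b :: "'d::finite \<Rightarrow> real^'d"
  assumes b: "inj b" "independent (range b)"
  defines "L \<equiv> \<lambda>s :: real^'d. \<Sum>k\<in>UNIV. (s $ k) *\<^sub>R b k"
  shows "linear L" "inj L" "surj L"
proof -
  show lin: "linear L"
    unfolding L_def by (intro linear_compose_sum ballI linearI) (auto simp: scaleR_add_left)
  have "s = 0" if "L s = 0" for s
  proof -
    have "(\<Sum>v\<in>range b. (s $ inv b v) *\<^sub>R v) = L s"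
      unfolding L_def by (subst sum.reindex[OF b(1)]) (simp add: b(1))
    then have "s $ inv b v = 0" if "v \<in> range b" for v
      using independentD[OF b(2) _ order_refl _ that, of "\<lambda>v. s $ inv b v"] \<open>L s = 0\<close> by simp
    then have "s $ k = 0" for k using b(1) by (metis inv_f_f rangeI)
    then show ?thesis by (simp add: vec_eq_iff)
  qed
  then show "inj L" using lin linear_injective_0 by blast
  then show "surj L" using lin linear_injective_imp_surjective by blast
qed

text \<open>In the coordinates given by the basis, the parallelotope is the half-open unit cube and the periods
are the integer points; integer parts give the tiling.\<close>

lemma parallelotope:
  fixes b :: "'d::finite \<Rightarrow> real^'d"
  assumes b: "inj b" "independent (range b)"
  shows "fund_domain (periods (Periodic b)) (fundamental_domain (Periodic b))"
    and "bounded (fundamental_domain (Periodic b))"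
proof -
  define L where "L s = (\<Sum>k\<in>UNIV. (s $ k) *\<^sub>R b k)" for s :: "real^'d"
  have L: "linear L" "inj L" "surj L"
    using basis_coordinates[OF b] unfolding L_def by auto
  let ?C = "{s :: real^'d. \<forall>k. 0 \<le> s $ k \<and> s $ k < 1}"
  let ?A = "fundamental_domain (Periodic b)" and ?P = "periods (Periodic b)"
  have A: "?A = L ` ?C"
  proof -
    have "(\<Sum>k\<in>UNIV. s k *\<^sub>R b k) = L (\<chi> k. s k)" for s by (simp add: L_def)
    then have "?A = {L (\<chi> k. s k) | s. \<forall>k. 0 \<le> s k \<and> s k < 1}" by simp
    also have "\<dots> = L ` ?C"
    proof (intro equalityI subsetI)
      fix x assume "x \<in> L ` ?C"
      then obtain s where "x = L s" "s \<in> ?C" by blast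
      then show "x \<in> {L (\<chi> k. s k) | s. \<forall>k. 0 \<le> s k \<and> s k < 1}"
        by (intro CollectI exI[of _ "\<lambda>k. s $ k"]) auto
    qed auto
    finally show ?thesis .
  qed
  have P: "?P = L ` {s. \<forall>k. s $ k \<in> \<int>}"
  proof -
    have "(\<Sum>k\<in>UNIV. of_int (z k) *\<^sub>R b k) = L (\<chi> k. of_int (z k))" for z :: "'d \<Rightarrow> int" by (simp add: L_def)
    then have "?P = range (\<lambda>z. L (\<chi> k. of_int (z k)))" by simp
    also have "\<dots> = L ` {s. \<forall>k. s $ k \<in> \<int>}"
    proof (intro equalityI subsetI)
      fix x assume "x \<in> L ` {s. \<forall>k. s $ k \<in> \<int>}"
      then obtain s where s: "x = L s" "\<And>k. s $ k \<in> \<int>" by blast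
      then have "s = (\<chi> k. of_int \<lfloor>s $ k\<rfloor>)" by (simp add: vec_eq_iff)
      from trans[OF s(1) arg_cong[OF this, of L]]
      show "x \<in> range (\<lambda>z. L (\<chi> k. of_int (z k)))" by (rule range_eqI[where x="\<lambda>k. \<lfloor>s $ k\<rfloor>"])
    qed auto
    finally show ?thesis .
  qed
  have bC: "bounded ?C"
    by (rule bounded_subset[OF bounded_cbox[of 0 "\<chi> k. 1"]]) (auto simp: mem_box_cart less_imp_le)
  show bA: "bounded ?A"
    unfolding A using bC L(1) by (intro bounded_linear_image) (auto simp: linear_conv_bounded_linear)
  have "convex ?C"
  proof -
    have "?C = (\<Inter>k\<in>UNIV. {s. 0 \<le> s $ k} \<inter> {s. s $ k < 1})" by auto
    moreover have "convex {s :: real^'d. 0 \<le> s $ k}" "convex {s :: real^'d. s $ k < 1}" for k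
      using convex_halfspace_ge[where a="axis k 1 :: real^'d" and b=0] convex_halfspace_lt[where a="axis k 1 :: real^'d" and b=1]
      by (simp_all add: inner_axis' )
    ultimately show ?thesis by (auto intro!: convex_INT convex_Int)
  qed
  then have "convex ?A" unfolding A using L(1) by (rule convex_linear_image[rotated])
  then have Am: "?A \<in> sets lebesgue"
    using measurable_convex[OF _ bA] by (auto simp: fmeasurable_def)
  show "fund_domain ?P ?A"
    unfolding fund_domain_def
  proof (intro conjI ballI impI Am)
    have "x \<in> (\<Union>p\<in>?P. (+) p ` ?A)" for x
    proof -
      obtain s where s: "x = L s" using L(3) by (metis surjD)
      define z :: "real^'d" where "z = (\<chi> k. of_int \<lfloor>s $ k\<rfloor>)"
      have "x = L z + L (s - z)" using s by (simp add: linear_diff[OF L(1)])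
      moreover have "L z \<in> ?P" unfolding P by (auto simp: z_def)
      moreover have "0 \<le> (s - z) $ k \<and> (s - z) $ k < 1" for k
        using floor_correct[of "s $ k"] by (simp add: z_def) linarith
      then have "L (s - z) \<in> ?A" unfolding A by blast
      ultimately show ?thesis by blast
    qed
    then show "(\<Union>p\<in>?P. (+) p ` ?A) = UNIV" by blast
    fix p assume p: "p \<in> ?P" "p \<noteq> 0"
    then obtain z where z: "p = L z" "\<And>k. z $ k \<in> \<int>" unfolding P by blast
    have "?A \<inter> (+) p ` ?A = {}"
    proof (rule ccontr)
      assume "?A \<inter> (+) p ` ?A \<noteq> {}"
      then obtain s s' where s: "s \<in> ?C" "s' \<in> ?C" "L s = p + L s'"
        unfolding A by blast
      then have "L s = L (z + s')" using z linear_add[OF L(1)] by metis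
      then have "s = z + s'" using L(2) by (simp add: inj_def)
      have "z $ k = 0" for k
      proof -
        have "z $ k = s $ k - s' $ k" using \<open>s = z + s'\<close> by simp
        moreover have "0 \<le> s $ k" "s $ k < 1" "0 \<le> s' $ k" "s' $ k < 1" using s(1,2) by blast+
        then have "\<bar>s $ k - s' $ k\<bar> < 1" by linarith
        ultimately show ?thesis using z(2)[of k] by (metis Ints_nonzero_abs_less1)
      qed
      then have "z = 0" by (simp add: vec_eq_iff)
      then show False using p(2) z(1) linear_0[OF L(1)] by simp
    qed
    then show "negligible (?A \<inter> (+) p ` ?A)" by simp
  qed
qed

section \<open>Meshes\<close>

locale mesh =
  fixes M :: "'d::finite discretization" and a :: "nat \<Rightarrow> real^'d"
  assumes adm: "admissible_discretization M" and matching: "matching_mesh M a"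
begin

abbreviation "T \<equiv> geo_map M a"
abbreviation "E \<equiv> cell_elt M"
abbreviation "X K \<equiv> T K ` E K"

lemma pers_group: "additive_subgroup (pers M)"
  by (rule periods_additive_subgroup)

lemmas pers_closed = additive_subgroup_closed[OF pers_group]

lemma zero_pers: "0 \<in> pers M"
  using pers_group by (simp add: additive_subgroup_def)

lemma cell_reference_element: "K \<in> cells M \<Longrightarrow> reference_element M (ref M K)"
  using adm by (simp add: admissible_discretization_def)

lemma cell_elt_facts:
  assumes "K \<in> cells M"
  shows "compact (E K)" "convex (E K)" "closed (E K)" "interior (E K) \<noteq> {}" "bounded (E K)"
proof -
  have p: "polytope (E K)" and i: "interior (E K) \<noteq> {}"
    using cell_reference_element[OF assms] by (auto simp: reference_element_def)
  show "compact (E K)" "convex (E K)" "interior (E K) \<noteq> {}" "closed (E K)" "bounded (E K)"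
    using p i polytope_imp_compact polytope_imp_convex polytope_imp_closed polytope_imp_bounded by blast+
qed

lemma interior_elt: "y \<in> interior (E K) \<Longrightarrow> y \<in> E K"
  using interior_subset by blast

lemma T_diffeo: "K \<in> cells M \<Longrightarrow> diffeomorphism_on (T K) (E K)"
  using matching by (simp add: matching_mesh_def)

lemma T_C1: "K \<in> cells M \<Longrightarrow> C1_near (T K) (E K)"
  using T_diffeo by (simp add: diffeomorphism_on_def)

lemma T_inverse:
  assumes "K \<in> cells M"
  obtains T' where "C1_near T' (X K)" "\<And>y. y \<in> E K \<Longrightarrow> T' (T K y) = y"
  using T_diffeo[OF assms] by (auto simp: diffeomorphism_on_def)

lemma T_inj: "K \<in> cells M \<Longrightarrow> inj_on (T K) (E K)"
  by (metis T_inverse inj_onI)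

lemma T_cont: "K \<in> cells M \<Longrightarrow> continuous_on (E K) (T K)"
  using T_C1 C1_near_continuous by blast

lemma X_compact: "K \<in> cells M \<Longrightarrow> compact (X K)"
  using cell_elt_facts T_cont compact_continuous_image by blast

lemma T_negligible:
  assumes "K \<in> cells M" "N \<subseteq> E K" "negligible N"
  shows "negligible (T K ` N)"
  using C1_near_lipschitz[OF T_C1[OF assms(1)] cell_elt_facts(1)[OF assms(1)]] lipschitz_on_negligible_image assms by metis

text \<open>A cell map and its inverse are both Lipschitz.\<close>

lemma T_negligible_iff:
  assumes K: "K \<in> cells M" and N: "N \<subseteq> E K"
  shows "negligible (T K ` N) \<longleftrightarrow> negligible N"
proof
  assume n: "negligible (T K ` N)"
  obtain T' where T': "C1_near T' (X K)" "\<And>y. y \<in> E K \<Longrightarrow> T' (T K y) = y"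
    using T_inverse[OF K] by blast
  obtain C where "C-lipschitz_on (X K) T'"
    using C1_near_lipschitz[OF T'(1) X_compact[OF K]] by blast
  then have "negligible (T' ` T K ` N)"
    using n image_mono[OF N] by (rule lipschitz_on_negligible_image)
  moreover have "T' ` T K ` N = N"
    unfolding image_image using T'(2) N by (force simp: image_iff)
  ultimately show "negligible N" by simp
qed (use T_negligible assms in blast)

lemma T_open:
  assumes K: "K \<in> cells M"
  shows "open (T K ` interior (E K))"
  using T_cont[OF K] T_inj[OF K] interior_subset[of "E K"]
  by (intro invariance_of_domain) (auto intro: continuous_on_subset inj_on_subset)

lemma cell_cover: obtains K p y where "K \<in> cells M" "p \<in> pers M" "y \<in> E K" "x = p + T K y"
proof -
  have "x \<in> (\<Union>K\<in>cells M. \<Union>p\<in>pers M. (+) p ` X K)"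
    using matching by (simp add: matching_mesh_def)
  then show ?thesis using that by blast
qed

lemma locally_finite:
  "bounded S \<Longrightarrow> finite {(K, p). K \<in> cells M \<and> p \<in> pers M \<and> ((+) p ` X K) \<inter> S \<noteq> {}}"
  using matching by (simp add: matching_mesh_def)

text \<open>The overlap is the image of a proper face, which lies in the frontier of a convex set.\<close>

lemma cells_overlap_negligible:
  assumes K: "K \<in> cells M" "K' \<in> cells M" and p: "p \<in> pers M" and ne: "(K, 0) \<noteq> (K', p)"
  shows "negligible (X K \<inter> (+) p ` X K')"
proof -
  obtain F where F: "F face_of E K" "F \<noteq> E K" "X K \<inter> ((+) p ` X K') = T K ` F"
    using matching K p ne unfolding matching_mesh_def by meson
  have "F \<subseteq> rel_frontier (E K)"
    by (rule face_of_subset_rel_frontier[OF F(1,2)])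
  then have "F \<subseteq> frontier (E K)"
    using rel_frontier_nonempty_interior[OF cell_elt_facts(4)[OF K(1)]] by simp
  then have "negligible F"
    using negligible_convex_frontier[OF cell_elt_facts(2)[OF K(1)]] negligible_subset by blast
  then show ?thesis
    using T_negligible[OF K(1) face_of_imp_subset[OF F(1)]] F(3) by simp
qed

text \<open>The exceptional null set: off it, a point is up to a period the image of an interior point of a
reference element, and finite element functions are differentiable.\<close>

definition skeleton :: "(real^'d) set" where
  "skeleton = (\<Union>K\<in>cells M. \<Union>p\<in>pers M. (+) p ` T K ` frontier (E K))"

lemma skeleton_negligible: "negligible skeleton"
  unfolding skeleton_def
proof (intro negligible_countable_Union countable_image)
  show "countable (cells M)" by simp
  fix S assume "S \<in> (\<lambda>K. \<Union>p\<in>pers M. (+) p ` T K ` frontier (E K)) ` cells M"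
  then obtain K where K: "K \<in> cells M" "S = (\<Union>p\<in>pers M. (+) p ` T K ` frontier (E K))" by blast
  have "negligible (T K ` frontier (E K))"
    by (rule T_negligible[OF K(1) frontier_subset_closed[OF cell_elt_facts(3)[OF K(1)]]
          negligible_convex_frontier[OF cell_elt_facts(2)[OF K(1)]]])
  then show "negligible S"
    unfolding K(2) using periods_countable
    by (intro negligible_countable_Union countable_image) (auto intro: negligible_translation)
qed

lemma regular_point:
  assumes "x \<notin> skeleton"
  obtains K p y where "K \<in> cells M" "p \<in> pers M" "y \<in> interior (E K)" "x = p + T K y"
proof -
  obtain K p y where *: "K \<in> cells M" "p \<in> pers M" "y \<in> E K" "x = p + T K y"
    by (rule cell_cover)
  then have "y \<notin> frontier (E K)" using assms unfolding skeleton_def by blast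
  then have "y \<in> interior (E K)"
    using *(3) closure_subset[of "E K"] by (auto simp: frontier_def)
  then show ?thesis using that * by blast
qed

lemma AE_regular: "AE x in lebesgue. x \<notin> skeleton"
  using skeleton_negligible by (intro AE_not_in) (simp only: negligible_iff_null_sets)

lemma glue_eq:
  assumes F: "continuous_across_cells M a F" and K: "K \<in> cells M" "p \<in> pers M" "y \<in> E K"
  shows "glue M a F (p + T K y) = F K y"
  unfolding glue_def
proof (rule the_equality)
  show "\<exists>K'\<in>cells M. \<exists>p'\<in>pers M. \<exists>y'\<in>E K'. p + T K y = p' + T K' y' \<and> F K y = F K' y'"
    using K by blast
  fix v assume "\<exists>K'\<in>cells M. \<exists>p'\<in>pers M. \<exists>y'\<in>E K'. p + T K y = p' + T K' y' \<and> v = F K' y'"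
  then obtain K' p' y' where *: "K' \<in> cells M" "p' \<in> pers M" "y' \<in> E K'" "p + T K y = p' + T K' y'" "v = F K' y'"
    by blast
  then have "T K y = (p' - p) + T K' y'" by (simp add: algebra_simps)
  then have "F K y = F K' y'"
    using F K * pers_closed(3)[OF *(2) K(2)] unfolding continuous_across_cells_def by blast
  then show "v = F K y" using * by simp
qed

lemma glue_periodic:
  assumes F: "continuous_across_cells M a F" and p: "p \<in> pers M"
  shows "glue M a F (p + x) = glue M a F x"
proof -
  obtain K q y where *: "K \<in> cells M" "q \<in> pers M" "y \<in> E K" "x = q + T K y"
    by (rule cell_cover)
  have "glue M a F ((p + q) + T K y) = F K y"
    by (rule glue_eq[OF F *(1) pers_closed(4)[OF p *(2)] *(3)])
  then show ?thesis using glue_eq[OF F *(1-3)] *(4) by (simp add: add.assoc)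
qed

end

section \<open>Piecewise smooth functions on a mesh\<close>

context mesh begin

text \<open>In the interior of a cell the function is \<open>g\<close> composed with the inverse cell map; the image of the
open cell is open by invariance of domain, so this representation holds in a neighbourhood.\<close>

lemma cell_chart_derivative:
  fixes v :: "real^'d \<Rightarrow> 'b::real_normed_vector"
  assumes K: "K \<in> cells M" and y: "y \<in> interior (E K)"
    and v: "\<And>z. z \<in> interior (E K) \<Longrightarrow> v (p + T K z) = g z"
    and g: "(g has_derivative D) (at y)" and A: "(T K has_derivative A) (at y)"
  obtains B where "linear B" "A \<circ> B = id" "B \<circ> A = id" "(v has_derivative D \<circ> B) (at (p + T K y))"
proof -
  obtain T' where T': "C1_near T' (X K)" "\<And>y. y \<in> E K \<Longrightarrow> T' (T K y) = y"
    using T_inverse[OF K] by blast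
  define B where "B = frechet_derivative T' (at (T K y))"
  have B: "(T' has_derivative B) (at (T K y))"
    unfolding B_def using C1_near_differentiable[OF T'(1)] interior_elt[OF y]
    by (simp flip: frechet_derivative_works)
  have "((T' \<circ> T K) has_derivative B \<circ> A) (at y)"
    by (rule diff_chain_at[OF A B])
  then have "((\<lambda>x. x) has_derivative B \<circ> A) (at y)"
    by (rule has_derivative_transform_within_open[OF _ open_interior y])
       (simp add: T'(2) interior_elt)
  then have BA: "B \<circ> A = id"
    using has_derivative_unique[OF _ has_derivative_ident] by (auto simp: id_def)
  have lin: "linear A" "linear B"
    using A B has_derivative_linear by blast+
  have AB: "A \<circ> B = id"
    using linear_inverse_left[OF lin] BA by blast
  define U where "U = (\<lambda>x. x - p) -` (T K ` interior (E K))"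
  have U: "open U" "p + T K y \<in> U"
    using T_open[OF K] y unfolding U_def by (auto intro!: open_vimage continuous_intros)
  have "((\<lambda>x. T' (x - p)) has_derivative (\<lambda>h. B h)) (at (p + T K y))"
  proof (rule has_derivative_compose[of "\<lambda>x. x - p" "\<lambda>h. h" _ _ T' B])
    show "((\<lambda>x. x - p) has_derivative (\<lambda>h. h)) (at (p + T K y))"
      by (auto intro!: derivative_eq_intros)
    show "(T' has_derivative B) (at (p + T K y - p))" using B by simp
  qed
  then have "((\<lambda>x. g (T' (x - p))) has_derivative (\<lambda>h. D (B h))) (at (p + T K y))"
    by (rule has_derivative_compose) (simp add: T'(2) interior_elt[OF y] g)
  then have "(v has_derivative (\<lambda>h. D (B h))) (at (p + T K y))"
  proof (rule has_derivative_transform_within_open[OF _ U])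
    fix x assume "x \<in> U"
    then obtain z where z: "z \<in> interior (E K)" "x - p = T K z" unfolding U_def by auto
    then have "x = p + T K z" by (metis add.commute diff_add_cancel)
    then show "g (T' (x - p)) = v x" using z v[OF z(1)] T'(2)[OF interior_elt[OF z(1)]] by simp
  qed
  then show ?thesis using lin AB BA by (intro that[of B]) (auto simp: o_def)
qed

definition piecewise_C1 :: "(nat \<Rightarrow> real^'d \<Rightarrow> real) \<Rightarrow> bool" where
  "piecewise_C1 F \<longleftrightarrow> continuous_across_cells M a F \<and> (\<forall>K\<in>cells M. C1_near (F K) (E K)) \<and>
     finite {K \<in> cells M. \<exists>y\<in>E K. F K y \<noteq> 0}"

text \<open>On one cell the function is a Lipschitz function composed with the Lipschitz inverse of the cell map.
Only finitely many cells matter, and all translates of a cell share its constant.\<close>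

lemma glue_lipschitz:
  assumes F: "piecewise_C1 F"
  obtains C where "C-lipschitz_on UNIV (glue M a F)"
proof -
  have Fc: "continuous_across_cells M a F" and F1: "\<And>K. K \<in> cells M \<Longrightarrow> C1_near (F K) (E K)"
    and fin: "finite {K \<in> cells M. \<exists>y\<in>E K. F K y \<noteq> 0}"
    using F by (auto simp: piecewise_C1_def)
  let ?v = "glue M a F" and ?I = "{K \<in> cells M. \<exists>y\<in>E K. F K y \<noteq> 0}"
  have "\<exists>C\<ge>0. \<forall>y\<in>E K. \<forall>z\<in>E K. \<bar>F K y - F K z\<bar> \<le> C * norm (T K y - T K z)" if K: "K \<in> cells M" for K
  proof -
    obtain C1 where C1: "C1-lipschitz_on (E K) (F K)"
      using C1_near_lipschitz[OF F1[OF K] cell_elt_facts(1)[OF K]] by blast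
    obtain T' where T': "C1_near T' (X K)" "\<And>y. y \<in> E K \<Longrightarrow> T' (T K y) = y"
      using T_inverse[OF K] by blast
    obtain C2 where C2: "C2-lipschitz_on (X K) T'"
      using C1_near_lipschitz[OF T'(1) X_compact[OF K]] by blast
    have "\<bar>F K y - F K z\<bar> \<le> C1 * C2 * norm (T K y - T K z)" if "y \<in> E K" "z \<in> E K" for y z
    proof -
      have "\<bar>F K y - F K z\<bar> \<le> C1 * norm (y - z)"
        using lipschitz_onD[OF C1 that] by (simp add: dist_norm)
      also have "norm (y - z) = norm (T' (T K y) - T' (T K z))"
        using T'(2) that by simp
      also have "C1 * \<dots> \<le> C1 * (C2 * norm (T K y - T K z))"
        using lipschitz_onD[OF C2, of "T K y" "T K z"] that lipschitz_on_nonneg[OF C1]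
        by (intro mult_left_mono) (auto simp: dist_norm)
      finally show ?thesis by simp
    qed
    then show ?thesis
      using lipschitz_on_nonneg[OF C1] lipschitz_on_nonneg[OF C2] by (intro exI[of _ "C1 * C2"]) auto
  qed
  then obtain c where c0: "\<And>K. K \<in> cells M \<Longrightarrow> 0 \<le> c K"
    and c: "\<And>K y z. K \<in> cells M \<Longrightarrow> y \<in> E K \<Longrightarrow> z \<in> E K \<Longrightarrow> \<bar>F K y - F K z\<bar> \<le> c K * norm (T K y - T K z)"
    by metis
  define C where "C = (\<Sum>K\<in>?I. c K)"
  have C0: "0 \<le> C" unfolding C_def by (rule sum_nonneg) (use c0 in blast)
  have cC: "\<bar>F K y - F K z\<bar> \<le> C * norm (T K y - T K z)" if K: "K \<in> cells M" "y \<in> E K" "z \<in> E K" for K y z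
  proof (cases "K \<in> ?I")
    case True
    have "c K \<le> C"
      unfolding C_def using fin True c0 by (intro member_le_sum) auto
    then have "c K * norm (T K y - T K z) \<le> C * norm (T K y - T K z)"
      by (intro mult_right_mono) auto
    with c[OF K] show ?thesis by linarith
  next
    case False
    then have "F K y = 0" "F K z = 0" using K by blast+
    then show ?thesis using C0 by simp
  qed
  have "C-lipschitz_on UNIV ?v"
  proof (rule lipschitz_on_locally_finite_cover[where I="cells M \<times> pers M" and U="\<lambda>(K, p). (+) p ` X K"])
    show "(\<Union>i\<in>cells M \<times> pers M. case i of (K, p) \<Rightarrow> (+) p ` X K) = UNIV"
    proof (intro equalityI subsetI UNIV_I)
      fix x
      obtain K p y where "K \<in> cells M" "p \<in> pers M" "y \<in> E K" "x = p + T K y"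
        by (rule cell_cover)
      then show "x \<in> (\<Union>i\<in>cells M \<times> pers M. case i of (K, p) \<Rightarrow> (+) p ` X K)" by blast
    qed
    fix S :: "(real^'d) set" assume S: "bounded S"
    have "{i \<in> cells M \<times> pers M. (case i of (K, p) \<Rightarrow> (+) p ` X K) \<inter> S \<noteq> {}}
        = {(K, p). K \<in> cells M \<and> p \<in> pers M \<and> ((+) p ` X K) \<inter> S \<noteq> {}}" by auto
    then show "finite {i \<in> cells M \<times> pers M. (case i of (K, p) \<Rightarrow> (+) p ` X K) \<inter> S \<noteq> {}}"
      using locally_finite[OF S] by metis
  next
    fix i assume "i \<in> cells M \<times> pers M"
    then obtain K p where i: "i = (K, p)" "K \<in> cells M" "p \<in> pers M" by blast
    show "closed (case i of (K, p) \<Rightarrow> (+) p ` X K)"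
      using X_compact[OF i(2)] i by (simp add: compact_imp_closed compact_translation)
    show "C-lipschitz_on (case i of (K, p) \<Rightarrow> (+) p ` X K) ?v"
    proof (rule lipschitz_onI[OF _ C0])
      fix x x' assume "x \<in> (case i of (K, p) \<Rightarrow> (+) p ` X K)" "x' \<in> (case i of (K, p) \<Rightarrow> (+) p ` X K)"
      then obtain y y' where y: "y \<in> E K" "x = p + T K y" "y' \<in> E K" "x' = p + T K y'"
        using i by auto
      then show "dist (?v x) (?v x') \<le> C * dist x x'"
        using cC[OF i(2) y(1,3)] by (simp add: glue_eq[OF Fc i(2,3)] dist_norm)
    qed
  qed
  then show ?thesis by (rule that)
qed

lemma T_derivative:
  assumes "K \<in> cells M" "y \<in> E K"
  shows "(T K has_derivative frechet_derivative (T K) (at y)) (at y)"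
  using C1_near_differentiable[OF T_C1[OF assms(1)] assms(2)] by (simp flip: frechet_derivative_works)

lemma glue_differentiable:
  assumes F: "piecewise_C1 F" and x: "x \<notin> skeleton"
  shows "glue M a F differentiable (at x)"
proof -
  obtain K p y where K: "K \<in> cells M" "p \<in> pers M" "y \<in> interior (E K)" "x = p + T K y"
    using regular_point[OF x] .
  have "C1_near (F K) (E K)" and Fc: "continuous_across_cells M a F" using F K by (auto simp: piecewise_C1_def)
  then have "(F K has_derivative frechet_derivative (F K) (at y)) (at y)"
    using C1_near_differentiable interior_elt[OF K(3)] by (simp flip: frechet_derivative_works)
  from cell_chart_derivative[OF K(1,3) _ this T_derivative[OF K(1) interior_elt[OF K(3)]], of "glue M a F" p]
  show ?thesis
    unfolding K(4) differentiable_def using glue_eq[OF Fc K(1,2)] interior_elt by metis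
qed

lemma glue_nonzero:
  assumes F: "continuous_across_cells M a F" and x: "glue M a F x \<noteq> 0"
  obtains K p y where "K \<in> cells M" "p \<in> pers M" "y \<in> E K" "x = p + T K y" "F K y \<noteq> 0"
proof -
  obtain K p y where "K \<in> cells M" "p \<in> pers M" "y \<in> E K" "x = p + T K y"
    by (rule cell_cover)
  then show ?thesis using that glue_eq[OF F] x by metis
qed

lemma Omega_fund_domain: "fund_domain (pers M) (Omega M)"
  using adm parallelotope by (cases "bdry M") (auto simp: admissible_discretization_def fund_domain_def)

lemma Omega_periodic_bounded: "bdry M \<noteq> Cauchy \<Longrightarrow> bounded (Omega M)"
  using adm parallelotope by (cases "bdry M") (auto simp: admissible_discretization_def)

lemma Omega_measurable: "Omega M \<in> sets lebesgue"
  using Omega_fund_domain by (simp add: fund_domain_def)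

text \<open>Local finiteness of the mesh makes the lattice discrete: only finitely many periods translate a fixed
cell to a position where it meets a given bounded set, and a period
that makes the two sets meet is a difference of their points.\<close>

lemma finite_pers_overlap:
  assumes "bounded S" "bounded S'"
  shows "finite {p \<in> pers M. (+) p ` S \<inter> S' \<noteq> {}}"
proof -
  obtain K p y where K: "K \<in> cells M" "p \<in> pers M" "y \<in> E K"
    by (rule cell_cover)
  define D where "D = (\<Union>s'\<in>S'. \<Union>s\<in>S. {s' - s})"
  have "bounded D" unfolding D_def by (rule bounded_differences[OF assms(2,1)])
  then have "bounded ((+) (T K y) ` D)" by (rule bounded_translation)
  from locally_finite[OF this]
  have fin: "finite (snd ` {(K', p). K' \<in> cells M \<and> p \<in> pers M \<and> ((+) p ` X K') \<inter> (+) (T K y) ` D \<noteq> {}})"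
    by (rule finite_imageI)
  show ?thesis
  proof (rule finite_subset[OF _ fin], intro subsetI)
    fix q assume "q \<in> {p \<in> pers M. (+) p ` S \<inter> S' \<noteq> {}}"
    then obtain s where q: "q \<in> pers M" "s \<in> S" "q + s \<in> S'" by blast
    then have "q \<in> D" unfolding D_def by (intro UN_I[of "q + s"] UN_I[of s]) auto
    then have "q + T K y \<in> (+) (T K y) ` D" by (force simp: add.commute)
    moreover have "q + T K y \<in> (+) q ` X K" using K(3) by blast
    ultimately have "(K, q) \<in> {(K', p). K' \<in> cells M \<and> p \<in> pers M \<and> ((+) p ` X K') \<inter> (+) (T K y) ` D \<noteq> {}}"
      using q(1) K(1) by blast
    then show "q \<in> snd ` {(K', p). K' \<in> cells M \<and> p \<in> pers M \<and> ((+) p ` X K') \<inter> (+) (T K y) ` D \<noteq> {}}"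
      by (rule image_eqI[rotated]) simp
  qed
qed

lemma Omega_translates_finite:
  assumes "bounded S"
  shows "finite {p \<in> pers M. (+) p ` Omega M \<inter> S \<noteq> {}}" "finite {p \<in> pers M. (+) p ` Omega M \<inter> (+) h ` Omega M \<noteq> {}}"
proof -
  have "finite {p \<in> pers M. (+) p ` Omega M \<inter> S \<noteq> {}} \<and> finite {p \<in> pers M. (+) p ` Omega M \<inter> (+) h ` Omega M \<noteq> {}}"
  proof (cases "bdry M = Cauchy")
    case True
    then show ?thesis by simp
  next
    case False
    then show ?thesis
      using finite_pers_overlap[OF Omega_periodic_bounded] bounded_translation[OF Omega_periodic_bounded] assms by blast
  qed
  then show "finite {p \<in> pers M. (+) p ` Omega M \<inter> S \<noteq> {}}" "finite {p \<in> pers M. (+) p ` Omega M \<inter> (+) h ` Omega M \<noteq> {}}"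
    by blast+
qed

text \<open>In the periodic case the fundamental domain itself is bounded; for the Cauchy problem a function with
finitely many nonzero cells has bounded support. The margin 1 leaves room for difference quotients.\<close>

lemma glue_bounded_support:
  assumes F: "piecewise_C1 F"
  obtains S where "S \<in> sets lebesgue" "bounded S"
    "\<And>x h. x \<in> Omega M \<Longrightarrow> x \<notin> S \<Longrightarrow> norm h \<le> 1 \<Longrightarrow> glue M a F (h + x) = 0"
proof (cases "bdry M = Cauchy")
  case False
  then show ?thesis using that[OF Omega_measurable Omega_periodic_bounded] by blast
next
  case True
  have Fc: "continuous_across_cells M a F" and fin: "finite {K \<in> cells M. \<exists>y\<in>E K. F K y \<noteq> 0}"
    using F by (auto simp: piecewise_C1_def)
  have "bounded (\<Union>K\<in>{K \<in> cells M. \<exists>y\<in>E K. F K y \<noteq> 0}. X K)"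
    using fin X_compact compact_imp_bounded by (intro bounded_UN) auto
  then obtain r where r: "\<And>x. x \<in> (\<Union>K\<in>{K \<in> cells M. \<exists>y\<in>E K. F K y \<noteq> 0}. X K) \<Longrightarrow> norm x \<le> r"
    unfolding bounded_iff by blast
  have P: "pers M = {0}" using True by simp
  have *: "norm x \<le> r" if nz: "glue M a F x \<noteq> 0" for x
  proof -
    obtain K p y where K: "K \<in> cells M" "p \<in> pers M" "y \<in> E K" "x = p + T K y" "F K y \<noteq> 0"
      by (rule glue_nonzero[OF Fc nz])
    then have "x = T K y" using P by auto
    then show ?thesis using r[of x] K by blast
  qed
  show ?thesis
  proof (rule that[of "cball 0 (r + 1)"])
    fix x h :: "real^'d" assume xh: "x \<notin> cball 0 (r + 1)" "norm h \<le> 1"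
    then have "r < norm (h + x)"
      using norm_triangle_ineq2[of x "- h"] by (simp add: add.commute)
    then show "glue M a F (h + x) = 0" using * by (meson not_le)
  qed auto
qed

end

section \<open>Shape functions and integration by parts\<close>

context mesh begin

lemma local_shape_con:
  assumes K: "K \<in> cells M" and i: "i \<in> {1..nsh M (ref M K)}"
  shows "local_shape M (con M i K) K = shape M (ref M K) i"
proof
  fix y
  have "inj_on (\<lambda>i. con M i K) {1..nsh M (ref M K)}"
    using adm K by (auto simp: admissible_discretization_def)
  then have "{i' \<in> {1..nsh M (ref M K)}. con M i' K = con M i K} = {i}"
    using i by (auto dest: inj_onD)
  then show "local_shape M (con M i K) K y = shape M (ref M K) i y"
    by (simp only: local_shape_def) simp
qed

lemma local_shape_notin: "j \<notin> (\<lambda>i. con M i K) ` {1..nsh M (ref M K)} \<Longrightarrow> local_shape M j K = (\<lambda>_. 0)"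
  by (intro ext, unfold local_shape_def, rule sum.neutral) auto

lemma local_shape_C1: "K \<in> cells M \<Longrightarrow> C1_near (local_shape M j K) (E K)"
proof (cases "j \<in> (\<lambda>i. con M i K) ` {1..nsh M (ref M K)}")
  case True
  assume K: "K \<in> cells M"
  with True show ?thesis
    using local_shape_con[OF K] cell_reference_element[OF K] by (auto simp: reference_element_def)
next
  case False
  then show ?thesis
    unfolding local_shape_notin[OF False] C1_near_def
    by (intro exI[of _ UNIV]) (auto simp: frechet_derivative_const)
qed

lemma local_shape_nonneg: "K \<in> cells M \<Longrightarrow> y \<in> E K \<Longrightarrow> 0 \<le> local_shape M j K y"
  unfolding local_shape_def
  by (rule sum_nonneg) (use cell_reference_element in \<open>auto simp: reference_element_def\<close>)

definition cell_dofs :: "nat \<Rightarrow> nat set" where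
  "cell_dofs K = (\<lambda>i. con M i K) ` {1..nsh M (ref M K)}"

lemma cell_dofs_finite: "finite (cell_dofs K)"
  by (simp add: cell_dofs_def)

lemma cell_dofs_dofs: "K \<in> cells M \<Longrightarrow> cell_dofs K \<subseteq> dofs M"
  unfolding cell_dofs_def dofs_def by blast

lemma local_shape_zero: "j \<notin> cell_dofs K \<Longrightarrow> local_shape M j K y = 0"
  using local_shape_notin unfolding cell_dofs_def by metis

lemma sum_cell_dofs:
  assumes K: "K \<in> cells M"
  shows "(\<Sum>j\<in>cell_dofs K. f j (local_shape M j K y)) = (\<Sum>i=1..nsh M (ref M K). f (con M i K) (shape M (ref M K) i y))"
proof -
  have "inj_on (\<lambda>i. con M i K) {1..nsh M (ref M K)}"
    using adm K by (auto simp: admissible_discretization_def)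
  then show ?thesis
    unfolding cell_dofs_def by (subst sum.reindex) (auto simp: local_shape_con[OF K])
qed

lemma partition_of_unity:
  assumes "K \<in> cells M" "y \<in> E K"
  shows "(\<Sum>j\<in>cell_dofs K. local_shape M j K y) = 1"
  using sum_cell_dofs[OF assms(1), of "\<lambda>_ v. v"] cell_reference_element[OF assms(1)] assms(2)
  by (simp add: reference_element_def)

lemma piecewise_shape: "j \<in> dofs M \<Longrightarrow> piecewise_C1 (local_shape M j)"
  unfolding piecewise_C1_def
proof (intro conjI ballI local_shape_C1)
  assume "j \<in> dofs M"
  then show "continuous_across_cells M a (local_shape M j)" using matching by (simp add: matching_mesh_def)
  have "finite {K \<in> cells M. j \<in> (\<lambda>i. con M i K) ` {1..nsh M (ref M K)}}"
    using adm by (simp add: admissible_discretization_def)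
  then show "finite {K \<in> cells M. \<exists>y\<in>E K. local_shape M j K y \<noteq> 0}"
    by (rule rev_finite_subset) (use local_shape_notin in fastforce)
qed

lemma dof_continuous_across: "j \<in> dofs M \<Longrightarrow> continuous_across_cells M a (local_shape M j)"
  using piecewise_shape by (simp add: piecewise_C1_def)

lemma psi_cell:
  "j \<in> dofs M \<Longrightarrow> K \<in> cells M \<Longrightarrow> p \<in> pers M \<Longrightarrow> y \<in> E K \<Longrightarrow> psi M a j (p + T K y) = local_shape M j K y"
  unfolding psi_def by (rule glue_eq[OF dof_continuous_across])

lemma psi_periodic: "j \<in> dofs M \<Longrightarrow> p \<in> pers M \<Longrightarrow> psi M a j (p + x) = psi M a j x"
  unfolding psi_def by (rule glue_periodic[OF dof_continuous_across])

lemma psi_lipschitz: assumes "j \<in> dofs M" obtains C where "C-lipschitz_on UNIV (psi M a j)"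
  using glue_lipschitz[OF piecewise_shape[OF assms]] unfolding psi_def by blast

lemma psi_continuous: "j \<in> dofs M \<Longrightarrow> continuous_on UNIV (psi M a j)"
  using psi_lipschitz lipschitz_on_continuous_on by metis

lemma psi_measurable: "j \<in> dofs M \<Longrightarrow> psi M a j \<in> borel_measurable lebesgue"
  by (rule lebesgue_measurable_continuous[OF psi_continuous])

lemma psi_differentiable: "j \<in> dofs M \<Longrightarrow> x \<notin> skeleton \<Longrightarrow> psi M a j differentiable (at x)"
  unfolding psi_def by (rule glue_differentiable[OF piecewise_shape])

lemma psi_AE_differentiable: "j \<in> dofs M \<Longrightarrow> AE x in lebesgue. psi M a j differentiable (at x)"
  using AE_regular by eventually_elim (rule psi_differentiable)

lemma psi_bounds:
  assumes j: "j \<in> dofs M" shows "0 \<le> psi M a j x" "psi M a j x \<le> 1"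
proof -
  obtain K p y where K: "K \<in> cells M" "p \<in> pers M" "y \<in> E K" "x = p + T K y"
    by (rule cell_cover)
  have eq: "psi M a j x = local_shape M j K y" using psi_cell[OF j K(1-3)] K(4) by simp
  show "0 \<le> psi M a j x" unfolding eq by (rule local_shape_nonneg[OF K(1,3)])
  show "psi M a j x \<le> 1"
  proof (cases "j \<in> cell_dofs K")
    case True
    have "local_shape M j K y \<le> (\<Sum>j\<in>cell_dofs K. local_shape M j K y)"
      by (rule member_le_sum[OF True]) (use local_shape_nonneg K cell_dofs_finite in auto)
    then show ?thesis using partition_of_unity[OF K(1,3)] eq by simp
  qed (simp add: eq local_shape_zero)
qed

lemma psi_bounded_support:
  assumes "j \<in> dofs M"
  obtains S where "S \<in> sets lebesgue" "bounded S"
    "\<And>x h. x \<in> Omega M \<Longrightarrow> x \<notin> S \<Longrightarrow> norm h \<le> 1 \<Longrightarrow> psi M a j (h + x) = 0"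
  using glue_bounded_support[OF piecewise_shape[OF assms]] unfolding psi_def by blast

lemma psi_times_integrable:
  assumes i: "i \<in> dofs M" and g: "g \<in> borel_measurable lebesgue" and b: "\<And>x. \<bar>g x\<bar> \<le> C"
  shows "set_integrable lebesgue (Omega M) (\<lambda>x. psi M a i x * g x)"
proof -
  obtain S where S: "S \<in> sets lebesgue" "bounded S"
    "\<And>x h. x \<in> Omega M \<Longrightarrow> x \<notin> S \<Longrightarrow> norm h \<le> 1 \<Longrightarrow> psi M a i (h + x) = 0"
    by (rule psi_bounded_support[OF i]) blast
  show ?thesis
  proof (rule bounded_support_set_integrable[OF _ Omega_measurable S(1,2), of _ C])
    show "(\<lambda>x. psi M a i x * g x) \<in> borel_measurable lebesgue"
      using psi_measurable[OF i] g by measurable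
    show "\<bar>psi M a i x * g x\<bar> \<le> C" for x
      using mult_mono[of "\<bar>psi M a i x\<bar>" 1 "\<bar>g x\<bar>" C] psi_bounds[OF i, of x] b[of x] by (simp add: abs_mult)
    show "psi M a i x * g x = 0" if "x \<in> Omega M" "x \<notin> S" for x
      using S(3)[OF that, of 0] by simp
  qed
qed

lemma psi_partial_integrable:
  assumes i: "i \<in> dofs M" and j: "j \<in> dofs M"
  shows "set_integrable lebesgue (Omega M) (\<lambda>x. psi M a i x * partial_deriv (psi M a j) k x)"
proof -
  obtain C where C: "C-lipschitz_on UNIV (psi M a j)" using psi_lipschitz[OF j] .
  define g where "g x = (if \<bar>partial_deriv (psi M a j) k x\<bar> \<le> C then partial_deriv (psi M a j) k x else 0)" for x
  have pm: "partial_deriv (psi M a j) k \<in> borel_measurable lebesgue"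
    by (rule partial_deriv_measurable[OF psi_continuous[OF j] psi_AE_differentiable[OF j]])
  have "g \<in> borel_measurable lebesgue" unfolding g_def using pm by measurable
  moreover have "\<bar>g x\<bar> \<le> C" for x using lipschitz_on_nonneg[OF C] by (simp add: g_def)
  ultimately have "set_integrable lebesgue (Omega M) (\<lambda>x. psi M a i x * g x)"
    by (rule psi_times_integrable[OF i])
  then show ?thesis
  proof (rule set_integrable_AE_cong(1))
    show "AE x in lebesgue. x \<in> Omega M \<longrightarrow> psi M a i x * g x = psi M a i x * partial_deriv (psi M a j) k x"
      using psi_AE_differentiable[OF j]
      by eventually_elim (use partial_deriv_lipschitz_bound[OF C] in \<open>auto simp: g_def\<close>)
  qed
qed

lemma cvec_inner:
  assumes i: "i \<in> dofs M" and j: "j \<in> dofs M"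
  shows "set_integrable lebesgue (Omega M) (\<lambda>x. psi M a i x *\<^sub>R grad (psi M a j) x)"
    and "set_integrable lebesgue (Omega M) (\<lambda>x. psi M a i x * (grad (psi M a j) x \<bullet> w))"
    and "cvec M a i j \<bullet> w = (LINT x:Omega M|lebesgue. psi M a i x * (grad (psi M a j) x \<bullet> w))"
proof -
  have eq: "indicator (Omega M) x *\<^sub>R psi M a i x *\<^sub>R grad (psi M a j) x
     = (\<Sum>k\<in>UNIV. (indicator (Omega M) x *\<^sub>R (psi M a i x * partial_deriv (psi M a j) k x)) *\<^sub>R axis k 1)" for x
    by (simp add: vec_eq_iff grad_def axis_def sum_distrib_left if_distrib cong: if_cong)
  show I: "set_integrable lebesgue (Omega M) (\<lambda>x. psi M a i x *\<^sub>R grad (psi M a j) x)"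
    unfolding set_integrable_def eq
    by (intro Bochner_Integration.integrable_sum integrable_scaleR_left)
       (use psi_partial_integrable[OF i j] in \<open>auto simp: set_integrable_def\<close>)
  have "integrable lebesgue (\<lambda>x. (indicator (Omega M) x *\<^sub>R psi M a i x *\<^sub>R grad (psi M a j) x) \<bullet> w)"
    using I unfolding set_integrable_def by (intro integrable_inner_left)
  then show "set_integrable lebesgue (Omega M) (\<lambda>x. psi M a i x * (grad (psi M a j) x \<bullet> w))"
    unfolding set_integrable_def by (simp add: mult.assoc)
  have "cvec M a i j \<bullet> w = (LINT x|lebesgue. (indicator (Omega M) x *\<^sub>R psi M a i x *\<^sub>R grad (psi M a j) x) \<bullet> w)"
    unfolding cvec_def set_lebesgue_integral_def using I unfolding set_integrable_def
    by (intro integral_inner_left[symmetric])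
  then show "cvec M a i j \<bullet> w = (LINT x:Omega M|lebesgue. psi M a i x * (grad (psi M a j) x \<bullet> w))"
    unfolding set_lebesgue_integral_def by (simp add: mult.assoc)
qed

text \<open>Integration by parts without boundary terms, applied to the product of two shape functions.\<close>

lemma cvec_antisym:
  assumes i: "i \<in> dofs M" and j: "j \<in> dofs M"
  shows "cvec M a i j = - cvec M a j i"
proof -
  let ?v = "\<lambda>x. psi M a i x * psi M a j x"
  obtain C D where C: "C-lipschitz_on UNIV (psi M a i)" and D: "D-lipschitz_on UNIV (psi M a j)"
    using psi_lipschitz[OF i] psi_lipschitz[OF j] by metis
  have lip: "(C + D)-lipschitz_on UNIV ?v"
  proof (rule lipschitz_onI)
    show "0 \<le> C + D" using lipschitz_on_nonneg[OF C] lipschitz_on_nonneg[OF D] by simp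
    fix x y
    have "\<bar>?v x - ?v y\<bar> \<le> \<bar>psi M a j y\<bar> * \<bar>psi M a i x - psi M a i y\<bar> + \<bar>psi M a i x\<bar> * \<bar>psi M a j x - psi M a j y\<bar>"
    proof -
      have "?v x - ?v y = psi M a j y * (psi M a i x - psi M a i y) + psi M a i x * (psi M a j x - psi M a j y)"
        by (simp add: algebra_simps)
      then show ?thesis by (simp add: abs_mult[symmetric] abs_triangle_ineq)
    qed
    also have "\<dots> \<le> 1 * (C * dist x y) + 1 * (D * dist x y)"
      using psi_bounds[OF i, of x] psi_bounds[OF j, of y] lipschitz_onD[OF C, of x y] lipschitz_onD[OF D, of x y]
      by (intro add_mono mult_mono) (auto simp: dist_real_def)
    finally show "dist (?v x) (?v y) \<le> (C + D) * dist x y" by (simp add: dist_real_def algebra_simps)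
  qed
  obtain S where S: "S \<in> sets lebesgue" "bounded S"
    "\<And>x h. x \<in> Omega M \<Longrightarrow> x \<notin> S \<Longrightarrow> norm h \<le> 1 \<Longrightarrow> psi M a i (h + x) = 0"
    by (rule psi_bounded_support[OF i]) blast
  have "(cvec M a i j + cvec M a j i) \<bullet> axis k 1 = 0" for k
  proof -
    have ae: "AE x in lebesgue. ?v differentiable (at x)"
      using psi_AE_differentiable[OF i] psi_AE_differentiable[OF j]
      by eventually_elim (rule differentiable_mult)
    have "0 = (LINT x:Omega M|lebesgue. partial_deriv ?v k x)"
      by (rule periodic_integral_partial_deriv_zero[OF pers_group Omega_fund_domain _ _ lip ae S(1,2), symmetric])
         (use Omega_translates_finite(2)[of "{}"] psi_periodic[OF i] psi_periodic[OF j] S(3) in auto)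
    also have "\<dots> = (LINT x:Omega M|lebesgue. psi M a i x * partial_deriv (psi M a j) k x + psi M a j x * partial_deriv (psi M a i) k x)"
    proof (rule set_integrable_AE_cong(2)[OF set_integral_add(1)[OF psi_partial_integrable[OF i j] psi_partial_integrable[OF j i]]])
      show "AE x in lebesgue. x \<in> Omega M \<longrightarrow> psi M a i x * partial_deriv (psi M a j) k x + psi M a j x * partial_deriv (psi M a i) k x
          = partial_deriv ?v k x"
        using psi_AE_differentiable[OF i] psi_AE_differentiable[OF j]
        by eventually_elim (simp add: partial_deriv_mult)
    qed
    also have "\<dots> = (cvec M a i j + cvec M a j i) \<bullet> axis k 1"
      using set_integral_add(2)[OF psi_partial_integrable[OF i j, of k] psi_partial_integrable[OF j i, of k]]
      by (simp add: cvec_inner(3)[OF i j] cvec_inner(3)[OF j i] inner_add_left grad_inner_axis)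
    finally show ?thesis by simp
  qed
  then have "cvec M a i j + cvec M a j i = 0"
    by (simp add: vec_eq_iff inner_axis)
  then show ?thesis by (simp add: eq_neg_iff_add_eq_0)
qed

end

section \<open>Supports and neighbours\<close>

definition shape_support :: "'d::finite discretization \<Rightarrow> nat \<Rightarrow> nat \<Rightarrow> (real^'d) set" where
  "shape_support M j K = closure {y \<in> cell_elt M K. local_shape M j K y \<noteq> 0}"

text \<open>This relation refers to the reference elements only, not to the positions of the nodes. It will
characterize neighbours, which are therefore the same throughout the motion of the mesh.\<close>

definition shapes_overlap :: "'d::finite discretization \<Rightarrow> nat \<Rightarrow> nat \<Rightarrow> bool" where
  "shapes_overlap M i j \<longleftrightarrow> (\<exists>K\<in>cells M. \<not> negligible (shape_support M i K \<inter> shape_support M j K))"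

lemma shapes_overlap_sym: "shapes_overlap M i j \<longleftrightarrow> shapes_overlap M j i"
  by (simp add: shapes_overlap_def Int_commute)

context mesh begin

lemma shape_support_subset: "K \<in> cells M \<Longrightarrow> shape_support M j K \<subseteq> E K"
  unfolding shape_support_def by (rule closure_minimal) (use cell_elt_facts in auto)

lemma supp_closed: "closed (supp M a i)"
  by (simp add: supp_def)

lemma supp_measurable: "supp M a i \<in> sets lebesgue"
  using supp_closed by (simp add: borel_closed)

lemma supp_periodic:
  assumes i: "i \<in> dofs M" and p: "p \<in> pers M"
  shows "(+) p ` supp M a i = supp M a i"
proof -
  have "(+) p ` {x. psi M a i x \<noteq> 0} = {x. psi M a i x \<noteq> 0}"
  proof (intro equalityI subsetI)
    fix x assume x: "x \<in> {x. psi M a i x \<noteq> 0}"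
    have "psi M a i (- p + x) = psi M a i x"
      by (rule psi_periodic[OF i pers_closed(2)[OF p p]])
    then have "- p + x \<in> {x. psi M a i x \<noteq> 0}" using x by simp
    then show "x \<in> (+) p ` {x. psi M a i x \<noteq> 0}" by (rule rev_image_eqI) simp
  qed (auto simp: psi_periodic[OF i p])
  then show ?thesis unfolding supp_def by (metis closure_translation)
qed

lemma supp_supset:
  assumes i: "i \<in> dofs M" and K: "K \<in> cells M" "p \<in> pers M" "y \<in> shape_support M i K"
  shows "p + T K y \<in> supp M a i"
proof -
  let ?S = "{y \<in> E K. local_shape M i K y \<noteq> 0}"
  have "T K ` closure ?S \<subseteq> supp M a i"
  proof (rule image_closure_subset)
    show "continuous_on (closure ?S) (T K)"
      using T_cont[OF K(1)] shape_support_subset[OF K(1)] continuous_on_subset unfolding shape_support_def by blast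
    have "T K ` ?S \<subseteq> {x. psi M a i x \<noteq> 0}"
      using psi_cell[OF i K(1) zero_pers] by auto
    then show "T K ` ?S \<subseteq> supp M a i" unfolding supp_def using closure_subset by blast
  qed (rule supp_closed)
  then have "T K y \<in> supp M a i" using K(3) unfolding shape_support_def by blast
  then show ?thesis using supp_periodic[OF i K(2)] by blast
qed

text \<open>If \<open>y\<close> were outside the support of the local shape function, the shape function would vanish on an
open neighbourhood of the image of \<open>y\<close>.\<close>

lemma supp_regular:
  assumes i: "i \<in> dofs M" and K: "K \<in> cells M" "p \<in> pers M" "y \<in> interior (E K)"
    and x: "p + T K y \<in> supp M a i"
  shows "y \<in> shape_support M i K"
proof (rule ccontr)
  assume ny: "y \<notin> shape_support M i K"
  define V where "V = interior (E K) - shape_support M i K"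
  have V: "open V" "y \<in> V" "V \<subseteq> E K"
    unfolding V_def shape_support_def using K(3) ny interior_subset by (auto simp: shape_support_def)
  have "open (T K ` V)"
    using V T_cont[OF K(1)] T_inj[OF K(1)] continuous_on_subset inj_on_subset by (intro invariance_of_domain) blast+
  then have o: "open ((+) p ` T K ` V)" by (rule open_translation)
  have "psi M a i (p + T K z) = 0" if z: "z \<in> V" for z
  proof -
    have "z \<notin> {y \<in> E K. local_shape M i K y \<noteq> 0}"
      using z closure_subset[of "{y \<in> E K. local_shape M i K y \<noteq> 0}"]
      unfolding V_def shape_support_def by blast
    moreover have zE: "z \<in> E K" using z V(3) by blast
    ultimately have "local_shape M i K z = 0" by blast
    then show ?thesis using psi_cell[OF i K(1,2) zE] by simp
  qed
  then have "(+) p ` T K ` V \<inter> {x. psi M a i x \<noteq> 0} = {}" by blast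
  then have "(+) p ` T K ` V \<inter> supp M a i = {}"
    unfolding supp_def using o by (simp add: open_Int_closure_eq_empty)
  then show False using x V(2) by blast
qed

text \<open>Up to the skeleton, the common support is the union of the images of the common supports on the
reference elements, and cell maps preserve null sets in both directions. Periodicity allows to pass
between the fundamental domain and the whole space.\<close>

lemma supp_overlap_negligible_iff:
  assumes i: "i \<in> dofs M" and j: "j \<in> dofs M"
  shows "negligible (Omega M \<inter> (supp M a j \<inter> supp M a i)) \<longleftrightarrow> \<not> shapes_overlap M i j"
proof
  assume n: "negligible (Omega M \<inter> (supp M a j \<inter> supp M a i))"
  let ?S = "supp M a j \<inter> supp M a i"
  have "?S \<subseteq> (\<Union>p\<in>pers M. (+) p ` (Omega M \<inter> ?S))"
  proof
    fix x assume x: "x \<in> ?S"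
    obtain p z where p: "p \<in> pers M" "z \<in> Omega M" "x = p + z"
      using Omega_fund_domain unfolding fund_domain_def by blast
    have "z = - p + x" using p by simp
    then have "z \<in> (+) (- p) ` supp M a j" "z \<in> (+) (- p) ` supp M a i" using x by blast+
    then have "z \<in> ?S"
      using supp_periodic[OF j pers_closed(2)[OF p(1) p(1)]] supp_periodic[OF i pers_closed(2)[OF p(1) p(1)]] by blast
    then show "x \<in> (\<Union>p\<in>pers M. (+) p ` (Omega M \<inter> ?S))" using p by blast
  qed
  moreover have "negligible (\<Union>p\<in>pers M. (+) p ` (Omega M \<inter> ?S))"
    using periods_countable n by (intro negligible_countable_Union countable_image) (auto intro: negligible_translation)
  ultimately have S: "negligible ?S" by (rule negligible_subset[rotated])
  have "negligible (shape_support M i K \<inter> shape_support M j K)" if K: "K \<in> cells M" for K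
  proof -
    have sub: "shape_support M i K \<inter> shape_support M j K \<subseteq> E K" using shape_support_subset[OF K] by blast
    have "T K ` (shape_support M i K \<inter> shape_support M j K) \<subseteq> ?S"
      using supp_supset[OF i K zero_pers] supp_supset[OF j K zero_pers] by auto
    then have "negligible (T K ` (shape_support M i K \<inter> shape_support M j K))"
      using S negligible_subset by blast
    then show ?thesis using T_negligible_iff[OF K sub] by blast
  qed
  then show "\<not> shapes_overlap M i j" unfolding shapes_overlap_def by blast
next
  assume no: "\<not> shapes_overlap M i j"
  define N where "N = (\<Union>K\<in>cells M. \<Union>p\<in>pers M. (+) p ` T K ` (shape_support M i K \<inter> shape_support M j K))"
  have "negligible N"
    unfolding N_def
  proof (intro negligible_countable_Union countable_image)
    show "countable (cells M)" by simp
    fix S assume "S \<in> (\<lambda>K. \<Union>p\<in>pers M. (+) p ` T K ` (shape_support M i K \<inter> shape_support M j K)) ` cells M"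
    then obtain K where K: "K \<in> cells M" "S = (\<Union>p\<in>pers M. (+) p ` T K ` (shape_support M i K \<inter> shape_support M j K))" by blast
    have "negligible (T K ` (shape_support M i K \<inter> shape_support M j K))"
      using no K(1) shape_support_subset[OF K(1)] unfolding shapes_overlap_def by (intro T_negligible) auto
    then show "negligible S"
      unfolding K(2) using periods_countable
      by (intro negligible_countable_Union countable_image) (auto intro: negligible_translation)
  qed
  moreover have "Omega M \<inter> (supp M a j \<inter> supp M a i) \<subseteq> skeleton \<union> N"
  proof
    fix x assume x: "x \<in> Omega M \<inter> (supp M a j \<inter> supp M a i)"
    show "x \<in> skeleton \<union> N"
    proof (rule ccontr)
      assume nx: "x \<notin> skeleton \<union> N"
      then have "x \<notin> skeleton" by blast
      then obtain K p y where K: "K \<in> cells M" "p \<in> pers M" "y \<in> interior (E K)" "x = p + T K y"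
        by (rule regular_point)
      have "y \<in> shape_support M i K \<inter> shape_support M j K"
        using supp_regular[OF i K(1-3)] supp_regular[OF j K(1-3)] x K(4) by blast
      then have "x \<in> N" unfolding N_def K(4) using K by blast
      then show False using nx by blast
    qed
  qed
  ultimately show "negligible (Omega M \<inter> (supp M a j \<inter> supp M a i))"
    using skeleton_negligible negligible_Un negligible_subset by blast
qed

lemma nb_iff:
  assumes i: "i \<in> dofs M"
  shows "j \<in> nb M a i \<longleftrightarrow> j \<in> dofs M \<and> shapes_overlap M i j"
proof (cases "j \<in> dofs M")
  case True
  have "Omega M \<inter> (supp M a j \<inter> supp M a i) \<in> sets lebesgue"
    using Omega_measurable supp_measurable by blast
  then have "emeasure lebesgue (Omega M \<inter> (supp M a j \<inter> supp M a i)) = 0 \<longleftrightarrow> \<not> shapes_overlap M i j"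
    using supp_overlap_negligible_iff[OF i True] by (simp add: negligible_iff_null_sets null_sets_def)
  then show ?thesis using True by (simp add: nbh_def)
qed (simp add: nbh_def)

lemma nb_dofs: "nb M a i \<subseteq> dofs M"
  by (auto simp: nbh_def)

lemma nb_sym: "i \<in> dofs M \<Longrightarrow> j \<in> nb M a i \<Longrightarrow> i \<in> nb M a j"
  using nb_iff[of i j] nb_iff[of j i] shapes_overlap_sym by blast

lemma nb_finite:
  assumes i: "i \<in> dofs M" shows "finite (nb M a i)"
proof -
  have fin: "finite {K \<in> cells M. i \<in> cell_dofs K}"
    using adm unfolding cell_dofs_def by (simp add: admissible_discretization_def)
  have "nb M a i \<subseteq> (\<Union>K\<in>{K \<in> cells M. i \<in> cell_dofs K}. cell_dofs K)"
  proof
    fix j assume "j \<in> nb M a i"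
    then obtain K where K: "K \<in> cells M" "\<not> negligible (shape_support M i K \<inter> shape_support M j K)"
      unfolding nb_iff[OF i] shapes_overlap_def by blast
    then have ne: "shape_support M i K \<noteq> {}" "shape_support M j K \<noteq> {}" by auto
    have "l \<in> cell_dofs K" if "shape_support M l K \<noteq> {}" for l
      using that local_shape_zero unfolding shape_support_def by fastforce
    then show "j \<in> (\<Union>K\<in>{K \<in> cells M. i \<in> cell_dofs K}. cell_dofs K)" using ne K(1) by blast
  qed
  then show ?thesis
    by (rule finite_subset) (use fin cell_dofs_finite in blast)
qed

text \<open>By linear independence a local shape function is not identically zero, and by continuity it is then
nonzero at an interior point.\<close>

lemma shape_nonzero_interior:
  assumes i: "i \<in> dofs M"
  obtains K where "K \<in> cells M" "open {y \<in> interior (E K). local_shape M i K y \<noteq> 0}"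
    "{y \<in> interior (E K). local_shape M i K y \<noteq> 0} \<noteq> {}"
proof -
  obtain K l where K: "K \<in> cells M" "l \<in> {1..nsh M (ref M K)}" "i = con M l K"
    using i unfolding dofs_def by blast
  have indep: "\<forall>c. (\<forall>y\<in>E K. (\<Sum>i=1..nsh M (ref M K). c i * shape M (ref M K) i y) = 0) \<longrightarrow>
        (\<forall>i\<in>{1..nsh M (ref M K)}. c i = 0)"
    using cell_reference_element[OF K(1)] unfolding reference_element_def by (elim conjE) assumption
  have c: "continuous_on (E K) (local_shape M i K)"
    by (rule C1_near_continuous[OF local_shape_C1[OF K(1)]])
  have "{y \<in> interior (E K). local_shape M i K y \<noteq> 0} \<noteq> {}"
  proof
    assume e: "{y \<in> interior (E K). local_shape M i K y \<noteq> 0} = {}"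
    have cl: "closure (interior (E K)) = E K"
      using convex_closure_interior[OF cell_elt_facts(2)[OF K(1)] cell_elt_facts(4)[OF K(1)]] cell_elt_facts(3)[OF K(1)] by simp
    have "local_shape M i K y = 0" if y: "y \<in> E K" for y
      by (rule continuous_constant_on_closure[of "interior (E K)" "local_shape M i K" 0 y])
         (use e c y cl in auto)
    then have z: "\<And>y. y \<in> E K \<Longrightarrow> shape M (ref M K) l y = 0"
      using local_shape_con[OF K(1,2)] K(3) by simp
    have "(\<Sum>i=1..nsh M (ref M K). (if i = l then 1 else 0) * shape M (ref M K) i y) = 0" if "y \<in> E K" for y
      by (rule sum.neutral) (use z that in auto)
    then have "\<forall>i\<in>{1..nsh M (ref M K)}. (if i = l then 1 else 0 :: real) = 0"
      using indep[rule_format, of "\<lambda>i. if i = l then 1 else 0"] by blast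
    from bspec[OF this K(2)] show False by simp
  qed
  moreover have "open {y \<in> interior (E K). local_shape M i K y \<noteq> 0}"
  proof -
    have "continuous_on (interior (E K)) (local_shape M i K)"
      using c interior_subset continuous_on_subset by blast
    then have "open (interior (E K) \<inter> local_shape M i K -` (- {0}))"
      by (rule continuous_open_preimage) auto
    moreover have "interior (E K) \<inter> local_shape M i K -` (- {0}) = {y \<in> interior (E K). local_shape M i K y \<noteq> 0}" by auto
    ultimately show ?thesis by simp
  qed
  ultimately show ?thesis using that K(1) by blast
qed

lemma nb_self: assumes i: "i \<in> dofs M" shows "i \<in> nb M a i"
proof -
  obtain K where K: "K \<in> cells M" "open {y \<in> interior (E K). local_shape M i K y \<noteq> 0}"
    "{y \<in> interior (E K). local_shape M i K y \<noteq> 0} \<noteq> {}"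
    by (rule shape_nonzero_interior[OF i])
  have "{y \<in> interior (E K). local_shape M i K y \<noteq> 0} \<subseteq> shape_support M i K"
    unfolding shape_support_def
    using interior_subset[of "E K"] closure_subset[of "{y \<in> E K. local_shape M i K y \<noteq> 0}"] by blast
  then have "\<not> negligible (shape_support M i K \<inter> shape_support M i K)"
    using open_not_negligible[OF K(2,3)] negligible_subset by auto
  then show ?thesis unfolding nb_iff[OF i] shapes_overlap_def using i K(1) by blast
qed

lemma mass_pos: assumes i: "i \<in> dofs M" shows "0 < mass M a i"
proof -
  have int: "set_integrable lebesgue (Omega M) (psi M a i)"
    using psi_times_integrable[OF i, of "\<lambda>_. 1" 1] by simp
  have nn: "0 \<le> mass M a i"
    unfolding mass_def set_lebesgue_integral_def
    by (rule integral_nonneg_AE) (use psi_bounds[OF i] in \<open>auto simp: indicator_def\<close>)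
  have "mass M a i \<noteq> 0"
  proof
    assume "mass M a i = 0"
    then have "AE x in lebesgue. indicator (Omega M) x *\<^sub>R psi M a i x = 0"
      using int psi_bounds[OF i] unfolding mass_def set_lebesgue_integral_def set_integrable_def
      by (subst (asm) integral_nonneg_eq_0_iff_AE) (auto simp: indicator_def)
    then have "{x. \<not> (indicator (Omega M) x *\<^sub>R psi M a i x = 0)} \<in> null_sets lebesgue"
      using completion.AE_iff_null_sets[where M=lborel and P="\<lambda>x. indicator (Omega M) x *\<^sub>R psi M a i x = 0"] by simp
    then have n: "negligible {x. \<not> (indicator (Omega M) x *\<^sub>R psi M a i x = 0)}"
      by (simp only: negligible_iff_null_sets)
    have "{x. psi M a i x \<noteq> 0} \<subseteq> (\<Union>p\<in>pers M. (+) p ` {x. \<not> (indicator (Omega M) x *\<^sub>R psi M a i x = 0)})"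
    proof
      fix x assume x: "x \<in> {x. psi M a i x \<noteq> 0}"
      obtain p z where p: "p \<in> pers M" "z \<in> Omega M" "x = p + z"
        using Omega_fund_domain unfolding fund_domain_def by blast
      have "psi M a i z \<noteq> 0" using x psi_periodic[OF i p(1)] p(3) by simp
      then show "x \<in> (\<Union>p\<in>pers M. (+) p ` {x. \<not> (indicator (Omega M) x *\<^sub>R psi M a i x = 0)})"
        using p(2) by (intro UN_I[OF p(1)] image_eqI[where x=z and f="(+) p"] p(3)) simp
    qed
    moreover have "negligible (\<Union>p\<in>pers M. (+) p ` {x. \<not> (indicator (Omega M) x *\<^sub>R psi M a i x = 0)})"
      using periods_countable n by (intro negligible_countable_Union countable_image) (auto intro: negligible_translation)
    ultimately have neg: "negligible {x. psi M a i x \<noteq> 0}" using negligible_subset by blast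
    have "open (psi M a i -` (- {0}))"
      using continuous_open_vimage[of "- {0}" "psi M a i"] psi_continuous[OF i] by (auto simp: continuous_on_eq_continuous_at)
    moreover have "psi M a i -` (- {0}) = {x. psi M a i x \<noteq> 0}" by auto
    ultimately have o: "open {x. psi M a i x \<noteq> 0}" by simp
    obtain K where K: "K \<in> cells M" "{y \<in> interior (E K). local_shape M i K y \<noteq> 0} \<noteq> {}"
      using shape_nonzero_interior[OF i] by blast
    then obtain y where "y \<in> interior (E K)" "local_shape M i K y \<noteq> 0" by blast
    then have "{x. psi M a i x \<noteq> 0} \<noteq> {}"
      using psi_cell[OF i K(1) zero_pers interior_elt] by force
    then show False using open_not_negligible[OF o] neg by blast
  qed
  with nn show ?thesis by linarith
qed

end

section \<open>Conservation and divergence identities\<close>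

lemma grad_zero_open:
  assumes "open U" "x \<in> U" "\<And>z. z \<in> U \<Longrightarrow> v z = 0"
  shows "grad v x = 0"
proof -
  have "((\<lambda>_. 0) has_derivative (\<lambda>_. 0)) (at x)" by simp
  then have "(v has_derivative (\<lambda>_. 0)) (at x)"
    by (rule has_derivative_transform_within_open[OF _ assms(1,2)]) (simp add: assms(3))
  from frechet_derivative_at[OF this, symmetric] show ?thesis
    by (simp add: grad_def partial_deriv_def vec_eq_iff)
qed

lemma dvg_sum_scaleR:
  fixes V :: "'j \<Rightarrow> real^'n"
  assumes "\<And>j. j \<in> J \<Longrightarrow> g j differentiable (at x)"
  shows "dvg (\<lambda>x. \<Sum>j\<in>J. g j x *\<^sub>R V j) x = (\<Sum>j\<in>J. grad (g j) x \<bullet> V j)"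
proof -
  have "((\<lambda>x. \<Sum>j\<in>J. g j x *\<^sub>R V j) has_derivative (\<lambda>h. \<Sum>j\<in>J. frechet_derivative (g j) (at x) h *\<^sub>R V j)) (at x)"
    by (intro has_derivative_sum has_derivative_scaleR_left) (use assms in \<open>simp flip: frechet_derivative_works\<close>)
  from frechet_derivative_at[OF this, symmetric] have
    "dvg (\<lambda>x. \<Sum>j\<in>J. g j x *\<^sub>R V j) x = (\<Sum>k\<in>UNIV. \<Sum>j\<in>J. partial_deriv (g j) k x * V j $ k)"
    by (simp add: dvg_def partial_deriv_def)
  also have "\<dots> = (\<Sum>j\<in>J. grad (g j) x \<bullet> V j)"
    by (subst sum.swap) (simp add: grad_def inner_vec_def)
  finally show ?thesis .
qed

lemma dvg_transform:
  assumes "open U" "x \<in> U" "\<And>z. z \<in> U \<Longrightarrow> v z = w z" "w differentiable (at x)"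
  shows "dvg v x = dvg w x"
proof -
  have "(w has_derivative frechet_derivative w (at x)) (at x)"
    using assms(4) by (simp flip: frechet_derivative_works)
  then have "(v has_derivative frechet_derivative w (at x)) (at x)"
    by (rule has_derivative_transform_within_open[OF _ assms(1,2)]) (simp add: assms(3))
  from frechet_derivative_at[OF this, symmetric] show ?thesis by (simp add: dvg_def)
qed

context mesh begin

lemma regular_neighbourhood:
  assumes K: "K \<in> cells M" "p \<in> pers M" "y \<in> interior (E K)"
  obtains U where "open U" "p + T K y \<in> U" "\<And>z. z \<in> U \<Longrightarrow> \<exists>y'\<in>E K. z = p + T K y'"
proof
  show "open ((+) p ` T K ` interior (E K))"
    by (rule open_translation[OF T_open[OF K(1)]])
  show "p + T K y \<in> (+) p ` T K ` interior (E K)" using K(3) by blast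
  show "\<exists>y'\<in>E K. z = p + T K y'" if "z \<in> (+) p ` T K ` interior (E K)" for z
    using that interior_subset[of "E K"] by blast
qed

lemma AE_support_neighbour:
  assumes i: "i \<in> dofs M"
  shows "AE x in lebesgue. x \<in> Omega M \<longrightarrow> (\<forall>j\<in>dofs M. x \<in> supp M a i \<longrightarrow> x \<in> supp M a j \<longrightarrow> j \<in> nb M a i)"
proof -
  have "AE x in lebesgue. \<forall>j\<in>dofs M - nb M a i. x \<notin> Omega M \<inter> (supp M a j \<inter> supp M a i)"
  proof (subst AE_ball_countable)
    show "\<forall>j\<in>dofs M - nb M a i. AE x in lebesgue. x \<notin> Omega M \<inter> (supp M a j \<inter> supp M a i)"
    proof
      fix j assume "j \<in> dofs M - nb M a i"
      then have "negligible (Omega M \<inter> (supp M a j \<inter> supp M a i))"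
        using supp_overlap_negligible_iff[OF i] nb_iff[OF i] by blast
      then show "AE x in lebesgue. x \<notin> Omega M \<inter> (supp M a j \<inter> supp M a i)"
        by (intro AE_not_in) (simp only: negligible_iff_null_sets)
    qed
  qed simp
  then show ?thesis by eventually_elim blast
qed

lemma psi_supp: "psi M a i x \<noteq> 0 \<Longrightarrow> x \<in> supp M a i"
  unfolding supp_def using closure_subset[of "{x. psi M a i x \<noteq> 0}"] by blast

lemma grad_psi_off_supp: "x \<notin> supp M a j \<Longrightarrow> grad (psi M a j) x = 0"
  by (rule grad_zero_open[of "- supp M a j"]) (use supp_closed psi_supp in \<open>auto simp: open_Compl\<close>)

text \<open>The neighbours of \<open>i\<close> and the degrees of freedom of a cell differ only in shape functions whose
gradient vanishes wherever \<open>\<psi>\<^sub>i\<close> does not, up to a null set. This allows to compute with the partition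
of unity and with the velocity field cell by cell.\<close>

lemma AE_cell_sum:
  assumes i: "i \<in> dofs M"
  shows "AE x in lebesgue. x \<in> Omega M \<longrightarrow> (\<exists>K\<in>cells M. \<exists>p\<in>pers M. \<exists>y\<in>interior (E K). x = p + T K y \<and> x \<notin> skeleton \<and>
     (\<forall>c. psi M a i x * (\<Sum>j\<in>nb M a i. grad (psi M a j) x \<bullet> c j) = psi M a i x * (\<Sum>j\<in>cell_dofs K. grad (psi M a j) x \<bullet> c j)))"
  using AE_regular AE_support_neighbour[OF i]
proof eventually_elim
  case (elim x)
  show ?case
  proof
    assume x: "x \<in> Omega M"
    obtain K p y where K: "K \<in> cells M" "p \<in> pers M" "y \<in> interior (E K)" "x = p + T K y"
      using regular_point[OF elim(1)] .
    have "psi M a i x * (\<Sum>j\<in>nb M a i. grad (psi M a j) x \<bullet> c j) = psi M a i x * (\<Sum>j\<in>cell_dofs K. grad (psi M a j) x \<bullet> c j)" for c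
    proof (cases "psi M a i x = 0")
      case False
      obtain U where U: "open U" "x \<in> U" "\<And>z. z \<in> U \<Longrightarrow> \<exists>y'\<in>E K. z = p + T K y'"
        using regular_neighbourhood[OF K(1-3)] K(4) by metis
      have 1: "grad (psi M a j) x = 0" if j: "j \<in> nb M a i - cell_dofs K" for j
      proof (rule grad_zero_open[OF U(1,2)])
        fix z assume "z \<in> U"
        then obtain y' where "y' \<in> E K" "z = p + T K y'" using U(3) by blast
        then show "psi M a j z = 0"
          using psi_cell[OF _ K(1,2), of j y'] local_shape_zero[of j K] nb_dofs j by auto
      qed
      have 2: "grad (psi M a j) x = 0" if j: "j \<in> cell_dofs K - nb M a i" for j
      proof (rule grad_psi_off_supp)
        show "x \<notin> supp M a j"
          using elim(2) x psi_supp[OF False] j cell_dofs_dofs[OF K(1)] by blast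
      qed
      have "(\<Sum>j\<in>nb M a i. grad (psi M a j) x \<bullet> c j) = (\<Sum>j\<in>nb M a i \<inter> cell_dofs K. grad (psi M a j) x \<bullet> c j)"
        by (rule sum.mono_neutral_right) (use nb_finite[OF i] 1 in auto)
      also have "\<dots> = (\<Sum>j\<in>cell_dofs K. grad (psi M a j) x \<bullet> c j)"
      proof (rule sum.mono_neutral_left[OF cell_dofs_finite])
        show "\<forall>j\<in>cell_dofs K - nb M a i \<inter> cell_dofs K. grad (psi M a j) x \<bullet> c j = 0"
        proof
          fix j assume "j \<in> cell_dofs K - nb M a i \<inter> cell_dofs K"
          then have "j \<in> cell_dofs K - nb M a i" by blast
          from 2[OF this] show "grad (psi M a j) x \<bullet> c j = 0" by simp
        qed
      qed blast
      finally show ?thesis by simp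
    qed simp
    then show "\<exists>K\<in>cells M. \<exists>p\<in>pers M. \<exists>y\<in>interior (E K). x = p + T K y \<and> x \<notin> skeleton \<and>
     (\<forall>c. psi M a i x * (\<Sum>j\<in>nb M a i. grad (psi M a j) x \<bullet> c j) = psi M a i x * (\<Sum>j\<in>cell_dofs K. grad (psi M a j) x \<bullet> c j))"
      using K elim(1) by blast
  qed
qed

lemma sum_cvec_inner:
  assumes i: "i \<in> dofs M"
  shows "set_integrable lebesgue (Omega M) (\<lambda>x. psi M a i x * (\<Sum>j\<in>nb M a i. grad (psi M a j) x \<bullet> c j))"
    and "(LINT x:Omega M|lebesgue. psi M a i x * (\<Sum>j\<in>nb M a i. grad (psi M a j) x \<bullet> c j)) = (\<Sum>j\<in>nb M a i. cvec M a i j \<bullet> c j)"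
proof -
  have I: "set_integrable lebesgue (Omega M) (\<lambda>x. psi M a i x * (grad (psi M a j) x \<bullet> c j))" if "j \<in> nb M a i" for j
    using cvec_inner(2)[OF i] nb_dofs that by blast
  show "set_integrable lebesgue (Omega M) (\<lambda>x. psi M a i x * (\<Sum>j\<in>nb M a i. grad (psi M a j) x \<bullet> c j))"
    unfolding sum_distrib_left set_integrable_def scaleR_sum_right
    by (intro Bochner_Integration.integrable_sum) (use I in \<open>simp add: set_integrable_def\<close>)
  show "(LINT x:Omega M|lebesgue. psi M a i x * (\<Sum>j\<in>nb M a i. grad (psi M a j) x \<bullet> c j)) = (\<Sum>j\<in>nb M a i. cvec M a i j \<bullet> c j)"
  proof -
    have "(LINT x:Omega M|lebesgue. psi M a i x * (\<Sum>j\<in>nb M a i. grad (psi M a j) x \<bullet> c j))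
      = (\<Sum>j\<in>nb M a i. LINT x:Omega M|lebesgue. psi M a i x * (grad (psi M a j) x \<bullet> c j))"
      unfolding sum_distrib_left set_lebesgue_integral_def scaleR_sum_right
      by (intro Bochner_Integration.integral_sum) (use I in \<open>simp add: set_integrable_def\<close>)
    also have "\<dots> = (\<Sum>j\<in>nb M a i. cvec M a i j \<bullet> c j)"
      by (intro sum.cong refl, rule cvec_inner(3)[OF i, symmetric]) (use nb_dofs in blast)
    finally show ?thesis .
  qed
qed

text \<open>The shape functions of a cell add up to 1 near each of its interior points, so their gradients add up
to 0.\<close>

lemma sum_cvec_zero:
  assumes i: "i \<in> dofs M" shows "(\<Sum>j\<in>nb M a i. cvec M a i j) = 0"
proof -
  have "(\<Sum>j\<in>nb M a i. cvec M a i j \<bullet> w) = 0" for w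
  proof -
    have "AE x in lebesgue. x \<in> Omega M \<longrightarrow> psi M a i x * (\<Sum>j\<in>nb M a i. grad (psi M a j) x \<bullet> w) = 0"
      using AE_cell_sum[OF i]
    proof eventually_elim
      case (elim x)
      show ?case
      proof
        assume "x \<in> Omega M"
        with elim obtain K p y where K: "K \<in> cells M" "p \<in> pers M" "y \<in> interior (E K)" "x = p + T K y" "x \<notin> skeleton"
          and eqs: "\<forall>c. psi M a i x * (\<Sum>j\<in>nb M a i. grad (psi M a j) x \<bullet> c j) = psi M a i x * (\<Sum>j\<in>cell_dofs K. grad (psi M a j) x \<bullet> c j)"
          by blast
        note eq = spec[OF eqs, of "\<lambda>_. w"]
        obtain U where U: "open U" "x \<in> U" "\<And>z. z \<in> U \<Longrightarrow> \<exists>y'\<in>E K. z = p + T K y'"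
          using regular_neighbourhood[OF K(1-3)] K(4) by metis
        have one: "(\<Sum>j\<in>cell_dofs K. psi M a j z) = 1" if zU: "z \<in> U" for z
        proof -
          obtain y' where y': "y' \<in> E K" "z = p + T K y'" using U(3)[OF zU] by blast
          have "(\<Sum>j\<in>cell_dofs K. psi M a j z) = (\<Sum>j\<in>cell_dofs K. local_shape M j K y')"
            unfolding y'(2) by (intro sum.cong refl psi_cell K y') (use cell_dofs_dofs[OF K(1)] in blast)
          then show ?thesis using partition_of_unity[OF K(1) y'(1)] by simp
        qed
        have diff: "psi M a j differentiable (at x)" if "j \<in> cell_dofs K" for j
          using psi_differentiable K(5) cell_dofs_dofs[OF K(1)] that by blast
        have "(\<Sum>j\<in>cell_dofs K. grad (psi M a j) x \<bullet> w) = dvg (\<lambda>x. \<Sum>j\<in>cell_dofs K. psi M a j x *\<^sub>R w) x"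
          by (rule dvg_sum_scaleR[OF diff, symmetric])
        also have "\<dots> = dvg (\<lambda>_. w) x"
          by (rule dvg_transform[OF U(1,2)]) (use one in \<open>simp_all flip: scaleR_left.sum\<close>)
        also have "\<dots> = 0" by (simp add: dvg_def frechet_derivative_const)
        finally show "psi M a i x * (\<Sum>j\<in>nb M a i. grad (psi M a j) x \<bullet> w) = 0" using eq by simp
      qed
    qed
    from set_integrable_AE_cong(2)[OF sum_cvec_inner(1)[OF i] this]
    show ?thesis using sum_cvec_inner(2)[OF i, of "\<lambda>_. w"] by (simp add: set_lebesgue_integral_def)
  qed
  then have "(\<Sum>j\<in>nb M a i. cvec M a i j) \<bullet> (\<Sum>j\<in>nb M a i. cvec M a i j) = 0"
    by (simp add: inner_sum_left)
  then show ?thesis by simp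
qed

lemma flux_divergence_integral:
  assumes i: "i \<in> dofs M"
  shows "(LINT x:Omega M|lebesgue. dvg (\<lambda>x. \<Sum>j\<in>nb M a i. psi M a j x *\<^sub>R V j) x * psi M a i x)
     = (\<Sum>j\<in>nb M a i. cvec M a i j \<bullet> V j)"
proof -
  have "AE x in lebesgue. x \<in> Omega M \<longrightarrow> psi M a i x * (\<Sum>j\<in>nb M a i. grad (psi M a j) x \<bullet> V j)
      = dvg (\<lambda>x. \<Sum>j\<in>nb M a i. psi M a j x *\<^sub>R V j) x * psi M a i x"
    using AE_regular
  proof eventually_elim
    case (elim x)
    have "dvg (\<lambda>x. \<Sum>j\<in>nb M a i. psi M a j x *\<^sub>R V j) x = (\<Sum>j\<in>nb M a i. grad (psi M a j) x \<bullet> V j)"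
      by (rule dvg_sum_scaleR) (use psi_differentiable elim nb_dofs in blast)
    then show ?case by simp
  qed
  from set_integrable_AE_cong(2)[OF sum_cvec_inner(1)[OF i] this]
  show ?thesis using sum_cvec_inner(2)[OF i] by simp
qed

lemma velocity_cell:
  assumes K: "K \<in> cells M" "p \<in> pers M" "y \<in> E K"
  shows "velocity M a W (p + T K y) = (\<Sum>j\<in>cell_dofs K. local_shape M j K y *\<^sub>R W j)"
proof -
  let ?x = "p + T K y"
  have "velocity M a W ?x = (\<Sum>j\<in>cell_dofs K. psi M a j ?x *\<^sub>R W j)"
    unfolding velocity_def
  proof (rule sum.mono_neutral_left[OF cell_dofs_finite])
    show "{j \<in> dofs M. psi M a j ?x \<noteq> 0} \<subseteq> cell_dofs K"
    proof
      fix j assume j: "j \<in> {j \<in> dofs M. psi M a j ?x \<noteq> 0}"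
      then have "local_shape M j K y \<noteq> 0" using psi_cell[OF _ K, of j] by simp
      then show "j \<in> cell_dofs K" using local_shape_zero by blast
    qed
    show "\<forall>j\<in>cell_dofs K - {j \<in> dofs M. psi M a j ?x \<noteq> 0}. psi M a j ?x *\<^sub>R W j = 0"
      using cell_dofs_dofs[OF K(1)] by auto
  qed
  also have "\<dots> = (\<Sum>j\<in>cell_dofs K. local_shape M j K y *\<^sub>R W j)"
    by (intro sum.cong refl) (use psi_cell[OF _ K] cell_dofs_dofs[OF K(1)] in auto)
  finally show ?thesis .
qed

lemma velocity_divergence_integral:
  assumes i: "i \<in> dofs M"
  shows "set_integrable lebesgue (Omega M) (\<lambda>x. psi M a i x * dvg (velocity M a W) x)"
    and "(LINT x:Omega M|lebesgue. psi M a i x * dvg (velocity M a W) x) = (\<Sum>j\<in>nb M a i. cvec M a i j \<bullet> W j)"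
    and "(LINT x:Omega M \<inter> supp M a i|lebesgue. psi M a i x * dvg (velocity M a W) x) = (\<Sum>j\<in>nb M a i. cvec M a i j \<bullet> W j)"
proof -
  have "AE x in lebesgue. x \<in> Omega M \<longrightarrow> psi M a i x * (\<Sum>j\<in>nb M a i. grad (psi M a j) x \<bullet> W j)
      = psi M a i x * dvg (velocity M a W) x"
    using AE_cell_sum[OF i]
  proof eventually_elim
    case (elim x)
    show ?case
    proof
      assume "x \<in> Omega M"
      with elim obtain K p y where K: "K \<in> cells M" "p \<in> pers M" "y \<in> interior (E K)" "x = p + T K y" "x \<notin> skeleton"
        and eqs: "\<forall>c. psi M a i x * (\<Sum>j\<in>nb M a i. grad (psi M a j) x \<bullet> c j) = psi M a i x * (\<Sum>j\<in>cell_dofs K. grad (psi M a j) x \<bullet> c j)"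
        by blast
      note eq = spec[OF eqs, of W]
      obtain U where U: "open U" "x \<in> U" "\<And>z. z \<in> U \<Longrightarrow> \<exists>y'\<in>E K. z = p + T K y'"
        using regular_neighbourhood[OF K(1-3)] K(4) by metis
      have diff: "psi M a j differentiable (at x)" if "j \<in> cell_dofs K" for j
        using psi_differentiable K(5) cell_dofs_dofs[OF K(1)] that by blast
      have "dvg (velocity M a W) x = dvg (\<lambda>x. \<Sum>j\<in>cell_dofs K. psi M a j x *\<^sub>R W j) x"
      proof (rule dvg_transform[OF U(1,2)])
        fix z assume "z \<in> U"
        then obtain y' where y': "y' \<in> E K" "z = p + T K y'" using U(3) by blast
        show "velocity M a W z = (\<Sum>j\<in>cell_dofs K. psi M a j z *\<^sub>R W j)"
          unfolding y'(2) velocity_cell[OF K(1,2) y'(1)]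
          by (intro sum.cong refl) (use psi_cell[OF _ K(1,2) y'(1)] cell_dofs_dofs[OF K(1)] in auto)
      next
        show "(\<lambda>x. \<Sum>j\<in>cell_dofs K. psi M a j x *\<^sub>R W j) differentiable (at x)"
          using diff cell_dofs_finite by (intro differentiable_sum differentiable_scaleR) auto
      qed
      also have "\<dots> = (\<Sum>j\<in>cell_dofs K. grad (psi M a j) x \<bullet> W j)"
        by (rule dvg_sum_scaleR[OF diff])
      finally show "psi M a i x * (\<Sum>j\<in>nb M a i. grad (psi M a j) x \<bullet> W j) = psi M a i x * dvg (velocity M a W) x"
        using eq by simp
    qed
  qed
  note ae = set_integrable_AE_cong[OF sum_cvec_inner(1)[OF i] this]
  show "set_integrable lebesgue (Omega M) (\<lambda>x. psi M a i x * dvg (velocity M a W) x)" by (rule ae(1))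
  from ae(2) show 1: "(LINT x:Omega M|lebesgue. psi M a i x * dvg (velocity M a W) x) = (\<Sum>j\<in>nb M a i. cvec M a i j \<bullet> W j)"
    using sum_cvec_inner(2)[OF i] by simp
  have eq: "indicator (Omega M \<inter> supp M a i) x *\<^sub>R (psi M a i x * dvg (velocity M a W) x)
      = indicator (Omega M) x *\<^sub>R (psi M a i x * dvg (velocity M a W) x)" for x
    using psi_supp[of i x] by (auto simp: indicator_def)
  show "(LINT x:Omega M \<inter> supp M a i|lebesgue. psi M a i x * dvg (velocity M a W) x) = (\<Sum>j\<in>nb M a i. cvec M a i j \<bullet> W j)"
    using 1 unfolding set_lebesgue_integral_def eq .
qed

lemma psi_integrable: "i \<in> dofs M \<Longrightarrow> set_integrable lebesgue (Omega M) (psi M a i)"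
  using psi_times_integrable[of i "\<lambda>_. 1" 1] by simp

section \<open>Local mesh size\<close>

lemma overlap_mass_bounds:
  assumes i: "i \<in> dofs M"
  shows "0 \<le> overlap_mass M a i j" "overlap_mass M a i j \<le> mass M a i"
    and "(LINT x:Omega M \<inter> supp M a i|lebesgue. psi M a i x) = mass M a i"
proof -
  show "0 \<le> overlap_mass M a i j"
    unfolding overlap_mass_def set_lebesgue_integral_def
    by (rule integral_nonneg_AE) (use psi_bounds[OF i] in \<open>auto simp: indicator_def\<close>)
  have S: "Omega M \<inter> (supp M a i \<inter> supp M a j) \<in> sets lebesgue"
    using Omega_measurable supp_measurable by blast
  have "set_integrable lebesgue (Omega M \<inter> (supp M a i \<inter> supp M a j)) (psi M a i)"
    by (rule set_integrable_subset[OF psi_integrable[OF i] S]) auto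
  moreover have "indicator (Omega M \<inter> (supp M a i \<inter> supp M a j)) x *\<^sub>R psi M a i x \<le> indicator (Omega M) x *\<^sub>R psi M a i x" for x
    using psi_bounds(1)[OF i, of x] by (auto simp: indicator_def)
  ultimately show "overlap_mass M a i j \<le> mass M a i"
    using psi_integrable[OF i] unfolding overlap_mass_def mass_def set_lebesgue_integral_def set_integrable_def
    by (intro integral_mono)
  have eq: "indicator (Omega M \<inter> supp M a i) x *\<^sub>R psi M a i x = indicator (Omega M) x *\<^sub>R psi M a i x" for x
    using psi_supp[of i x] by (auto simp: indicator_def)
  show "(LINT x:Omega M \<inter> supp M a i|lebesgue. psi M a i x) = mass M a i"
    unfolding mass_def set_lebesgue_integral_def eq ..
qed

lemma grad_measurable:
  assumes "j \<in> dofs M" shows "(\<lambda>x. grad (psi M a j) x) \<in> borel_measurable lebesgue"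
proof -
  have "grad (psi M a j) x = (\<Sum>k\<in>UNIV. partial_deriv (psi M a j) k x *\<^sub>R axis k 1)" for x
    by (simp add: vec_eq_iff grad_def axis_def if_distrib cong: if_cong)
  moreover have "(\<lambda>x. \<Sum>k\<in>UNIV. partial_deriv (psi M a j) k x *\<^sub>R axis k 1 :: real^'d) \<in> borel_measurable lebesgue"
    using partial_deriv_measurable[OF psi_continuous[OF assms] psi_AE_differentiable[OF assms]]
    by (intro borel_measurable_sum borel_measurable_scaleR) auto
  ultimately show ?thesis by simp
qed

text \<open>The gradient of \<open>\<psi>\<^sub>j\<close> is essentially bounded on the common support by \<open>1 / hloc M a i j\<close>. The bound is a
real number because \<open>\<psi>\<^sub>j\<close> is Lipschitz, and it is nonnegative because the common support has positive
measure.\<close>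

lemma cvec_hloc_bound:
  assumes i: "i \<in> dofs M" and j: "j \<in> nb M a i"
  obtains e :: real where "0 \<le> e" "hloc M a i j = 1 / ereal e" "norm (cvec M a i j) \<le> e * overlap_mass M a i j"
proof -
  have jd: "j \<in> dofs M" using j nb_dofs by blast
  define S where "S = Omega M \<inter> (supp M a i \<inter> supp M a j)"
  define f where "f x = ereal (norm (grad (psi M a j) x))" for x
  have Sm: "S \<in> sets lebesgue" unfolding S_def using Omega_measurable supp_measurable by blast
  have S0: "emeasure lebesgue S \<noteq> 0" using j unfolding S_def nbh_def by (simp add: Int_commute)
  have fm: "f \<in> borel_measurable (lebesgue_on S)"
    unfolding f_def using grad_measurable[OF jd] by (intro measurable_restrict_space1) measurable
  have lo: "0 \<le> esssup (lebesgue_on S) f"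
  proof -
    have "emeasure (lebesgue_on S) (space (lebesgue_on S)) \<noteq> 0"
      using S0 Sm by (simp add: emeasure_restrict_space space_restrict_space)
    from esssup_const[OF this, of "0::ereal"] esssup_mono[of "\<lambda>_. 0" "lebesgue_on S" f]
    show ?thesis by (simp add: f_def)
  qed
  obtain C where C: "C-lipschitz_on UNIV (psi M a j)" using psi_lipschitz[OF jd] .
  have hi: "esssup (lebesgue_on S) f \<le> ereal (real CARD('d) * C)"
  proof (rule esssup_I[OF fm])
    have "AE x in lebesgue. f x \<le> ereal (real CARD('d) * C)"
      using psi_AE_differentiable[OF jd]
    proof eventually_elim
      case (elim x)
      have "norm (grad (psi M a j) x) \<le> (\<Sum>k\<in>UNIV. \<bar>grad (psi M a j) x $ k\<bar>)" by (rule norm_le_l1_cart)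
      also have "\<dots> \<le> (\<Sum>k\<in>(UNIV::'d set). C)"
        by (rule sum_mono) (use partial_deriv_lipschitz_bound[OF C elim] in \<open>simp add: grad_def\<close>)
      finally show ?case by (simp add: f_def)
    qed
    then show "AE x in lebesgue_on S. f x \<le> ereal (real CARD('d) * C)"
      using Sm by (subst AE_restrict_space_iff) auto
  qed
  obtain e where e: "esssup (lebesgue_on S) f = ereal e"
    using lo hi by (cases "esssup (lebesgue_on S) f") auto
  have e0: "0 \<le> e" using lo e by simp
  have "AE x in lebesgue_on S. f x \<le> ereal e" using esssup_AE[of f "lebesgue_on S"] e by simp
  then have ae: "AE x in lebesgue. x \<in> S \<longrightarrow> norm (grad (psi M a j) x) \<le> e"
    using Sm by (subst (asm) AE_restrict_space_iff) (auto simp: f_def)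
  have "norm (cvec M a i j) \<le> (LINT x|lebesgue. norm (indicator (Omega M) x *\<^sub>R (psi M a i x *\<^sub>R grad (psi M a j) x)))"
    unfolding cvec_def set_lebesgue_integral_def by (rule integral_norm_bound)
  also have "\<dots> \<le> (LINT x|lebesgue. e * (indicator S x *\<^sub>R psi M a i x))"
  proof (rule integral_mono_AE)
    show "integrable lebesgue (\<lambda>x. norm (indicator (Omega M) x *\<^sub>R (psi M a i x *\<^sub>R grad (psi M a j) x)))"
      using cvec_inner(1)[OF i jd] unfolding set_integrable_def by (rule integrable_norm)
    have "set_integrable lebesgue S (psi M a i)"
      by (rule set_integrable_subset[OF psi_integrable[OF i] Sm]) (auto simp: S_def)
    then show "integrable lebesgue (\<lambda>x. e * (indicator S x *\<^sub>R psi M a i x))"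
      unfolding set_integrable_def by (rule integrable_mult_right)
    show "AE x in lebesgue. norm (indicator (Omega M) x *\<^sub>R (psi M a i x *\<^sub>R grad (psi M a j) x)) \<le> e * (indicator S x *\<^sub>R psi M a i x)"
      using ae
    proof eventually_elim
      case (elim x)
      show ?case
      proof (cases "x \<in> S")
        case True
        then have "x \<in> Omega M" by (simp add: S_def)
        then show ?thesis
          using True elim psi_bounds[OF i, of x] mult_right_mono[of "norm (grad (psi M a j) x)" e "psi M a i x"]
          by (simp add: mult.commute)
      next
        case False
        then have "x \<notin> Omega M \<or> psi M a i x = 0 \<or> grad (psi M a j) x = 0"
          using psi_supp[of i x] grad_psi_off_supp[of x j] unfolding S_def by blast
        then show ?thesis using False by auto
      qed
    qed
  qed
  also have "\<dots> = e * overlap_mass M a i j"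
    unfolding overlap_mass_def set_lebesgue_integral_def S_def by simp
  finally have "norm (cvec M a i j) \<le> e * overlap_mass M a i j" .
  moreover have "hloc M a i j = 1 / ereal e"
    unfolding hloc_def using e unfolding S_def f_def by simp
  ultimately show ?thesis using that e0 by blast
qed

end

section \<open>Change of variables\<close>

text \<open>Change of variables in \<open>real^'n\<close> is formulated for a well-ordered index type. This copy of \<open>'a\<close> carries
such an order.\<close>

typedef ('a::finite) ranked = "{..<CARD('a)}"
  by (rule exI[of _ 0]) simp

instance ranked :: (finite) finite
proof
  have "(UNIV :: 'a ranked set) = Abs_ranked ` {..<CARD('a)}"
    using type_definition.Abs_image[OF type_definition_ranked] by auto
  then show "finite (UNIV :: 'a ranked set)" by (metis finite_imageI finite_lessThan)
qed

instantiation ranked :: (finite) wellorder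
begin

definition less_eq_ranked :: "'a ranked \<Rightarrow> 'a ranked \<Rightarrow> bool" where
  "less_eq_ranked x y \<longleftrightarrow> Rep_ranked x \<le> Rep_ranked y"

definition less_ranked :: "'a ranked \<Rightarrow> 'a ranked \<Rightarrow> bool" where
  "less_ranked x y \<longleftrightarrow> Rep_ranked x < Rep_ranked y"

instance
proof
  fix P :: "'a ranked \<Rightarrow> bool" and x :: "'a ranked"
  assume step: "\<And>x. (\<And>y. y < x \<Longrightarrow> P y) \<Longrightarrow> P x"
  show "P x"
  proof (induction x rule: measure_induct_rule[of Rep_ranked])
    case (less x)
    show ?case by (rule step) (rule less, simp add: less_ranked_def)
  qed
qed (simp_all add: less_eq_ranked_def less_ranked_def linear less_le_not_le flip: Rep_ranked_inject)

end

lemma ranked_bijection: obtains e :: "'a::finite ranked \<Rightarrow> 'a" where "bij e"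
proof -
  have "card (UNIV :: 'a ranked set) = card {..<CARD('a)}"
    by (rule type_definition.card[OF type_definition_ranked])
  then obtain e :: "'a ranked \<Rightarrow> 'a" where "bij_betw e UNIV UNIV"
    using finite_same_card_bij[of "UNIV :: 'a ranked set" "UNIV :: 'a set"] by auto
  then show ?thesis by (rule that)
qed

definition reindex :: "('e::finite \<Rightarrow> 'd::finite) \<Rightarrow> real^'d \<Rightarrow> real^'e" where
  "reindex e x = (\<chi> i. x $ e i)"

lemma reindex_linear: "bounded_linear (reindex e)"
  unfolding linear_conv_bounded_linear[symmetric]
  by (rule linearI) (auto simp: reindex_def vec_eq_iff)

lemma reindex_inverse:
  assumes "bij e"
  shows "reindex e (reindex (inv e) v) = v" "reindex (inv e) (reindex e x) = x"
  using assms by (simp_all add: reindex_def vec_eq_iff bij_is_inj bij_is_surj surj_f_inv_f inv_f_f)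

lemma reindex_axis:
  assumes "bij e" shows "reindex (inv e) (axis i 1) = axis (e i) 1"
proof -
  have "inv e k = i \<longleftrightarrow> k = e i" for k
    using assms by (metis bij_inv_eq_iff)
  then show ?thesis by (simp add: reindex_def vec_eq_iff axis_def)
qed

lemma prod_Basis_cart: "(\<Prod>b\<in>Basis. (x::real^'n) \<bullet> b) = (\<Prod>k\<in>UNIV. x $ k)"
proof -
  have B: "(Basis :: (real^'n) set) = range (\<lambda>k. axis k 1)" by (auto simp: Basis_vec_def)
  show ?thesis unfolding B by (subst prod.reindex) (auto simp: inj_on_def axis_eq_axis inner_axis)
qed

text \<open>Relabelling coordinates maps boxes to boxes with the same edge lengths.\<close>

lemma reindex_measure_preserving:
  fixes e :: "'e::finite \<Rightarrow> 'd::finite"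
  assumes e: "bij e"
  shows "reindex e \<in> lebesgue \<rightarrow>\<^sub>M lebesgue" "distr lebesgue lebesgue (reindex e) = lebesgue"
proof -
  have m: "reindex e \<in> borel_measurable borel"
    using reindex_linear linear_continuous_on by (intro borel_measurable_continuous_onI) blast
  have "lborel = distr lborel borel (reindex e)"
  proof (rule lborel_eqI)
    fix l u :: "real^'e" assume le: "\<And>b. b \<in> Basis \<Longrightarrow> l \<bullet> b \<le> u \<bullet> b"
    have le': "l $ i \<le> u $ i" for i
      using le[of "axis i 1"] by (simp add: inner_axis axis_in_Basis_iff)
    have v: "reindex e -` box l u = box (reindex (inv e) l) (reindex (inv e) u)"
    proof (intro equalityI subsetI)
      fix x assume "x \<in> reindex e -` box l u"
      then have *: "l $ i < x $ e i" "x $ e i < u $ i" for i by (auto simp: mem_box_cart reindex_def)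
      have "l $ inv e k < x $ k \<and> x $ k < u $ inv e k" for k
        using *[of "inv e k"] e by (simp add: bij_is_surj surj_f_inv_f)
      then show "x \<in> box (reindex (inv e) l) (reindex (inv e) u)" by (simp add: mem_box_cart reindex_def)
    next
      fix x assume "x \<in> box (reindex (inv e) l) (reindex (inv e) u)"
      then have *: "l $ inv e k < x $ k" "x $ k < u $ inv e k" for k by (auto simp: mem_box_cart reindex_def)
      have "l $ i < x $ e i \<and> x $ e i < u $ i" for i
        using *[of "e i"] e by (simp add: bij_is_inj inv_f_f)
      then show "x \<in> reindex e -` box l u" by (simp add: mem_box_cart reindex_def)
    qed
    have leb: "reindex (inv e) l \<bullet> b \<le> reindex (inv e) u \<bullet> b" if "b \<in> Basis" for b
      using that le' by (auto simp: Basis_vec_def inner_axis reindex_def)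
    have "emeasure (distr lborel borel (reindex e)) (box l u) = emeasure lborel (box (reindex (inv e) l) (reindex (inv e) u))"
      using m by (simp add: emeasure_distr v)
    also have "\<dots> = ennreal (\<Prod>b\<in>Basis. (reindex (inv e) u - reindex (inv e) l) \<bullet> b)"
      using leb by (rule emeasure_lborel_box)
    also have "(\<Prod>b\<in>Basis. (reindex (inv e) u - reindex (inv e) l) \<bullet> b) = (\<Prod>k\<in>UNIV. u $ inv e k - l $ inv e k)"
      unfolding prod_Basis_cart by (simp add: reindex_def)
    also have "\<dots> = (\<Prod>i\<in>UNIV. u $ i - l $ i)"
      by (rule prod.reindex_bij_betw[of "inv e" UNIV UNIV "\<lambda>i. u $ i - l $ i"]) (rule bij_imp_bij_inv[OF e])
    also have "\<dots> = (\<Prod>b\<in>Basis. (u - l) \<bullet> b)"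
      unfolding prod_Basis_cart by simp
    finally show "emeasure (distr lborel borel (reindex e)) (box l u) = (\<Prod>b\<in>Basis. (u - l) \<bullet> b)" .
  qed simp
  from lebesgue_measure_preserving[OF m this[symmetric]]
  show "reindex e \<in> lebesgue \<rightarrow>\<^sub>M lebesgue" "distr lebesgue lebesgue (reindex e) = lebesgue" .
qed

text \<open>The matrix of \<open>A\<close> in relabelled coordinates, which has an index type with a well-order.\<close>

definition jac_matrix :: "('e::finite \<Rightarrow> 'd::finite) \<Rightarrow> (real^'d \<Rightarrow> real^'d) \<Rightarrow> real^'e^'e" where
  "jac_matrix e A = (\<chi> i j. A (axis (e j) 1) $ e i)"

definition jac :: "('e::finite \<Rightarrow> 'd::finite) \<Rightarrow> (real^'d \<Rightarrow> real^'d) \<Rightarrow> real" where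
  "jac e A = det (jac_matrix e A)"

lemma jac_matrix_eq:
  assumes "bij e" shows "jac_matrix e A = matrix (\<lambda>v. reindex e (A (reindex (inv e) v)))"
  by (simp add: jac_matrix_def matrix_def reindex_axis[OF assms] vec_eq_iff) (simp add: reindex_def)

lemma set_integral_reindex:
  fixes f :: "real^'e \<Rightarrow> real" and e :: "'e::finite \<Rightarrow> 'd::finite"
  assumes e: "bij e" and f: "set_integrable lebesgue (reindex e ` A) f"
  shows "set_integrable lebesgue A (\<lambda>x. f (reindex e x))"
    and "(LINT x:A|lebesgue. f (reindex e x)) = (LINT v:reindex e ` A|lebesgue. f v)"
proof -
  have inj: "inj (reindex e)" using reindex_inverse(2)[OF e] by (metis injI)
  have eq: "indicator (reindex e ` A) (reindex e x) *\<^sub>R f (reindex e x) = indicator A x *\<^sub>R f (reindex e x)" for x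
    using inj by (simp add: indicator_def inj_image_mem_iff)
  note T = lebesgue_preserving_integral[OF reindex_measure_preserving[OF e] f[unfolded set_integrable_def], unfolded eq]
  show "set_integrable lebesgue A (\<lambda>x. f (reindex e x))"
    using T(1) unfolding set_integrable_def .
  show "(LINT x:A|lebesgue. f (reindex e x)) = (LINT v:reindex e ` A|lebesgue. f v)"
    using T(2) unfolding set_lebesgue_integral_def .
qed

lemma set_integral_change_of_variables_wellorder:
  fixes f :: "real^'m::{finite,wellorder} \<Rightarrow> real" and g :: "real^'m::_ \<Rightarrow> real^'m::_"
  assumes S: "S \<in> sets lebesgue"
    and der: "\<And>x. x \<in> S \<Longrightarrow> (g has_derivative g' x) (at x within S)" and inj: "inj_on g S"
    and f: "set_integrable lebesgue (g ` S) f"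
  shows "set_integrable lebesgue S (\<lambda>x. \<bar>det (matrix (g' x))\<bar> * f (g x))"
    and "(LINT x:S|lebesgue. \<bar>det (matrix (g' x))\<bar> * f (g x)) = (LINT x:g ` S|lebesgue. f x)"
proof -
  let ?F = "\<lambda>x. vec (f x) :: real^1"
  have lin: "bounded_linear (\<lambda>r. vec r :: real^1)" "bounded_linear (\<lambda>v :: real^1. v $ 1)"
    by (auto simp: linear_conv_bounded_linear[symmetric] vec_eq_iff intro!: linearI)
  have sc: "indicator A x *\<^sub>R (vec r :: real^1) = vec (indicator A x *\<^sub>R r)" for A x and r :: real
    by (simp add: vec_eq_iff)
  have F: "set_integrable lebesgue (g ` S) ?F"
    using integrable_bounded_linear[OF lin(1) f[unfolded set_integrable_def]]
    unfolding set_integrable_def sc .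
  then have *: "set_integrable lebesgue S (\<lambda>x. \<bar>det (matrix (g' x))\<bar> *\<^sub>R ?F (g x))"
    and int: "integral S (\<lambda>x. \<bar>det (matrix (g' x))\<bar> *\<^sub>R ?F (g x)) = integral (g ` S) ?F"
    using has_absolute_integral_change_of_variables[OF S der inj, of ?F "integral (g ` S) ?F"] by auto
  have **: "integrable lebesgue (\<lambda>x. (indicator S x *\<^sub>R \<bar>det (matrix (g' x))\<bar> *\<^sub>R ?F (g x)) $ 1)"
    by (rule integrable_bounded_linear[OF lin(2) *[unfolded set_integrable_def]])
  then show "set_integrable lebesgue S (\<lambda>x. \<bar>det (matrix (g' x))\<bar> * f (g x))"
    unfolding set_integrable_def by (simp add: mult.assoc)
  have "(LINT x:S|lebesgue. \<bar>det (matrix (g' x))\<bar> *\<^sub>R ?F (g x)) = (LINT x:g ` S|lebesgue. ?F x)"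
    using set_lebesgue_integral_eq_integral(2)[OF *] set_lebesgue_integral_eq_integral(2)[OF F] int by simp
  then have "(LINT x:S|lebesgue. \<bar>det (matrix (g' x))\<bar> *\<^sub>R ?F (g x)) $ 1 = (LINT x:g ` S|lebesgue. ?F x) $ 1" by simp
  then show "(LINT x:S|lebesgue. \<bar>det (matrix (g' x))\<bar> * f (g x)) = (LINT x:g ` S|lebesgue. f x)"
    unfolding set_lebesgue_integral_def
    using integral_bounded_linear[OF lin(2) *[unfolded set_integrable_def]] integral_bounded_linear[OF lin(2) F[unfolded set_integrable_def]]
    by (simp add: mult.assoc)
qed

text \<open>Conjugation with the relabelling of coordinates reduces this to a well-ordered index type.\<close>

theorem set_integral_change_of_variables:
  fixes f :: "real^'d::finite \<Rightarrow> real" and e :: "'e::{finite,wellorder} \<Rightarrow> 'd"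
  assumes e: "bij e" and S: "S \<in> sets lebesgue"
    and der: "\<And>x. x \<in> S \<Longrightarrow> (g has_derivative g' x) (at x within S)" and inj: "inj_on g S"
    and f: "set_integrable lebesgue (g ` S) f"
  shows "set_integrable lebesgue S (\<lambda>x. \<bar>jac e (g' x)\<bar> * f (g x))"
    and "(LINT x:S|lebesgue. \<bar>jac e (g' x)\<bar> * f (g x)) = (LINT x:g ` S|lebesgue. f x)"
proof -
  let ?J = "reindex e" and ?I = "reindex (inv e)"
  have e': "bij (inv e)" by (rule bij_imp_bij_inv[OF e])
  note JI [simp] = reindex_inverse[OF e]
  have IJ: "reindex (inv (inv e)) = ?J" using e by (simp add: inv_inv_eq)
  define S' where "S' = ?J ` S"
  define G where "G v = ?J (g (?I v))" for v
  define G' where "G' v h = ?J (g' (?I v) (?I h))" for v h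
  have IS: "?I ` S' = S" unfolding S'_def image_image by simp
  have GS: "G ` S' = ?J ` g ` S" unfolding G_def S'_def image_image by simp
  have S'm: "S' \<in> sets lebesgue"
  proof -
    have "S' = ?I -` S \<inter> space lebesgue" unfolding S'_def by (auto simp: image_iff) (metis JI(1))
    then show ?thesis using measurable_sets[OF reindex_measure_preserving(1)[OF e'] S] by simp
  qed
  have der': "(G has_derivative G' v) (at v within S')" if v: "v \<in> S'" for v
  proof -
    have "?I v \<in> S" using v IS by blast
    have "((\<lambda>v. g (?I v)) has_derivative (\<lambda>h. g' (?I v) (?I h))) (at v within S')"
      by (rule has_derivative_in_compose[OF bounded_linear_imp_has_derivative[OF reindex_linear]])
         (use der[OF \<open>?I v \<in> S\<close>] IS in simp)
    from bounded_linear.has_derivative[OF reindex_linear this] show ?thesis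
      unfolding G_def[abs_def] G'_def[abs_def] .
  qed
  have inj': "inj_on G S'"
  proof (rule inj_onI)
    fix v w assume vw: "v \<in> S'" "w \<in> S'" "G v = G w"
    then have "g (?I v) = g (?I w)" unfolding G_def by (metis JI(2))
    then have "?I v = ?I w" using inj vw IS by (meson imageI inj_onD)
    then show "v = w" by (metis JI(1))
  qed
  have f': "set_integrable lebesgue (G ` S') (\<lambda>v. f (?I v))"
  proof (rule set_integral_reindex(1)[OF e'])
    have "?I ` G ` S' = g ` S" unfolding GS image_image by simp
    then show "set_integrable lebesgue (?I ` G ` S') f" using f by simp
  qed
  have jac: "det (matrix (G' (?J x))) = jac e (g' x)" for x
    unfolding jac_def jac_matrix_eq[OF e] G'_def[abs_def] by simp
  have fG: "f (?I (G v)) = f (g (?I v))" for v by (simp add: G_def)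
  note C = set_integral_change_of_variables_wellorder[OF S'm der' inj' f', unfolded fG]
  note R = set_integral_reindex[OF e C(1)[unfolded S'_def], unfolded jac JI]
  show "set_integrable lebesgue S (\<lambda>x. \<bar>jac e (g' x)\<bar> * f (g x))" by (rule R(1))
  have "(LINT x:S|lebesgue. \<bar>jac e (g' x)\<bar> * f (g x)) = (LINT v:G ` S'|lebesgue. f (?I v))"
    using R(2) C(2) unfolding S'_def by simp
  also have "\<dots> = (LINT v:?J ` g ` S|lebesgue. f (?I v))" by (simp only: GS)
  also have "\<dots> = (LINT x:g ` S|lebesgue. f x)"
    using set_integral_reindex(2)[OF e f'[unfolded GS]] by simp
  finally show "(LINT x:S|lebesgue. \<bar>jac e (g' x)\<bar> * f (g x)) = (LINT x:g ` S|lebesgue. f x)" .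
qed

section \<open>Jacobian determinants along a line of linear maps\<close>

lemma jac_matrix_compose:
  assumes e: "bij e" and A: "linear A" and B: "linear B"
  shows "jac_matrix e (A \<circ> B) = jac_matrix e A ** jac_matrix e B"
proof -
  let ?c = "\<lambda>A v. reindex e (A (reindex (inv e) v))"
  have l: "linear (?c A)" if "linear A" for A
    using linear_compose[OF linear_compose[OF bounded_linear.linear[OF reindex_linear[of "inv e"]] that]
       bounded_linear.linear[OF reindex_linear[of e]]]
    by (simp add: o_def)
  have "?c (A \<circ> B) = ?c A \<circ> ?c B" using reindex_inverse[OF e] by (simp add: fun_eq_iff)
  then show ?thesis
    unfolding jac_matrix_eq[OF e] using matrix_compose[OF l[OF B] l[OF A]] by simp
qed

lemma jac_matrix_id: "bij e \<Longrightarrow> jac_matrix e id = mat 1"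
  by (auto simp: jac_matrix_def mat_def axis_def vec_eq_iff bij_def inj_eq)

lemma jac_compose:
  "bij e \<Longrightarrow> linear A \<Longrightarrow> linear B \<Longrightarrow> jac e (A \<circ> B) = jac e A * jac e B"
  by (simp add: jac_def jac_matrix_compose det_mul)

lemma jac_id: "bij e \<Longrightarrow> jac e id = 1"
  by (simp add: jac_def jac_matrix_id)

text \<open>In the Leibniz expansion a permutation other than the identity moves at least two indices, so its
term vanishes at 0 to second order.\<close>

lemma det_identity_perturbation_derivative:
  fixes C :: "real^'n^'n"
  shows "((\<lambda>h. det (mat 1 + h *\<^sub>R C)) has_real_derivative trace C) (at 0)"
proof -
  define a where "a p i h = (mat 1 + h *\<^sub>R C) $ i $ p i" for p :: "'n \<Rightarrow> 'n" and i h
  have a: "a p i h = (if i = p i then 1 else 0) + h * C $ i $ p i" for p i h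
    by (simp add: a_def mat_def)
  have d: "((\<lambda>h. \<Prod>i\<in>UNIV. a p i h) has_derivative (\<lambda>y. y * (if p = id then trace C else 0))) (at 0)"
    if p: "p permutes UNIV" for p
  proof -
    have "((\<lambda>h. a p i h) has_derivative (\<lambda>y. y * C $ i $ p i)) (at 0)" for i
      unfolding a by (auto intro!: derivative_eq_intros)
    then have "((\<lambda>h. \<Prod>i\<in>UNIV. a p i h) has_derivative (\<lambda>y. \<Sum>i\<in>UNIV. y * C $ i $ p i * (\<Prod>j\<in>UNIV - {i}. a p j 0))) (at 0)"
      by (rule has_derivative_prod)
    moreover have "(\<Sum>i\<in>UNIV. y * C $ i $ p i * (\<Prod>j\<in>UNIV - {i}. a p j 0)) = y * (if p = id then trace C else 0)" for y
    proof (cases "p = id")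
      case True
      then show ?thesis by (simp add: a trace_def sum_distrib_left)
    next
      case False
      have "(\<Prod>j\<in>UNIV - {i}. a p j 0) = 0" for i
      proof -
        obtain k where k: "p k \<noteq> k" using False by (auto simp: fun_eq_iff)
        have "inj p" using p permutes_inj by blast
        then have "p (p k) \<noteq> p k" using k by (metis injD)
        then obtain j where j: "j \<noteq> i" "p j \<noteq> j" using k by (cases "k = i") auto
        then have "a p j 0 = 0" by (simp add: a)
        then show ?thesis using j by (intro prod_zero) auto
      qed
      then show ?thesis by (simp only: False if_False mult_zero_right sum.neutral_const)
    qed
    ultimately show ?thesis by simp
  qed
  have "((\<lambda>h. \<Sum>p | p permutes (UNIV::'n set). of_int (sign p) * (\<Prod>i\<in>UNIV. a p i h)) has_derivative
     (\<lambda>y. \<Sum>p | p permutes (UNIV::'n set). of_int (sign p) * (y * (if p = id then trace C else 0)))) (at 0)"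
    by (intro has_derivative_sum has_derivative_mult_right d) simp
  moreover have "(\<Sum>p | p permutes (UNIV::'n set). of_int (sign p) * (y * (if p = id then trace C else 0))) = y * trace C" for y
  proof -
    have "(\<Sum>p | p permutes (UNIV::'n set). of_int (sign p) * (y * (if p = id then trace C else 0)))
      = (\<Sum>p\<in>{id :: 'n \<Rightarrow> 'n}. of_int (sign p) * (y * (if p = id then trace C else 0)))"
      by (rule sum.mono_neutral_right) (auto simp: permutes_id finite_permutations)
    then show ?thesis by (simp add: sign_id)
  qed
  ultimately have "((\<lambda>h. det (mat 1 + h *\<^sub>R C)) has_derivative (\<lambda>y. y * trace C)) (at 0)"
    by (simp add: det_def a_def)
  then show ?thesis unfolding has_field_derivative_def by (rule has_derivative_eq_rhs) (auto simp: fun_eq_iff)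
qed

lemma jac_poly:
  fixes e :: "'e::finite \<Rightarrow> 'd::finite"
  assumes "bij e"
  obtains p :: "real poly" where "degree p \<le> CARD('d)" "\<And>s. jac e (\<lambda>h. A h + s *\<^sub>R Q h) = poly p s"
proof
  define P where "P \<pi> = (\<Prod>i\<in>UNIV. [:A (axis (e (\<pi> i)) 1) $ e i, Q (axis (e (\<pi> i)) 1) $ e i:])" for \<pi> :: "'e \<Rightarrow> 'e"
  define p where "p = (\<Sum>\<pi> | \<pi> permutes (UNIV::'e set). smult (of_int (sign \<pi>)) (P \<pi>))"
  have "degree (P \<pi>) \<le> CARD('e)" for \<pi>
  proof -
    have "degree (P \<pi>) \<le> (\<Sum>i\<in>(UNIV::'e set). degree [:A (axis (e (\<pi> i)) 1) $ e i, Q (axis (e (\<pi> i)) 1) $ e i:])"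
      unfolding P_def using degree_prod_sum_le[of "UNIV::'e set" "\<lambda>i. [:A (axis (e (\<pi> i)) 1) $ e i, Q (axis (e (\<pi> i)) 1) $ e i:]"]
      by (simp add: o_def)
    also have "\<dots> \<le> (\<Sum>i\<in>(UNIV::'e set). 1)" by (rule sum_mono) simp
    finally show ?thesis by simp
  qed
  moreover have "CARD('e) = CARD('d)" using assms bij_betw_same_card by blast
  ultimately have "degree (P \<pi>) \<le> CARD('d)" for \<pi> by metis
  then show "degree p \<le> CARD('d)"
    unfolding p_def by (intro degree_sum_le) (auto simp: finite_permutations intro: order_trans[OF degree_smult_le])
  show "jac e (\<lambda>h. A h + s *\<^sub>R Q h) = poly p s" for s
    unfolding p_def jac_def det_def jac_matrix_def P_def by (simp add: poly_sum poly_prod)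
qed

text \<open>Jacobi's formula. With \<open>As\<close> the map at parameter \<open>s\<close> and \<open>B\<close> its inverse, the map at parameter \<open>t\<close> is
\<open>(id + (t - s) Q B) As\<close>, so that the determinant is differentiated at the identity.\<close>

lemma jac_derivative:
  assumes e: "bij e" and lin: "linear A" "linear Q" "linear B" and B: "(\<lambda>h. A h + s *\<^sub>R Q h) \<circ> B = id" "B \<circ> (\<lambda>h. A h + s *\<^sub>R Q h) = id"
    and p: "\<And>s. jac e (\<lambda>h. A h + s *\<^sub>R Q h) = poly p s"
  shows "poly (pderiv p) s = jac e (\<lambda>h. A h + s *\<^sub>R Q h) * (\<Sum>k\<in>UNIV. Q (B (axis k 1)) $ k)" "jac e (\<lambda>h. A h + s *\<^sub>R Q h) \<noteq> 0"
proof -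
  define As where "As h = A h + s *\<^sub>R Q h" for h
  define C where "C = jac_matrix e (Q \<circ> B)"
  have linAs: "linear As" unfolding As_def using lin by (intro linear_compose_add linear_compose_scale_right)
  have BAs: "As \<circ> B = id" "B \<circ> As = id" using B by (simp_all add: As_def[abs_def])
  have "jac e (\<lambda>h. A h + t *\<^sub>R Q h) = det (mat 1 + (t - s) *\<^sub>R C) * jac e As" for t
  proof -
    have lin': "linear (\<lambda>h. h + (t - s) *\<^sub>R Q (B h))"
      using linear_compose[OF lin(3,2)] by (intro linear_compose_add linear_compose_scale_right linear_id) (simp_all add: o_def linear_id[unfolded id_def])
    have "(\<lambda>h. A h + t *\<^sub>R Q h) = (\<lambda>h. h + (t - s) *\<^sub>R Q (B h)) \<circ> As"
    proof
      fix h
      have "B (As h) = h" using BAs(2) by (metis comp_apply id_apply)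
      then show "A h + t *\<^sub>R Q h = ((\<lambda>h. h + (t - s) *\<^sub>R Q (B h)) \<circ> As) h"
        by (simp add: As_def algebra_simps)
    qed
    then have "jac e (\<lambda>h. A h + t *\<^sub>R Q h) = jac e (\<lambda>h. h + (t - s) *\<^sub>R Q (B h)) * jac e As"
      using jac_compose[OF e lin' linAs] by simp
    moreover have "jac_matrix e (\<lambda>h. h + (t - s) *\<^sub>R Q (B h)) = mat 1 + (t - s) *\<^sub>R C"
      using jac_matrix_id[OF e] unfolding C_def by (simp add: jac_matrix_def vec_eq_iff)
    ultimately show ?thesis by (simp add: jac_def)
  qed
  then have "poly p = (\<lambda>t. det (mat 1 + (t - s) *\<^sub>R C) * jac e As)" using p by auto
  moreover have "((\<lambda>t. det (mat 1 + (t - s) *\<^sub>R C)) has_real_derivative trace C * 1) (at s)"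
    by (rule DERIV_chain2[where g="\<lambda>t. t - s"]) (auto intro!: derivative_eq_intros det_identity_perturbation_derivative)
  ultimately have "(poly p has_real_derivative trace C * 1 * jac e As) (at s)"
    by (auto intro: DERIV_cmult_right)
  then have "poly (pderiv p) s = trace C * jac e As"
    using DERIV_unique[OF poly_DERIV] by simp
  moreover have "trace C = (\<Sum>k\<in>UNIV. Q (B (axis k 1)) $ k)"
    unfolding trace_def C_def jac_matrix_def
    using sum.reindex_bij_betw[of e UNIV UNIV "\<lambda>k. Q (B (axis k 1)) $ k"] e by simp
  ultimately show "poly (pderiv p) s = jac e (\<lambda>h. A h + s *\<^sub>R Q h) * (\<Sum>k\<in>UNIV. Q (B (axis k 1)) $ k)"
    by (simp add: As_def[abs_def] mult.commute)
  have "jac e As * jac e B = 1" using jac_compose[OF e linAs lin(3)] BAs(1) jac_id[OF e] by simp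
  then show "jac e (\<lambda>h. A h + s *\<^sub>R Q h) \<noteq> 0" unfolding As_def[abs_def] by auto
qed

section \<open>Integration over reference cells\<close>

lemma periodic_has_derivative_iff:
  fixes v :: "'a::real_normed_vector \<Rightarrow> 'b::real_normed_vector"
  assumes per: "\<And>x. v (p + x) = v x"
  shows "(v has_derivative D) (at (p + x)) \<longleftrightarrow> (v has_derivative D) (at x)"
proof
  assume v: "(v has_derivative D) (at (p + x))"
  have s: "((\<lambda>x. p + x) has_derivative (\<lambda>h. h)) (at x)" by (auto intro!: derivative_eq_intros)
  have "((\<lambda>x. v (p + x)) has_derivative (\<lambda>h. D h)) (at x)"
    by (rule has_derivative_compose[OF s v])
  then show "(v has_derivative D) (at x)" by (simp add: per)
next
  assume v: "(v has_derivative D) (at x)"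
  have s: "((\<lambda>x. x - p) has_derivative (\<lambda>h. h)) (at (p + x))" by (auto intro!: derivative_eq_intros)
  have "((\<lambda>x. v (x - p)) has_derivative (\<lambda>h. D h)) (at (p + x))"
    by (rule has_derivative_compose[OF s]) (simp add: v)
  moreover have "v (z - p) = v z" for z using per[of "z - p"] by simp
  ultimately show "(v has_derivative D) (at (p + x))" by simp
qed

lemma dvg_periodic: "(\<And>x. v (p + x) = v x) \<Longrightarrow> dvg v (p + x) = dvg v x"
  unfolding dvg_def frechet_derivative_def by (simp only: periodic_has_derivative_iff)

context mesh begin

definition shape_cells :: "nat \<Rightarrow> nat set" where
  "shape_cells i = {K \<in> cells M. i \<in> cell_dofs K}"

lemma shape_cells_finite: "finite (shape_cells i)"
  using adm unfolding shape_cells_def cell_dofs_def by (simp add: admissible_discretization_def)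

lemma velocity_periodic:
  assumes p: "p \<in> pers M" shows "velocity M a W (p + x) = velocity M a W x"
  unfolding velocity_def by (intro sum.cong Collect_cong) (use psi_periodic[OF _ p] in auto)

text \<open>The cells chosen as representatives modulo the lattice form a fundamental domain. This is the bridge
between integrals over \<open>Omega M\<close> and sums over cells.\<close>

lemma cells_fund_domain: "fund_domain (pers M) (\<Union>K\<in>cells M. X K)"
  unfolding fund_domain_def
proof (intro conjI ballI impI)
  show "(\<Union>K\<in>cells M. X K) \<in> sets lebesgue"
    using borel_closed[OF compact_imp_closed[OF X_compact]] by (intro sets.countable_UN') auto
  have "x \<in> (\<Union>p\<in>pers M. (+) p ` (\<Union>K\<in>cells M. X K))" for x
  proof -
    obtain K p y where "K \<in> cells M" "p \<in> pers M" "y \<in> E K" "x = p + T K y"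
      by (rule cell_cover)
    then show ?thesis by blast
  qed
  then show "(\<Union>p\<in>pers M. (+) p ` (\<Union>K\<in>cells M. X K)) = UNIV" by blast
  fix p assume p: "p \<in> pers M" "p \<noteq> 0"
  have "negligible (\<Union>K\<in>cells M. \<Union>K'\<in>cells M. X K \<inter> (+) p ` X K')"
  proof (intro negligible_countable_Union countable_image)
    fix S assume "S \<in> (\<lambda>K. \<Union>K'\<in>cells M. X K \<inter> (+) p ` X K') ` cells M"
    then obtain K where K: "K \<in> cells M" "S = (\<Union>K'\<in>cells M. X K \<inter> (+) p ` X K')" by blast
    show "negligible S"
      unfolding K(2) using cells_overlap_negligible[OF K(1) _ p(1)] p(2)
      by (intro negligible_countable_Union countable_image) auto
  qed auto
  then show "negligible ((\<Union>K\<in>cells M. X K) \<inter> (+) p ` (\<Union>K\<in>cells M. X K))"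
    by (rule negligible_subset) blast
qed

text \<open>A periodic mesh has finitely many cells and hence a bounded union; for the Cauchy problem there is
only one period.\<close>

lemma finite_Omega_cells: "finite {p \<in> pers M. (+) p ` Omega M \<inter> (\<Union>K\<in>cells M. X K) \<noteq> {}}"
proof (cases "bdry M = Cauchy")
  case False
  then have "finite (cells M)"
    using adm by (cases "bdry M") (auto simp: admissible_discretization_def)
  then have "bounded (\<Union>K\<in>cells M. X K)"
    using X_compact compact_imp_bounded by (intro bounded_UN) auto
  then show ?thesis by (rule Omega_translates_finite(1))
qed simp

lemma integral_over_cells:
  fixes f :: "real^'d \<Rightarrow> real"
  assumes per: "\<And>p x. p \<in> pers M \<Longrightarrow> f (p + x) = f x" and int: "set_integrable lebesgue (Omega M) f"
    and C: "finite C" "C \<subseteq> cells M" and zero: "\<And>K x. K \<in> cells M - C \<Longrightarrow> x \<in> X K \<Longrightarrow> f x = 0"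
  shows "K \<in> C \<Longrightarrow> set_integrable lebesgue (X K) f"
    and "(LINT x:Omega M|lebesgue. f x) = (\<Sum>K\<in>C. LINT x:X K|lebesgue. f x)"
proof -
  let ?D = "\<Union>K\<in>cells M. X K"
  note F = fund_domain_integral[where f=f, OF pers_group Omega_fund_domain cells_fund_domain finite_Omega_cells per int]
  have Xm: "X K \<in> sets lebesgue" if "K \<in> cells M" for K
    using borel_closed[OF compact_imp_closed[OF X_compact[OF that]]] by simp
  have I: "set_integrable lebesgue (X K) f" if "K \<in> C" for K
    by (rule set_integrable_subset[OF F(1)]) (use that C Xm in auto)
  then show "K \<in> C \<Longrightarrow> set_integrable lebesgue (X K) f" .
  have eq: "indicator ?D x *\<^sub>R f x = indicator (\<Union>K\<in>C. X K) x *\<^sub>R f x" for x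
  proof (cases "x \<in> (\<Union>K\<in>C. X K)")
    case True
    then have "x \<in> ?D" using C by blast
    then show ?thesis using True by (simp only: indicator_simps)
  next
    case False
    then have "x \<in> ?D \<Longrightarrow> f x = 0" using zero by blast
    then show ?thesis using False by (cases "x \<in> ?D") (simp_all add: indicator_def del: UN_iff)
  qed
  have "(LINT x:Omega M|lebesgue. f x) = (LINT x:?D|lebesgue. f x)" by (rule F(2)[symmetric])
  also have "\<dots> = (LINT x:(\<Union>K\<in>C. X K)|lebesgue. f x)" unfolding set_lebesgue_integral_def eq ..
  also have "\<dots> = (\<Sum>K\<in>C. LINT x:X K|lebesgue. f x)"
  proof (rule set_integral_finite_AE_disjoint(2)[OF C(1)])
    show "X K \<in> sets lebesgue" if "K \<in> C" for K using that C Xm by blast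
    show "negligible (X K \<inter> X K')" if "K \<in> C" "K' \<in> C" "K \<noteq> K'" for K K'
      using cells_overlap_negligible[of K K' 0] that C zero_pers by auto
  qed (rule I)
  finally show "(LINT x:Omega M|lebesgue. f x) = (\<Sum>K\<in>C. LINT x:X K|lebesgue. f x)" .
qed

definition DT :: "nat \<Rightarrow> real^'d \<Rightarrow> real^'d \<Rightarrow> real^'d" where
  "DT K y = frechet_derivative (T K) (at y)"

lemma integral_on_reference_cells:
  fixes e :: "'e::{finite,wellorder} \<Rightarrow> 'd"
  assumes e: "bij e" and i: "i \<in> dofs M" and per: "\<And>p x. p \<in> pers M \<Longrightarrow> h (p + x) = h x"
    and int: "set_integrable lebesgue (Omega M) (\<lambda>x. psi M a i x * h x)"
  shows "K \<in> shape_cells i \<Longrightarrow> set_integrable lebesgue (interior (E K)) (\<lambda>y. \<bar>jac e (DT K y)\<bar> * (local_shape M i K y * h (T K y)))"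
    and "(LINT x:Omega M|lebesgue. psi M a i x * h x) =
      (\<Sum>K\<in>shape_cells i. LINT y:interior (E K)|lebesgue. \<bar>jac e (DT K y)\<bar> * (local_shape M i K y * h (T K y)))"
proof -
  let ?f = "\<lambda>x. psi M a i x * h x"
  have psi0: "psi M a i (T K y) = local_shape M i K y" if "K \<in> cells M" "y \<in> E K" for K y
    using psi_cell[OF i that(1) zero_pers that(2)] by simp
  have zero: "?f x = 0" if K: "K \<in> cells M - shape_cells i" "x \<in> X K" for K x
    using K psi0 local_shape_zero[of i K] by (auto simp: shape_cells_def)
  have per': "?f (p + x) = ?f x" if "p \<in> pers M" for p x
    using per[OF that] psi_periodic[OF i that] by simp
  have sub: "shape_cells i \<subseteq> cells M" by (auto simp: shape_cells_def)
  note C = integral_over_cells[of ?f "shape_cells i", OF per' int shape_cells_finite sub zero]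
  have cell: "set_integrable lebesgue (interior (E K)) (\<lambda>y. \<bar>jac e (DT K y)\<bar> * (local_shape M i K y * h (T K y))) \<and>
     (LINT y:interior (E K)|lebesgue. \<bar>jac e (DT K y)\<bar> * (local_shape M i K y * h (T K y))) = (LINT x:X K|lebesgue. ?f x)"
    if Ki: "K \<in> shape_cells i" for K
  proof -
    have K: "K \<in> cells M" using Ki sub by blast
    let ?S = "interior (E K)"
    have TS: "T K ` ?S \<in> sets lebesgue" using T_open[OF K] borel_open by auto
    have S: "?S \<in> sets lebesgue" using borel_open by auto
    have der: "(T K has_derivative DT K y) (at y within ?S)" if "y \<in> ?S" for y
      unfolding DT_def using T_derivative[OF K interior_elt[OF that]] by (rule has_derivative_at_withinI)
    have inj: "inj_on (T K) ?S" using T_inj[OF K] interior_subset inj_on_subset by blast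
    have fi: "set_integrable lebesgue (T K ` ?S) ?f"
      by (rule set_integrable_subset[OF C(1)[OF _ _ _ Ki] TS]) (use interior_subset[of "E K"] in auto)
    note V = set_integral_change_of_variables[OF e S der inj fi]
    have eq: "\<And>y. indicator ?S y *\<^sub>R (\<bar>jac e (DT K y)\<bar> * (psi M a i (T K y) * h (T K y)))
        = indicator ?S y *\<^sub>R (\<bar>jac e (DT K y)\<bar> * (local_shape M i K y * h (T K y)))"
      using psi0[OF K interior_elt] by (auto simp: indicator_def)
    have "(LINT x:X K|lebesgue. ?f x) = (LINT x:T K ` ?S|lebesgue. ?f x)"
      unfolding set_lebesgue_integral_def
    proof (rule integral_cong_AE)
      have neg: "negligible (T K ` frontier (E K))"
        by (rule T_negligible[OF K frontier_subset_closed[OF cell_elt_facts(3)[OF K]] negligible_convex_frontier[OF cell_elt_facts(2)[OF K]]])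
      then have "AE x in lebesgue. x \<notin> T K ` frontier (E K)"
        by (intro AE_not_in) (simp only: negligible_iff_null_sets)
      then show "AE x in lebesgue. indicator (X K) x *\<^sub>R ?f x = indicator (T K ` ?S) x *\<^sub>R ?f x"
      proof eventually_elim
        case (elim x)
        have "x \<in> X K \<longleftrightarrow> x \<in> T K ` ?S"
          using elim interior_subset[of "E K"] closure_subset[of "E K"] unfolding frontier_def by blast
        then show ?case by (simp add: indicator_def)
      qed
    qed (use fi C(1)[OF _ _ _ Ki] in \<open>auto simp: set_integrable_def intro: borel_measurable_integrable\<close>)
    then show ?thesis
      using V unfolding set_integrable_def set_lebesgue_integral_def eq by simp
  qed
  show "K \<in> shape_cells i \<Longrightarrow> set_integrable lebesgue (interior (E K)) (\<lambda>y. \<bar>jac e (DT K y)\<bar> * (local_shape M i K y * h (T K y)))"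
    using cell by blast
  show "(LINT x:Omega M|lebesgue. psi M a i x * h x) =
      (\<Sum>K\<in>shape_cells i. LINT y:interior (E K)|lebesgue. \<bar>jac e (DT K y)\<bar> * (local_shape M i K y * h (T K y)))"
    using C(2) cell by simp
qed

end

section \<open>The geometric conservation law\<close>

text \<open>A polynomial without zero on \<open>{0..\<tau>}\<close> keeps its sign there, so the difference of absolute values is, up
to this sign, the integral of the derivative, which has degree at most \<open>n - 1\<close>. Here \<open>D l\<close> stands for
the logarithmic derivative at a node.\<close>

lemma quadrature_abs_poly:
  fixes p :: "real poly"
  assumes q: "quadrature L \<omega> \<zeta> (n - 1)" and deg: "degree p \<le> n" and n: "0 < n" and \<tau>: "0 < \<tau>"
    and nz: "\<And>s. s \<in> {0..\<tau>} \<Longrightarrow> poly p s \<noteq> 0"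
    and D: "\<And>l. l \<in> L \<Longrightarrow> poly (pderiv p) (\<tau> * \<zeta> l) = poly p (\<tau> * \<zeta> l) * D l"
  shows "\<bar>poly p \<tau>\<bar> - \<bar>poly p 0\<bar> = \<tau> * (\<Sum>l\<in>L. \<omega> l * (\<bar>poly p (\<tau> * \<zeta> l)\<bar> * D l))"
proof -
  have same_sign: "\<bar>poly p s\<bar> = sgn (poly p 0) * poly p s" if s: "s \<in> {0..\<tau>}" for s
  proof -
    have "0 < poly p 0 * poly p s"
    proof (rule ccontr)
      assume "\<not> 0 < poly p 0 * poly p s"
      then have "(poly p 0 \<le> 0 \<and> 0 \<le> poly p s) \<or> (0 \<le> poly p 0 \<and> poly p s \<le> 0)"
        using mult_pos_pos[of "poly p 0" "poly p s"] mult_neg_neg[of "poly p 0" "poly p s"] by linarith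
      moreover have "continuous_on {0..s} (poly p)"
        by (intro continuous_at_imp_continuous_on ballI poly_isCont)
      ultimately have "\<exists>x\<ge>0. x \<le> s \<and> poly p x = 0"
        using s IVT'[of "poly p" 0 0 s] IVT2'[of "poly p" s 0 0] by auto
      then show False using nz s by force
    qed
    then show ?thesis by (auto simp: zero_less_mult_iff abs_if sgn_if)
  qed
  \<comment> \<open>The quadrature lives on the unit interval.\<close>
  define r where "r = pcompose (pderiv p) [:0, \<tau>:]"
  have r: "poly r s = poly (pderiv p) (\<tau> * s)" for s by (simp add: r_def poly_pcompose mult.commute)
  have "degree r \<le> n - 1"
  proof -
    have "degree r \<le> degree (pderiv p) * degree [:0, \<tau>:]" unfolding r_def by (rule degree_pcompose_le)
    also have "\<dots> \<le> degree (pderiv p) * 1" by (rule mult_left_mono) auto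
    also have "\<dots> \<le> n - 1" using deg by (simp add: degree_pderiv)
    finally show ?thesis .
  qed
  then have "(\<Sum>l\<in>L. \<omega> l * poly r (\<zeta> l)) = (LINT s:{0..1}|lborel. poly r s)"
    using q unfolding quadrature_def by blast
  also have "\<dots> = (LINT s|lborel. indicator {0..1} s *\<^sub>R poly r s)" by (simp add: set_lebesgue_integral_def)
  also have "\<dots> = poly p (\<tau> * 1) / \<tau> - poly p (\<tau> * 0) / \<tau>"
  proof (rule integral_FTC_atLeastAtMost)
    fix s :: real
    have "((\<lambda>s. poly p (\<tau> * s)) has_real_derivative poly (pderiv p) (\<tau> * s) * \<tau>) (at s within {0..1})"
      by (rule DERIV_chain'[OF _ poly_DERIV]) (auto intro!: derivative_eq_intros)
    then have "((\<lambda>s. poly p (\<tau> * s) / \<tau>) has_real_derivative poly (pderiv p) (\<tau> * s) * \<tau> / \<tau>) (at s within {0..1})"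
      by (rule DERIV_cdivide)
    then show "((\<lambda>s. poly p (\<tau> * s) / \<tau>) has_vector_derivative poly r s) (at s within {0..1})"
      using \<tau> by (simp add: has_real_derivative_iff_has_vector_derivative r)
  qed (auto intro!: continuous_intros)
  finally have sum: "\<tau> * (\<Sum>l\<in>L. \<omega> l * poly (pderiv p) (\<tau> * \<zeta> l)) = poly p \<tau> - poly p 0"
    using \<tau> by (simp add: r field_simps)
  have "\<bar>poly p \<tau>\<bar> - \<bar>poly p 0\<bar> = sgn (poly p 0) * (poly p \<tau> - poly p 0)"
    using same_sign[of \<tau>] same_sign[of 0] \<tau> by (simp add: algebra_simps)
  also have "\<dots> = \<tau> * (\<Sum>l\<in>L. \<omega> l * (sgn (poly p 0) * poly (pderiv p) (\<tau> * \<zeta> l)))"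
    unfolding sum[symmetric] by (simp add: sum_distrib_left ac_simps)
  also have "\<dots> = \<tau> * (\<Sum>l\<in>L. \<omega> l * (\<bar>poly p (\<tau> * \<zeta> l)\<bar> * D l))"
  proof -
    have "\<tau> * \<zeta> l \<in> {0..\<tau>}" if "l \<in> L" for l
      using q that \<tau> mult_left_mono[of "\<zeta> l" 1 \<tau>] unfolding quadrature_def by auto
    then show ?thesis using same_sign D by (intro arg_cong[where f="\<lambda>x. \<tau> * x"] sum.cong) auto
  qed
  finally show ?thesis .
qed

definition cell_velocity :: "'d::finite discretization \<Rightarrow> (nat \<Rightarrow> real^'d) \<Rightarrow> nat \<Rightarrow> real^'d \<Rightarrow> real^'d" where
  "cell_velocity M V K y = (\<Sum>i=1..ngeo M (ref M K). geo_shape M (ref M K) i y *\<^sub>R V (geo_con M i K))"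

lemma geo_map_move: "geo_map M (move a V s) K y = geo_map M a K y + s *\<^sub>R cell_velocity M V K y"
  unfolding geo_map_def cell_velocity_def move_def scaleR_sum_right sum.distrib[symmetric]
  by (intro sum.cong refl) (simp add: algebra_simps)

context mesh begin

lemma geo_velocity_cell:
  assumes cont: "\<And>g. g \<in> geo_dofs M \<Longrightarrow> continuous_across_cells M a (local_geo_shape M g)"
    and K: "K \<in> cells M" "y \<in> E K"
  shows "geo_velocity M a V (T K y) = cell_velocity M V K y"
proof -
  let ?N = "{1..ngeo M (ref M K)}"
  let ?C = "(\<lambda>i. geo_con M i K) ` ?N"
  have inj: "inj_on (\<lambda>i. geo_con M i K) ?N"
    using adm K by (auto simp: admissible_discretization_def)
  have sub: "?C \<subseteq> geo_dofs M" using K unfolding geo_dofs_def by blast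
  have val: "psi_geo M a g (T K y) = local_geo_shape M g K y" if "g \<in> geo_dofs M" for g
    using glue_eq[OF cont[OF that] K(1) zero_pers K(2)] by (simp add: psi_geo_def)
  have loc: "local_geo_shape M (geo_con M i K) K y = geo_shape M (ref M K) i y" if "i \<in> ?N" for i
  proof -
    have "{i' \<in> ?N. geo_con M i' K = geo_con M i K} = {i}"
      using inj that by (auto dest: inj_onD)
    then show ?thesis by (simp only: local_geo_shape_def) simp
  qed
  have zero: "local_geo_shape M g K y = 0" if "g \<notin> ?C" for g
    unfolding local_geo_shape_def by (rule sum.neutral) (use that in blast)
  have "geo_velocity M a V (T K y) = (\<Sum>g\<in>?C. psi_geo M a g (T K y) *\<^sub>R V g)"
    unfolding geo_velocity_def
  proof (rule sum.mono_neutral_left)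
    show "{j \<in> geo_dofs M. psi_geo M a j (T K y) \<noteq> 0} \<subseteq> ?C"
    proof
      fix g assume g: "g \<in> {j \<in> geo_dofs M. psi_geo M a j (T K y) \<noteq> 0}"
      then have "local_geo_shape M g K y \<noteq> 0" using val[of g] by simp
      then show "g \<in> ?C" using zero by blast
    qed
    show "\<forall>g\<in>?C - {j \<in> geo_dofs M. psi_geo M a j (T K y) \<noteq> 0}. psi_geo M a g (T K y) *\<^sub>R V g = 0"
      using sub by auto
  qed simp
  also have "\<dots> = (\<Sum>i\<in>?N. psi_geo M a (geo_con M i K) (T K y) *\<^sub>R V (geo_con M i K))"
    by (subst sum.reindex[OF inj]) simp
  also have "\<dots> = cell_velocity M V K y"
    unfolding cell_velocity_def
  proof (rule sum.cong[OF refl])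
    fix i assume i: "i \<in> ?N"
    then have "geo_con M i K \<in> geo_dofs M" using sub by blast
    then show "psi_geo M a (geo_con M i K) (T K y) *\<^sub>R V (geo_con M i K) = geo_shape M (ref M K) i y *\<^sub>R V (geo_con M i K)"
      using val loc[OF i] by simp
  qed
  finally show ?thesis .
qed

lemma cell_velocity_differentiable:
  assumes K: "K \<in> cells M" "y \<in> E K"
  shows "cell_velocity M V K differentiable (at y)"
proof -
  have "geo_shape M (ref M K) i differentiable (at y)" if "i \<in> {1..ngeo M (ref M K)}" for i
  proof (rule C1_near_differentiable[OF _ K(2)])
    show "C1_near (geo_shape M (ref M K) i) (E K)"
      using cell_reference_element[OF K(1)] that unfolding reference_element_def by blast
  qed
  then show ?thesis unfolding cell_velocity_def[abs_def]
    by (intro differentiable_sum differentiable_scaleR) auto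
qed

text \<open>On a cell the velocity is \<open>g\<close> composed with the inverse cell map, so its divergence is the trace of
\<open>Q B\<close>, with \<open>B\<close> the inverse of the derivative of the cell map.\<close>

lemma velocity_divergence_cell:
  assumes K: "K \<in> cells M" "y \<in> interior (E K)"
    and v: "\<And>z. z \<in> E K \<Longrightarrow> velocity M a W (T K z) = g z" and g: "(g has_derivative Q) (at y)"
  obtains B where "linear B" "DT K y \<circ> B = id" "B \<circ> DT K y = id"
    "dvg (velocity M a W) (T K y) = (\<Sum>k\<in>UNIV. Q (B (axis k 1)) $ k)"
proof -
  have A: "(T K has_derivative DT K y) (at y)"
    unfolding DT_def by (rule T_derivative[OF K(1) interior_elt[OF K(2)]])
  obtain B where B: "linear B" "DT K y \<circ> B = id" "B \<circ> DT K y = id"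
    "(velocity M a W has_derivative Q \<circ> B) (at (0 + T K y))"
    by (rule cell_chart_derivative[OF K _ g A, of "velocity M a W" 0]) (use v interior_elt in auto)
  have "frechet_derivative (velocity M a W) (at (T K y)) = Q \<circ> B"
    using frechet_derivative_at[OF B(4), symmetric] by simp
  then show ?thesis using that[OF B(1-3)] by (simp add: dvg_def)
qed

end

lemma mass_cong:
  assumes "\<And>g. g \<in> geo_dofs M \<Longrightarrow> a g = b g"
  shows "mass M a i = mass M b i"
proof -
  have "geo_map M a K = geo_map M b K" if "K \<in> cells M" for K
    unfolding geo_map_def fun_eq_iff using assms that unfolding geo_dofs_def
    by (intro allI sum.cong refl) auto
  then have "psi M a i x = psi M b i x" for x
    unfolding psi_def glue_def by (intro arg_cong[where f=The] ext bex_cong refl) auto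
  then show ?thesis by (simp add: mass_def)
qed

text \<open>At a fixed reference point the Jacobian determinant of the moving cell map is a polynomial in time
whose logarithmic derivative is the divergence of the velocity: the velocity has time independent
values on the reference cells, because it is carried by the geometric nodes. The quadrature is exact
for each reference point separately, and integration over the reference cells gives the claim.\<close>

theorem mass_evolution:
  fixes M :: "'d::finite discretization"
  assumes adm: "admissible_discretization M" and \<tau>: "0 < \<tau>"
    and matching: "\<And>s. s \<in> {0..\<tau>} \<Longrightarrow> matching_mesh M (move a V s)"
    and cont: "\<And>g. g \<in> geo_dofs M \<Longrightarrow> continuous_across_cells M a (local_geo_shape M g)"
    and vel: "\<And>x. geo_velocity M a V x = velocity M a W x"
    and q: "quadrature L \<omega> \<zeta> (CARD('d) - 1)" and i: "i \<in> dofs M"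
  shows "mass M (move a V \<tau>) i - mass M a i = \<tau> * (\<Sum>l\<in>L. \<omega> l *
    (LINT x:Omega M|lebesgue. psi M (move a V (\<tau> * \<zeta> l)) i x * dvg (velocity M (move a V (\<tau> * \<zeta> l)) W) x))"
proof -
  obtain e :: "'d ranked \<Rightarrow> 'd" where e: "bij e" by (rule ranked_bijection)
  have a0: "move a V 0 = a" by (simp add: move_def fun_eq_iff)
  have mesh: "mesh M (move a V s)" if "s \<in> {0..\<tau>}" for s
    using adm matching[OF that] by (rule mesh.intro)
  have mesh0: "mesh M a" using mesh[of 0] \<tau> a0 by simp
  have \<zeta>: "\<tau> * \<zeta> l \<in> {0..\<tau>}" if "l \<in> L" for l
    using q that \<tau> mult_left_mono[of "\<zeta> l" 1 \<tau>] unfolding quadrature_def by auto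
  have fL: "finite L" using q by (simp add: quadrature_def)
  let ?S = "\<lambda>K. interior (cell_elt M K)"
  define C where "C = {K \<in> cells M. i \<in> (\<lambda>i. con M i K) ` {1..nsh M (ref M K)}}"
  have Cs: "mesh.shape_cells M i = C"
    unfolding mesh.shape_cells_def[OF mesh0] mesh.cell_dofs_def[OF mesh0] C_def ..
  \<comment> \<open>the density of the mass on the reference cell, and the divergence of the velocity pulled back to it\<close>
  define J where "J s K y = \<bar>jac e (mesh.DT M (move a V s) K y)\<bar>" for s K y
  define dv where "dv s K y = dvg (velocity M (move a V s) W) (geo_map M (move a V s) K y)" for s K y
  have vel_cell: "velocity M (move a V s) W (geo_map M (move a V s) K y) = cell_velocity M V K y"
    if s: "s \<in> {0..\<tau>}" and K: "K \<in> cells M" "y \<in> cell_elt M K" for s K y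
  proof -
    have "velocity M (move a V s) W (geo_map M (move a V s) K y) = velocity M a W (geo_map M a K y)"
      using mesh.velocity_cell[OF mesh[OF s] K(1) mesh.zero_pers[OF mesh0] K(2)]
        mesh.velocity_cell[OF mesh0 K(1) mesh.zero_pers[OF mesh0] K(2)] by simp
    also have "\<dots> = geo_velocity M a V (geo_map M a K y)" by (simp add: vel)
    also have "\<dots> = cell_velocity M V K y" by (rule mesh.geo_velocity_cell[OF mesh0 cont K])
    finally show ?thesis .
  qed
  have J_int: "set_integrable lebesgue (?S K) (\<lambda>y. J s K y * local_shape M i K y)" if "s \<in> {0..\<tau>}" "K \<in> C" for s K
    using mesh.integral_on_reference_cells(1)[OF mesh[OF that(1)] e i, of "\<lambda>_. 1" K] that(2) mesh.psi_integrable[OF mesh[OF that(1)] i]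
    by (simp add: J_def Cs)
  have mass: "mass M (move a V s) i = (\<Sum>K\<in>C. LINT y:?S K|lebesgue. J s K y * local_shape M i K y)" if "s \<in> {0..\<tau>}" for s
    using mesh.integral_on_reference_cells(2)[OF mesh[OF that] e i, of "\<lambda>_. 1"] mesh.psi_integrable[OF mesh[OF that] i]
    by (simp add: J_def Cs mass_def)
  have dvp: "dvg (velocity M (move a V s) W) (p + x) = dvg (velocity M (move a V s) W) x" if "s \<in> {0..\<tau>}" "p \<in> pers M" for s p x
    by (rule dvg_periodic) (rule mesh.velocity_periodic[OF mesh[OF that(1)] that(2)])
  note D = mesh.integral_on_reference_cells[OF mesh e i dvp mesh.velocity_divergence_integral(1)[OF mesh i], unfolded Cs]
  have dv_int: "set_integrable lebesgue (?S K) (\<lambda>y. J s K y * (local_shape M i K y * dv s K y))" if "s \<in> {0..\<tau>}" "K \<in> C" for s K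
    unfolding J_def dv_def using that by (intro D(1)) auto
  have div: "(LINT x:Omega M|lebesgue. psi M (move a V s) i x * dvg (velocity M (move a V s) W) x)
      = (\<Sum>K\<in>C. LINT y:?S K|lebesgue. J s K y * (local_shape M i K y * dv s K y))" if "s \<in> {0..\<tau>}" for s
    unfolding J_def dv_def using that by (intro D(2)) auto
  have key: "J \<tau> K y - J 0 K y = \<tau> * (\<Sum>l\<in>L. \<omega> l * (J (\<tau> * \<zeta> l) K y * dv (\<tau> * \<zeta> l) K y))"
    if K: "K \<in> cells M" and y: "y \<in> ?S K" for K y
  proof -
    have yE: "y \<in> cell_elt M K" by (rule mesh.interior_elt[OF mesh0 y])
    define A where "A = mesh.DT M a K y"
    define Q where "Q = frechet_derivative (cell_velocity M V K) (at y)"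
    have Ad: "(geo_map M a K has_derivative A) (at y)"
      unfolding A_def mesh.DT_def[OF mesh0] by (rule mesh.T_derivative[OF mesh0 K yE])
    have Qd: "(cell_velocity M V K has_derivative Q) (at y)"
      unfolding Q_def using mesh.cell_velocity_differentiable[OF mesh0 K yE] by (simp flip: frechet_derivative_works)
    have lin: "linear A" "linear Q" using Ad Qd has_derivative_linear by blast+
    have DTs: "mesh.DT M (move a V s) K y = (\<lambda>h. A h + s *\<^sub>R Q h)" if s: "s \<in> {0..\<tau>}" for s
    proof -
      have "((\<lambda>z. geo_map M a K z + s *\<^sub>R cell_velocity M V K z) has_derivative (\<lambda>h. A h + s *\<^sub>R Q h)) (at y)"
        by (intro has_derivative_add Ad has_derivative_scaleR_right Qd)
      moreover have "geo_map M (move a V s) K = (\<lambda>z. geo_map M a K z + s *\<^sub>R cell_velocity M V K z)"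
        by (rule ext) (rule geo_map_move)
      ultimately have "(geo_map M (move a V s) K has_derivative (\<lambda>h. A h + s *\<^sub>R Q h)) (at y)" by simp
      from frechet_derivative_at[OF this, symmetric] show ?thesis
        unfolding mesh.DT_def[OF mesh[OF s]] .
    qed
    obtain p where p: "degree p \<le> CARD('d)" "\<And>s. jac e (\<lambda>h. A h + s *\<^sub>R Q h) = poly p s"
      using jac_poly[OF e] by metis
    have der: "poly (pderiv p) s = poly p s * dv s K y \<and> poly p s \<noteq> 0" if s: "s \<in> {0..\<tau>}" for s
    proof -
      obtain B where B: "linear B" "mesh.DT M (move a V s) K y \<circ> B = id" "B \<circ> mesh.DT M (move a V s) K y = id"
        "dvg (velocity M (move a V s) W) (geo_map M (move a V s) K y) = (\<Sum>k\<in>UNIV. Q (B (axis k 1)) $ k)"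
        by (rule mesh.velocity_divergence_cell[OF mesh[OF s] K y vel_cell[OF s K] Qd])
      from jac_derivative[OF e lin B(1) B(2,3)[unfolded DTs[OF s]] p(2)] B(4) p(2)
      show ?thesis by (simp add: dv_def)
    qed
    have Jp: "J s K y = \<bar>poly p s\<bar>" if "s \<in> {0..\<tau>}" for s
      unfolding J_def DTs[OF that] p(2) ..
    have "\<bar>poly p \<tau>\<bar> - \<bar>poly p 0\<bar> = \<tau> * (\<Sum>l\<in>L. \<omega> l * (\<bar>poly p (\<tau> * \<zeta> l)\<bar> * dv (\<tau> * \<zeta> l) K y))"
      by (rule quadrature_abs_poly[OF q p(1) _ \<tau>]) (use der \<zeta> in auto)
    then show ?thesis using Jp \<zeta> \<tau> by simp
  qed
  have cell: "(LINT y:?S K|lebesgue. J \<tau> K y * local_shape M i K y) - (LINT y:?S K|lebesgue. J 0 K y * local_shape M i K y)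
     = \<tau> * (\<Sum>l\<in>L. \<omega> l * (LINT y:?S K|lebesgue. J (\<tau> * \<zeta> l) K y * (local_shape M i K y * dv (\<tau> * \<zeta> l) K y)))"
    if KC: "K \<in> C" for K
  proof -
    have K: "K \<in> cells M" using KC by (simp add: C_def)
    have eq: "indicator (?S K) y *\<^sub>R (J \<tau> K y * local_shape M i K y - J 0 K y * local_shape M i K y)
      = \<tau> * (\<Sum>l\<in>L. \<omega> l * (indicator (?S K) y *\<^sub>R (J (\<tau> * \<zeta> l) K y * (local_shape M i K y * dv (\<tau> * \<zeta> l) K y))))" for y
    proof (cases "y \<in> ?S K")
      case True
      have "J \<tau> K y * local_shape M i K y - J 0 K y * local_shape M i K y = (J \<tau> K y - J 0 K y) * local_shape M i K y"
        by (simp add: algebra_simps)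
      also have "\<dots> = \<tau> * (\<Sum>l\<in>L. \<omega> l * (J (\<tau> * \<zeta> l) K y * (local_shape M i K y * dv (\<tau> * \<zeta> l) K y)))"
        unfolding key[OF K True] by (simp add: sum_distrib_right sum_distrib_left ac_simps)
      finally show ?thesis using True by simp
    qed simp
    have "(LINT y:?S K|lebesgue. J \<tau> K y * local_shape M i K y) - (LINT y:?S K|lebesgue. J 0 K y * local_shape M i K y)
      = (LINT y:?S K|lebesgue. J \<tau> K y * local_shape M i K y - J 0 K y * local_shape M i K y)"
      using J_int[OF _ KC, of \<tau>] J_int[OF _ KC, of 0] \<tau> by (subst set_integral_diff(2)) auto
    also have "\<dots> = (LINT y|lebesgue. \<tau> * (\<Sum>l\<in>L. \<omega> l * (indicator (?S K) y *\<^sub>R (J (\<tau> * \<zeta> l) K y * (local_shape M i K y * dv (\<tau> * \<zeta> l) K y)))))"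
      unfolding set_lebesgue_integral_def eq ..
    also have "\<dots> = \<tau> * (\<Sum>l\<in>L. \<omega> l * (LINT y:?S K|lebesgue. J (\<tau> * \<zeta> l) K y * (local_shape M i K y * dv (\<tau> * \<zeta> l) K y)))"
    proof -
      have I: "integrable lebesgue (\<lambda>y. \<omega> l * (indicator (?S K) y *\<^sub>R (J (\<tau> * \<zeta> l) K y * (local_shape M i K y * dv (\<tau> * \<zeta> l) K y))))" if "l \<in> L" for l
        using dv_int[OF \<zeta>[OF that] KC] unfolding set_integrable_def by (rule integrable_mult_right)
      have "(LINT y|lebesgue. (\<Sum>l\<in>L. \<omega> l * (indicator (?S K) y *\<^sub>R (J (\<tau> * \<zeta> l) K y * (local_shape M i K y * dv (\<tau> * \<zeta> l) K y)))))
        = (\<Sum>l\<in>L. LINT y|lebesgue. \<omega> l * (indicator (?S K) y *\<^sub>R (J (\<tau> * \<zeta> l) K y * (local_shape M i K y * dv (\<tau> * \<zeta> l) K y))))"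
        by (rule Bochner_Integration.integral_sum[OF I])
      then show ?thesis
        unfolding set_lebesgue_integral_def by (simp only: integral_mult_right_zero)
    qed
    finally show ?thesis .
  qed
  have "mass M (move a V \<tau>) i - mass M a i = (\<Sum>K\<in>C. (LINT y:?S K|lebesgue. J \<tau> K y * local_shape M i K y) - (LINT y:?S K|lebesgue. J 0 K y * local_shape M i K y))"
    using mass[of \<tau>] mass[of 0] \<tau> a0 by (simp add: sum_subtractf)
  also have "\<dots> = (\<Sum>K\<in>C. \<tau> * (\<Sum>l\<in>L. \<omega> l * (LINT y:?S K|lebesgue. J (\<tau> * \<zeta> l) K y * (local_shape M i K y * dv (\<tau> * \<zeta> l) K y))))"
    by (rule sum.cong[OF refl cell])
  also have "\<dots> = \<tau> * (\<Sum>l\<in>L. \<omega> l * (\<Sum>K\<in>C. LINT y:?S K|lebesgue. J (\<tau> * \<zeta> l) K y * (local_shape M i K y * dv (\<tau> * \<zeta> l) K y)))"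
    by (simp add: sum_distrib_left) (rule sum.swap)
  also have "\<dots> = \<tau> * (\<Sum>l\<in>L. \<omega> l * (LINT x:Omega M|lebesgue. psi M (move a V (\<tau> * \<zeta> l)) i x * dvg (velocity M (move a V (\<tau> * \<zeta> l)) W) x))"
    using div \<zeta> by (intro arg_cong[where f="\<lambda>x. \<tau> * x"] sum.cong) auto
  finally show ?thesis .
qed

section \<open>Entropies relative to a tangent\<close>

text \<open>Restriction to the segment from \<open>u\<close> to \<open>v\<close> reduces this to functions of one variable.\<close>

lemma convex_above_tangent:
  fixes \<eta> :: "real^'m \<Rightarrow> real"
  assumes c: "convex_on UNIV \<eta>" and d: "\<eta> differentiable (at u)"
  shows "\<eta> u + grad \<eta> u \<bullet> (v - u) \<le> \<eta> v"
proof -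
  define D where "D = frechet_derivative \<eta> (at u)"
  have D: "(\<eta> has_derivative D) (at u)" using d unfolding D_def frechet_derivative_works .
  have lin: "linear D" using D has_derivative_linear by blast
  have Dg: "D h = grad \<eta> u \<bullet> h" for h
  proof -
    have "D h = D (\<Sum>k\<in>UNIV. h $ k *\<^sub>R axis k 1)"
      by (rule arg_cong[OF basis_expansion[of h, unfolded scalar_mult_eq_scaleR, symmetric]])
    also have "\<dots> = (\<Sum>k\<in>UNIV. h $ k * D (axis k 1))" by (simp add: linear_sum[OF lin] linear_scale[OF lin])
    finally show ?thesis by (simp add: grad_def partial_deriv_def D_def inner_vec_def mult.commute)
  qed
  define g where "g s = \<eta> (u + s *\<^sub>R (v - u))" for s :: real
  have "convex_on UNIV g"
  proof (rule convex_onI)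
    fix t x y :: real assume t: "0 < t" "t < 1"
    have "u + ((1 - t) *\<^sub>R x + t *\<^sub>R y) *\<^sub>R (v - u) = (1 - t) *\<^sub>R (u + x *\<^sub>R (v - u)) + t *\<^sub>R (u + y *\<^sub>R (v - u))"
      by (simp add: algebra_simps)
    then show "g ((1 - t) *\<^sub>R x + t *\<^sub>R y) \<le> (1 - t) * g x + t * g y"
      unfolding g_def using convex_onD[OF c, of t "u + x *\<^sub>R (v - u)" "u + y *\<^sub>R (v - u)"] t by simp
  qed simp
  moreover have "(g has_real_derivative D (v - u)) (at 0 within UNIV)"
  proof -
    have "((\<lambda>s. \<eta> (u + s *\<^sub>R (v - u))) has_derivative (\<lambda>s. D (s *\<^sub>R (v - u)))) (at 0)"
    proof (rule has_derivative_compose[of "\<lambda>s. u + s *\<^sub>R (v - u)" "\<lambda>s. s *\<^sub>R (v - u)" _ _ \<eta> D])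
      show "((\<lambda>s. u + s *\<^sub>R (v - u)) has_derivative (\<lambda>s. s *\<^sub>R (v - u))) (at 0)"
        by (auto intro!: derivative_eq_intros)
      show "(\<eta> has_derivative D) (at (u + 0 *\<^sub>R (v - u)))" using D by simp
    qed
    then show ?thesis
      unfolding has_field_derivative_def g_def[abs_def]
      by (rule has_derivative_eq_rhs) (simp add: fun_eq_iff linear_scale[OF lin] mult.commute)
  qed
  ultimately have "g 1 - g 0 \<ge> D (v - u) * (1 - 0)"
    by (intro convex_on_imp_above_tangent[where A=UNIV]) auto
  then show ?thesis by (simp add: g_def Dg)
qed

text \<open>The entropy flux that belongs to the linear entropy \<open>v \<mapsto> l \<bullet> v\<close> is this combination of the rows of the
flux.\<close>

definition row_combination :: "real^'m \<Rightarrow> real^'d^'m \<Rightarrow> real^'d" where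
  "row_combination l A = (\<Sum>k\<in>UNIV. l $ k *\<^sub>R A $ k)"

lemma row_combination_inner: "row_combination l A \<bullet> c = l \<bullet> (A *v c)"
  by (simp add: row_combination_def matrix_vector_mult_def inner_vec_def sum_distrib_left sum_distrib_right mult_ac)
     (rule sum.swap)

lemma entropy_pair_minus_affine:
  fixes f :: "real^'m::finite \<Rightarrow> real^'d::finite^'m"
  assumes f: "\<forall>v. f differentiable (at v)" and ent: "entropy_pair f \<eta> q"
  shows "entropy_pair f (\<lambda>v. \<eta> v - (b + l \<bullet> v)) (\<lambda>v. q v - row_combination l (f v))"
proof -
  have c: "convex_on UNIV \<eta>" and de: "\<And>v. \<eta> differentiable (at v)" and dq: "\<And>v. q differentiable (at v)"
    and comp: "\<And>v n k. norm n = 1 \<Longrightarrow> partial_deriv (\<lambda>w. q w \<bullet> n) k v =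
        (\<Sum>i\<in>UNIV. partial_deriv \<eta> i v * partial_deriv (\<lambda>w. (f w $ i) \<bullet> n) k v)"
    using ent unfolding entropy_pair_def by blast+
  have fD: "(f has_derivative frechet_derivative f (at v)) (at v)" for v
    using f by (simp flip: frechet_derivative_works)
  have fi: "((\<lambda>w. f w $ i) has_derivative (\<lambda>h. frechet_derivative f (at v) h $ i)) (at v)" for v i
    by (rule bounded_linear.has_derivative[OF bounded_linear_vec_nth fD])
  have fin: "((\<lambda>w. (f w $ i) \<bullet> n) has_derivative frechet_derivative (\<lambda>w. (f w $ i) \<bullet> n) (at v)) (at v)" for v i n
    using bounded_linear.has_derivative[OF bounded_linear_inner_left fi[where v=v]]
    by (metis differentiableI frechet_derivative_works)
  have eD: "((\<lambda>v. \<eta> v - (b + l \<bullet> v)) has_derivative (\<lambda>h. frechet_derivative \<eta> (at v) h - l \<bullet> h)) (at v)" for v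
    by (auto intro!: derivative_eq_intros simp: de simp flip: frechet_derivative_works)
  have rD: "((\<lambda>v. row_combination l (f v)) has_derivative (\<lambda>h. \<Sum>k\<in>UNIV. l $ k *\<^sub>R frechet_derivative f (at v) h $ k)) (at v)" for v
    unfolding row_combination_def by (intro has_derivative_sum has_derivative_scaleR_right fi)
  show ?thesis
    unfolding entropy_pair_def
  proof (intro conjI allI impI)
    have aff: "convex_on UNIV (\<lambda>v. - (b + l \<bullet> v))"
      by (rule convex_onI) (auto simp: algebra_simps inner_add_right)
    have "convex_on UNIV (\<lambda>v. \<eta> v + - (b + l \<bullet> v))" by (rule convex_on_add[OF c aff])
    then show "convex_on UNIV (\<lambda>v. \<eta> v - (b + l \<bullet> v))" by (simp only: diff_conv_add_uminus)
    show "(\<lambda>v. \<eta> v - (b + l \<bullet> v)) differentiable at v" for v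
      using eD differentiableI by blast
    show "(\<lambda>v. q v - row_combination l (f v)) differentiable at v" for v
      using dq rD differentiableI by (intro differentiable_diff) blast+
    fix v :: "real^'m" and n :: "real^'d" and k assume n: "norm n = 1"
    have e: "partial_deriv (\<lambda>v. \<eta> v - (b + l \<bullet> v)) i v = partial_deriv \<eta> i v - l $ i" for i
      using frechet_derivative_at[OF eD[of v], symmetric] by (simp add: partial_deriv_def inner_axis)
    have "((\<lambda>w. q w \<bullet> n) has_derivative frechet_derivative (\<lambda>w. q w \<bullet> n) (at v)) (at v)"
      using dq[of v] by (auto simp: frechet_derivative_works[symmetric] intro!: differentiable_inner)
    then have "((\<lambda>w. q w \<bullet> n - (\<Sum>i\<in>UNIV. l $ i * ((f w $ i) \<bullet> n))) has_derivative
       (\<lambda>h. frechet_derivative (\<lambda>w. q w \<bullet> n) (at v) h - (\<Sum>i\<in>UNIV. l $ i * frechet_derivative (\<lambda>w. (f w $ i) \<bullet> n) (at v) h))) (at v)"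
      by (intro has_derivative_diff has_derivative_sum has_derivative_mult_right fin)
    from frechet_derivative_at[OF this, symmetric]
    have "partial_deriv (\<lambda>w. q w \<bullet> n - (\<Sum>i\<in>UNIV. l $ i * ((f w $ i) \<bullet> n))) k v
       = partial_deriv (\<lambda>w. q w \<bullet> n) k v - (\<Sum>i\<in>UNIV. l $ i * partial_deriv (\<lambda>w. (f w $ i) \<bullet> n) k v)"
      by (simp add: partial_deriv_def)
    then show "partial_deriv (\<lambda>w. (q w - row_combination l (f w)) \<bullet> n) k v =
        (\<Sum>i\<in>UNIV. partial_deriv (\<lambda>v. \<eta> v - (b + l \<bullet> v)) i v * partial_deriv (\<lambda>w. (f w $ i) \<bullet> n) k v)"
      unfolding e comp[OF n] by (simp add: inner_diff_left row_combination_def inner_sum_left sum_subtractf left_diff_distrib)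
  qed
qed

lemma ale_flux_vec: "ale_flux f w v *v c = f v *v c - (w \<bullet> c) *\<^sub>R v"
  by (simp add: ale_flux_def outer_def vec_eq_iff matrix_vector_mult_def inner_vec_def
      sum_subtractf sum_distrib_left algebra_simps)

text \<open>The inequality for a unit normal, scaled by the length of \<open>c\<close>. For nonnegative entropies the limiting
wave speed itself is admissible as a cone speed, even if it is zero.\<close>

lemma edge_dissipation:
  fixes R :: "('m::finite, 'd::finite) riemann" and w c :: "real^'d"
  assumes R: "riemann_solvable f R" and ent: "entropy_pair f \<eta> q" and adm: "uL \<in> adm R" "uR \<in> adm R"
    and nonneg: "\<And>v. 0 \<le> \<eta> v" and d: "wave_speed R w c uL uR * norm c \<le> d"
  shows "(q uR - q uL) \<bullet> c - (c \<bullet> w) * (\<eta> uR - \<eta> uL) \<le> d * (\<eta> uL + \<eta> uR)"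
proof (cases "c = 0")
  case True
  then have "0 \<le> d" using d by simp
  then show ?thesis using True nonneg[of uL] nonneg[of uR] by simp
next
  case False
  let ?n = "sgn c" and ?l = "lam_max (ale_riemann w R) (sgn c) uL uR"
  have c: "c = norm c *\<^sub>R ?n" using False by (simp add: sgn_div_norm)
  have "(q uR - q uL) \<bullet> ?n - (w \<bullet> ?n) * (\<eta> uR - \<eta> uL) \<le> ?l * (\<eta> uL + \<eta> uR)"
    by (rule riemann_entropy_dissipation[OF R ent adm _ nonneg order_refl]) (simp add: norm_sgn False)
  then have "norm c * ((q uR - q uL) \<bullet> ?n - (w \<bullet> ?n) * (\<eta> uR - \<eta> uL)) \<le> norm c * (?l * (\<eta> uL + \<eta> uR))"
    by (rule mult_left_mono) simp
  also have "norm c * ((q uR - q uL) \<bullet> ?n - (w \<bullet> ?n) * (\<eta> uR - \<eta> uL)) = (q uR - q uL) \<bullet> c - (c \<bullet> w) * (\<eta> uR - \<eta> uL)"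
  proof -
    have "norm c * ((q uR - q uL) \<bullet> ?n) = (q uR - q uL) \<bullet> c" "norm c * (w \<bullet> ?n) = w \<bullet> c"
      using c by (metis inner_scaleR_right)+
    then show ?thesis by (simp add: right_diff_distrib inner_commute[of c w] flip: mult.assoc)
  qed
  also have "norm c * (?l * (\<eta> uL + \<eta> uR)) \<le> d * (\<eta> uL + \<eta> uR)"
    using d False nonneg[of uL] nonneg[of uR] mult_right_mono[of "?l * norm c" d "\<eta> uL + \<eta> uR"]
    by (simp add: wave_speed_def mult_ac)
  finally show ?thesis .
qed

section \<open>The entropy inequality of the scheme\<close>

text \<open>After subtraction of the tangent at \<open>U'\<close>, the entropy \<open>\<eta>1\<close> is nonnegative and vanishes at \<open>U'\<close>. With
\<open>Res\<close> the difference of the two sides, \<open>Res\<close> vanishes for the affine part. For \<open>\<eta>1\<close>, conservation and the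
mass balance rewrite it as a sum over edges minus \<open>m' * \<eta>1 (U i)\<close>; the edge inequalities bound the sum by
\<open>2 * \<tau> * (\<Sum>j. d j) * \<eta>1 (U i)\<close>.\<close>

lemma scheme_entropy_inequality:
  fixes f :: "real^'m::finite \<Rightarrow> real^'d::finite^'m" and c W :: "nat \<Rightarrow> real^'d" and U :: "nat \<Rightarrow> real^'m"
  assumes I: "finite I" "i \<in> I" and \<tau>: "0 < \<tau>"
    and update: "(1 / \<tau>) *\<^sub>R (m' *\<^sub>R U' - m *\<^sub>R U i) + (\<Sum>j\<in>I. ale_flux f (W j) (U j) *v c j - d j *\<^sub>R U j) = 0"
    and c0: "(\<Sum>j\<in>I. c j) = 0" and d0: "d i = - (\<Sum>j\<in>I - {i}. d j)"
    and mass: "m' = m + \<tau> * (\<Sum>j\<in>I. c j \<bullet> W j)"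
    and cfl: "2 * \<tau> * (\<Sum>j\<in>I - {i}. d j) \<le> m'"
    and f: "\<forall>v. f differentiable (at v)" and ent: "entropy_pair f \<eta> q"
    and diss: "\<And>\<eta> q j. entropy_pair f \<eta> q \<Longrightarrow> (\<And>v. 0 \<le> \<eta> v) \<Longrightarrow> j \<in> I - {i} \<Longrightarrow>
      (q (U j) - q (U i)) \<bullet> c j - (c j \<bullet> W j) * (\<eta> (U j) - \<eta> (U i)) \<le> d j * (\<eta> (U i) + \<eta> (U j))"
  shows "1 / \<tau> * (m' * \<eta> U' - m * \<eta> (U i)) \<le> (\<Sum>j\<in>I. d j * \<eta> (U j)) - (\<Sum>j\<in>I. c j \<bullet> (q (U j) - \<eta> (U j) *\<^sub>R W j))"
proof -
  define l where "l = grad \<eta> U'"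
  define b where "b = \<eta> U' - l \<bullet> U'"
  define \<eta>1 where "\<eta>1 v = \<eta> v - (b + l \<bullet> v)" for v
  define q1 where "q1 v = q v - row_combination l (f v)" for v
  have ent1: "entropy_pair f \<eta>1 q1"
    unfolding \<eta>1_def[abs_def] q1_def[abs_def] by (rule entropy_pair_minus_affine[OF f ent])
  have nonneg: "0 \<le> \<eta>1 v" for v
    using convex_above_tangent[of \<eta> U' v] ent unfolding entropy_pair_def \<eta>1_def b_def l_def
    by (simp add: inner_diff_right)
  have zero: "\<eta>1 U' = 0" by (simp add: \<eta>1_def b_def)
  \<comment> \<open>The inequality for an entropy \<open>e\<close> with flux \<open>r\<close> is \<open>Res e r \<le> 0\<close>.\<close>
  define Res where "Res e r = (m' * e U' - m * e (U i)) - \<tau> * (\<Sum>j\<in>I. d j * e (U j)) + \<tau> * (\<Sum>j\<in>I. c j \<bullet> (r (U j) - e (U j) *\<^sub>R W j))"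
    for e :: "real^'m \<Rightarrow> real" and r :: "real^'m \<Rightarrow> real^'d"
  have sum_d: "(\<Sum>j\<in>I. d j * x j) = (\<Sum>j\<in>I - {i}. d j * (x j - x i))" for x
    by (subst sum.remove[OF I]) (simp add: d0 right_diff_distrib sum_subtractf sum_distrib_right)
  have affine: "Res (\<lambda>v. b + l \<bullet> v) (\<lambda>v. row_combination l (f v)) = 0"
  proof -
    have "0 = \<tau> * (l \<bullet> ((1 / \<tau>) *\<^sub>R (m' *\<^sub>R U' - m *\<^sub>R U i) + (\<Sum>j\<in>I. ale_flux f (W j) (U j) *v c j - d j *\<^sub>R U j)))"
      unfolding update by simp
    also have "\<dots> = (m' * (l \<bullet> U') - m * (l \<bullet> U i)) + \<tau> * (\<Sum>j\<in>I. row_combination l (f (U j)) \<bullet> c j - (W j \<bullet> c j) * (l \<bullet> U j) - d j * (l \<bullet> U j))"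
      using \<tau> by (simp add: ale_flux_vec inner_add_right inner_diff_right inner_sum_right row_combination_inner distrib_left)
    also have "\<dots> = Res (\<lambda>v. b + l \<bullet> v) (\<lambda>v. row_combination l (f v))
       - (m' * b - m * b) + \<tau> * (\<Sum>j\<in>I. d j * b) + \<tau> * (\<Sum>j\<in>I. (c j \<bullet> W j) * b)"
    proof -
      let ?S1 = "\<Sum>j\<in>I. row_combination l (f (U j)) \<bullet> c j" and ?S2 = "\<Sum>j\<in>I. (W j \<bullet> c j) * (l \<bullet> U j)"
        and ?S3 = "\<Sum>j\<in>I. d j * (l \<bullet> U j)" and ?S4 = "\<Sum>j\<in>I. d j * b" and ?S5 = "\<Sum>j\<in>I. (c j \<bullet> W j) * b"
      have 1: "(\<Sum>j\<in>I. row_combination l (f (U j)) \<bullet> c j - (W j \<bullet> c j) * (l \<bullet> U j) - d j * (l \<bullet> U j)) = ?S1 - ?S2 - ?S3"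
        by (simp only: sum_subtractf)
      have 2: "(\<Sum>j\<in>I. d j * (b + l \<bullet> U j)) = ?S4 + ?S3"
        by (simp only: distrib_left sum.distrib)
      have 3: "(\<Sum>j\<in>I. c j \<bullet> (row_combination l (f (U j)) - (b + l \<bullet> U j) *\<^sub>R W j)) = ?S1 - ?S5 - ?S2"
        unfolding sum_subtractf[symmetric]
        by (intro sum.cong refl) (simp add: inner_diff_right inner_commute algebra_simps)
      show ?thesis unfolding Res_def 1 2 3 by (simp add: algebra_simps)
    qed
    also have "(\<Sum>j\<in>I. d j * b) = 0" using sum_d[of "\<lambda>_. b"] by simp
    also have "\<tau> * (\<Sum>j\<in>I. (c j \<bullet> W j) * b) = m' * b - m * b"
      unfolding sum_distrib_right[symmetric] mass by (simp add: algebra_simps)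
    finally show ?thesis by simp
  qed
  have "Res \<eta>1 q1 \<le> 0"
  proof -
    let ?x = "\<lambda>j. \<eta>1 (U j)" and ?y = "\<lambda>j. q1 (U j)"
    let ?D = "\<lambda>j. (?y j - ?y i) \<bullet> c j - (c j \<bullet> W j) * (?x j - ?x i)"
    have "(\<Sum>j\<in>I. c j \<bullet> (?y j - ?x j *\<^sub>R W j)) = (\<Sum>j\<in>I. ?D j + (c j \<bullet> ?y i - (c j \<bullet> W j) * ?x i))"
      by (intro sum.cong refl) (simp add: inner_diff_right inner_diff_left inner_commute algebra_simps)
    also have "\<dots> = (\<Sum>j\<in>I. ?D j) + ((\<Sum>j\<in>I. c j) \<bullet> ?y i - (\<Sum>j\<in>I. c j \<bullet> W j) * ?x i)"
      by (simp add: sum.distrib sum_subtractf inner_sum_left sum_distrib_right)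
    also have "(\<Sum>j\<in>I. ?D j) = (\<Sum>j\<in>I - {i}. ?D j)"
      by (subst sum.remove[OF I]) simp
    finally have e: "(\<Sum>j\<in>I. c j \<bullet> (?y j - ?x j *\<^sub>R W j)) = (\<Sum>j\<in>I - {i}. ?D j) + ((\<Sum>j\<in>I. c j) \<bullet> ?y i - (\<Sum>j\<in>I. c j \<bullet> W j) * ?x i)" .
    have "\<tau> * (A + (0 - S * x)) = \<tau> * A - (m + \<tau> * S - m) * x" for A S x :: real
      by (simp add: algebra_simps)
    then have "\<tau> * (\<Sum>j\<in>I. c j \<bullet> (?y j - ?x j *\<^sub>R W j)) = \<tau> * (\<Sum>j\<in>I - {i}. ?D j) - (m' - m) * ?x i"
      unfolding e c0 inner_zero_left mass .
    note L = this
    have "(m' * 0 - m * x) - \<tau> * P + (\<tau> * Q - (m' - m) * x) = \<tau> * (Q - P) - m' * x" for P Q x :: real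
      by (simp add: algebra_simps)
    then have "Res \<eta>1 q1 = \<tau> * (\<Sum>j\<in>I - {i}. ?D j - d j * (?x j - ?x i)) - m' * ?x i"
      unfolding Res_def sum_d[of ?x] zero L sum_subtractf[of ?D "\<lambda>j. d j * (?x j - ?x i)"] .
    also have "\<dots> \<le> \<tau> * (\<Sum>j\<in>I - {i}. 2 * d j * ?x i) - m' * ?x i"
    proof -
      have "?D j - d j * (?x j - ?x i) \<le> 2 * d j * ?x i" if "j \<in> I - {i}" for j
        using diss[OF ent1 nonneg that] by (simp add: algebra_simps)
      then show ?thesis using \<tau> by (intro diff_right_mono mult_left_mono sum_mono) auto
    qed
    also have "\<dots> = (2 * \<tau> * (\<Sum>j\<in>I - {i}. d j) - m') * ?x i"
      by (simp add: sum_distrib_left sum_distrib_right algebra_simps)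
    also have "\<dots> \<le> 0"
      using cfl nonneg[of "U i"] by (simp add: mult_nonpos_nonneg)
    finally show ?thesis .
  qed
  moreover have "Res \<eta> q = Res \<eta>1 q1 + Res (\<lambda>v. b + l \<bullet> v) (\<lambda>v. row_combination l (f v))"
    unfolding Res_def \<eta>1_def q1_def
    by (simp add: sum_subtractf sum.distrib inner_diff_right algebra_simps)
  ultimately have "Res \<eta> q \<le> 0" using affine by simp
  then have "m' * \<eta> U' - m * \<eta> (U i) \<le> \<tau> * ((\<Sum>j\<in>I. d j * \<eta> (U j)) - (\<Sum>j\<in>I. c j \<bullet> (q (U j) - \<eta> (U j) *\<^sub>R W j)))"
    unfolding Res_def by (simp add: right_diff_distrib)
  then show ?thesis using \<tau> by (simp add: field_simps)
qed

text \<open>The local mesh size is infinite if \<open>e = 0\<close>; then both \<open>lam / h\<close> and \<open>lam * e\<close> are 0.\<close>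

lemma cfl_real:
  assumes "0 \<le> e" "h = 1 / ereal e" "cfl \<tau> lam h \<kappa> r"
  shows "2 * \<tau> * (lam * e) * \<kappa> * r \<le> 1"
proof -
  have "ereal lam / h = ereal (lam * e)"
    unfolding assms(2) using assms(1) by (cases "e = 0") (auto simp: divide_ereal_def)
  then have "ereal (2 * \<tau> * (lam * e) * \<kappa> * r) \<le> 1"
    using assms(3) unfolding cfl_def by (simp add: numeral_eq_ereal)
  then show ?thesis by simp
qed

lemma ereal_inverse_le:
  assumes "0 \<le> e" "0 \<le> e'" "1 / ereal e \<le> 1 / ereal e'"
  shows "e' \<le> e"
  using assms by (cases "e = 0"; cases "e' = 0") (auto simp: divide_ereal_def field_simps)

lemma visc_diagonal:
  assumes "\<And>j. j \<in> I i \<Longrightarrow> i \<in> I j"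
  shows "visc R I c W U i i = - (\<Sum>j\<in>I i - {i}. visc R I c W U i j)"
  unfolding visc_def using assms by (auto simp: visc_off_def max.commute intro!: sum.cong)

text \<open>Antisymmetry makes both vectors in the definition of the viscosity equally long.\<close>

lemma visc_bounds:
  assumes I: "finite (I i)" "i \<in> I i" and j: "j \<in> I i" "j \<noteq> i"
    and anti: "\<And>j. j \<in> I i \<Longrightarrow> c j i = - c i j"
  shows "wave_speed R (W j) (c i j) (U i) (U j) * norm (c i j) \<le> visc R I c W U i j"
    and "visc R I c W U i j \<le> lam_i_max R I c W U i * norm (c i j)" and "0 \<le> lam_i_max R I c W U i"
proof -
  show "wave_speed R (W j) (c i j) (U i) (U j) * norm (c i j) \<le> visc R I c W U i j"
    using j by (simp add: visc_def visc_off_def)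
  let ?g = "\<lambda>j. max (wave_speed R (W j) (c i j) (U i) (U j)) (wave_speed R (W i) (c j i) (U j) (U i))"
  have l: "?g j \<le> lam_i_max R I c W U i" using I j unfolding lam_i_max_def by (intro Max_ge) auto
  have "0 \<le> wave_speed R (W j) (c i j) (U i) (U j)" by (simp add: wave_speed_def lam_max_def le_max_iff_disj)
  then show "0 \<le> lam_i_max R I c W U i" using l by linarith
  have n: "norm (c j i) = norm (c i j)" using anti[OF j(1)] by simp
  show "visc R I c W U i j \<le> lam_i_max R I c W U i * norm (c i j)"
    using j l by (auto simp: visc_def visc_off_def n intro!: mult_right_mono)
qed

text \<open>What the two versions have in common. For version 1 the numbers \<open>s j\<close> are overlap masses and \<open>\<mu>\<close> is the
mass of \<open>\<psi>\<^sub>i\<close>; for version 2 both are averages over the quadrature times.\<close>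

lemma ale_entropy_inequality:
  fixes f :: "real^'m::finite \<Rightarrow> real^'d::finite^'m" and R :: "('m, 'd) riemann" and W :: "nat \<Rightarrow> real^'d"
  assumes f: "\<forall>v. f differentiable (at v)" and R: "riemann_solvable f R" and ent: "entropy_pair f \<eta> q"
    and I: "finite (I i)" "i \<in> I i" and sym: "\<And>j. j \<in> I i \<Longrightarrow> i \<in> I j" and U: "U ` I i \<subseteq> adm R"
    and c0: "(\<Sum>j\<in>I i. c i j) = 0" and anti: "\<And>j. j \<in> I i \<Longrightarrow> c j i = - c i j"
    and \<tau>: "0 < \<tau>" and m': "0 < m' i" and mass: "m' i = m i + \<tau> * (\<Sum>j\<in>I i. c i j \<bullet> W j)"
    and update: "scheme_update f R I c W \<tau> m m' U U' i"
    and e: "0 \<le> e" "h = 1 / ereal e" and s: "\<And>j. j \<in> I i \<Longrightarrow> norm (c i j) \<le> e * s j" and \<mu>: "0 < \<mu>"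
    and cfl: "cfl \<tau> (lam_i_max R I c W U i) h ((\<Sum>j\<in>I i - {i}. s j) / \<mu>) (\<mu> / m' i)"
  shows "1 / \<tau> * (m' i * \<eta> (U' i) - m i * \<eta> (U i))
     \<le> (\<Sum>j\<in>I i. visc R I c W U i j * \<eta> (U j)) - (\<Sum>j\<in>I i. c i j \<bullet> (q (U j) - \<eta> (U j) *\<^sub>R W j))"
proof (rule scheme_entropy_inequality[OF I \<tau> _ c0 _ mass _ f ent])
  show "(1 / \<tau>) *\<^sub>R (m' i *\<^sub>R U' i - m i *\<^sub>R U i) + (\<Sum>j\<in>I i. ale_flux f (W j) (U j) *v c i j - visc R I c W U i j *\<^sub>R U j) = 0"
    using update unfolding scheme_update_def .
  let ?d = "visc R I c W U i" and ?lam = "lam_i_max R I c W U i"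
  have row: "?d j \<le> ?lam * norm (c i j)" "0 \<le> ?lam" "wave_speed R (W j) (c i j) (U i) (U j) * norm (c i j) \<le> ?d j"
    if "j \<in> I i - {i}" for j
    using visc_bounds[where I=I and i=i and c=c and j=j and R=R and W=W and U=U, OF I _ _ anti] that by auto
  show "?d i = - (\<Sum>j\<in>I i - {i}. ?d j)"
    by (rule visc_diagonal[OF sym])
  show "2 * \<tau> * (\<Sum>j\<in>I i - {i}. ?d j) \<le> m' i"
  proof -
    have "?d j \<le> ?lam * e * s j" if j: "j \<in> I i - {i}" for j
    proof -
      have "?d j \<le> ?lam * norm (c i j)" by (rule row(1)[OF j])
      also have "\<dots> \<le> ?lam * (e * s j)"
        using row(2)[OF j] s j by (intro mult_left_mono) auto
      finally show ?thesis by (simp add: mult.assoc)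
    qed
    then have "(\<Sum>j\<in>I i - {i}. ?d j) \<le> ?lam * e * (\<Sum>j\<in>I i - {i}. s j)"
      unfolding sum_distrib_left by (rule sum_mono)
    then have "2 * \<tau> * (\<Sum>j\<in>I i - {i}. ?d j) \<le> 2 * \<tau> * (?lam * e * (\<Sum>j\<in>I i - {i}. s j))"
      using \<tau> by (intro mult_left_mono) auto
    also have "\<dots> \<le> m' i"
      using cfl_real[OF e cfl] \<mu> m' by (simp add: field_simps)
    finally show ?thesis .
  qed
  fix \<eta>' q' j assume ent': "entropy_pair f \<eta>' q'" "\<And>v. 0 \<le> \<eta>' v" and j: "j \<in> I i - {i}"
  show "(q' (U j) - q' (U i)) \<bullet> c i j - (c i j \<bullet> W j) * (\<eta>' (U j) - \<eta>' (U i)) \<le> ?d j * (\<eta>' (U i) + \<eta>' (U j))"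
    by (rule edge_dissipation[OF R ent'(1) _ _ ent'(2) row(3)[OF j]]) (use U I j in auto)
qed

theorem theorem5p6:
  fixes f :: "real^'m \<Rightarrow> real^'d^'m"
    and R :: "('m::finite, 'd::finite) riemann"
    and \<eta> :: "real^'m \<Rightarrow> real"
    and q :: "real^'m \<Rightarrow> real^'d"
    and M :: "'d discretization"
    and B :: "(real^'m) set"
    and \<tau> :: "nat \<Rightarrow> real"
    and a W Wgeo :: "nat \<Rightarrow> nat \<Rightarrow> real^'d"
    and mu :: "nat \<Rightarrow> nat \<Rightarrow> real"
    and U :: "nat \<Rightarrow> nat \<Rightarrow> real^'m"
    and L :: "nat set"
    and \<omega> \<zeta> :: "nat \<Rightarrow> real"
    and n i :: nat
  assumes "\<forall>v. f differentiable (at v)"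
    and "riemann_solvable f R"
    and "entropy_pair f \<eta> q"
    and "admissible_discretization M"
    and "i \<in> dofs M"
    and "invariant_set R B"
    and "U n ` nb M (a n) i \<subseteq> B"
  shows
    "(let I = nb M (a n);
          c = cvec M (a n);
          d = visc R I c (W n) (U n);
          lam = lam_i_max R I c (W n) (U n) i;
          h = hmin M (a n) i;
          \<kappa> = kappa1 M (a n) i
      in ale_version1 M f R \<tau> a W mu U n \<longrightarrow>
         cfl (\<tau> n) lam h \<kappa> (mu n i / mu (Suc n) i) \<longrightarrow>
         cfl (\<tau> n) lam h \<kappa> (mass M (a n) i / mu (Suc n) i) \<longrightarrow>
         1 / \<tau> n * (mu (Suc n) i * \<eta> (U (Suc n) i) - mu n i * \<eta> (U n i))
         \<le> (\<Sum>j\<in>I i. d i j * \<eta> (U n j))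
           - (LINT x:Omega M|lebesgue.
                dvg (\<lambda>x. \<Sum>j\<in>I i. psi M (a n) j x *\<^sub>R (q (U n j) - \<eta> (U n j) *\<^sub>R W n j)) x
                * psi M (a n) i x))
     \<and>
     (let I = nb M (a n);
          aq = (\<lambda>l. move (a n) (Wgeo n) (\<tau> n * \<zeta> l));
          c = cvec2 M L \<omega> aq;
          d = visc R I c (W n) (U n);
          lam = lam_i_max R I c (W n) (U n) i;
          h = hmin2 M L aq i;
          \<kappa> = kappa2 M L \<omega> aq (I i) i
      in ale_version2 M f R L \<omega> \<zeta> \<tau> a Wgeo W U n \<longrightarrow>
         cfl (\<tau> n) lam h \<kappa> (quad_mass M L \<omega> aq i / mass M (a (Suc n)) i) \<longrightarrow>
         1 / \<tau> n * (mass M (a (Suc n)) i * \<eta> (U (Suc n) i) - mass M (a n) i * \<eta> (U n i))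
         \<le> (\<Sum>j\<in>I i. d i j * \<eta> (U n j))
           - (\<Sum>l\<in>L. \<omega> l *
                (LINT x:Omega M|lebesgue.
                   dvg (\<lambda>x. \<Sum>j\<in>I i. psi M (aq l) j x *\<^sub>R (q (U n j) - \<eta> (U n j) *\<^sub>R W n j)) x
                   * psi M (aq l) i x)))"
proof -
  note f = assms(1) and R = assms(2) and ent = assms(3) and adm = assms(4) and i = assms(5)
  let ?I = "nb M (a n)"
  let ?V = "\<lambda>j. q (U n j) - \<eta> (U n j) *\<^sub>R W n j"
  have U: "U n ` ?I i \<subseteq> adm R"
    using assms(6,7) unfolding invariant_set_def by blast
  have v1: "1 / \<tau> n * (mu (Suc n) i * \<eta> (U (Suc n) i) - mu n i * \<eta> (U n i))
      \<le> (\<Sum>j\<in>?I i. visc R ?I (cvec M (a n)) (W n) (U n) i j * \<eta> (U n j))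
        - (LINT x:Omega M|lebesgue. dvg (\<lambda>x. \<Sum>j\<in>?I i. psi M (a n) j x *\<^sub>R ?V j) x * psi M (a n) i x)"
    if ale: "ale_version1 M f R \<tau> a W mu U n"
      and cfl: "cfl (\<tau> n) (lam_i_max R ?I (cvec M (a n)) (W n) (U n) i) (hmin M (a n) i) (kappa1 M (a n) i) (mass M (a n) i / mu (Suc n) i)"
  proof -
    have step: "ale1_step M f R \<tau> a W mu U n"
      using ale unfolding ale_version1_def by blast
    have "matching_mesh M (a n)" using step unfolding ale1_step_def by blast
    then interpret mesh M "a n" by (rule mesh.intro[OF adm])
    have mu: "0 < mu (Suc n) i" "mu (Suc n) i = mu n i + \<tau> n * (\<Sum>j\<in>?I i. cvec M (a n) i j \<bullet> W n j)"
      using step i velocity_divergence_integral(3)[OF i] unfolding ale1_step_def by auto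
    obtain e where e: "\<And>j. j \<in> ?I i \<Longrightarrow> 0 \<le> e j \<and> hloc M (a n) i j = 1 / ereal (e j) \<and> norm (cvec M (a n) i j) \<le> e j * overlap_mass M (a n) i j"
    proof -
      have "\<exists>e. j \<in> ?I i \<longrightarrow> 0 \<le> e \<and> hloc M (a n) i j = 1 / ereal e \<and> norm (cvec M (a n) i j) \<le> e * overlap_mass M (a n) i j" for j
        using cvec_hloc_bound[OF i, of j] by metis
      then show ?thesis using that by metis
    qed
    have "hmin M (a n) i \<in> hloc M (a n) i ` ?I i"
      unfolding hmin_def using nb_finite[OF i] nb_self[OF i] by (intro Min_in) auto
    then obtain j0 where j0: "j0 \<in> ?I i" "hmin M (a n) i = 1 / ereal (e j0)" using e by auto
    have s: "norm (cvec M (a n) i j) \<le> e j0 * overlap_mass M (a n) i j" if j: "j \<in> ?I i" for j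
    proof -
      have "hmin M (a n) i \<le> hloc M (a n) i j"
        unfolding hmin_def using nb_finite[OF i] j by (intro Min_le) auto
      then have "e j \<le> e j0" using ereal_inverse_le e[OF j] e[OF j0(1)] j0(2) by metis
      then have "e j * overlap_mass M (a n) i j \<le> e j0 * overlap_mass M (a n) i j"
        using overlap_mass_bounds(1)[OF i] by (rule mult_right_mono)
      then show ?thesis using e[OF j] by linarith
    qed
    have \<kappa>: "kappa1 M (a n) i = (\<Sum>j\<in>?I i - {i}. overlap_mass M (a n) i j) / mass M (a n) i"
      unfolding kappa1_def overlap_mass_bounds(3)[OF i] ..
    have "1 / \<tau> n * (mu (Suc n) i * \<eta> (U (Suc n) i) - mu n i * \<eta> (U n i))
      \<le> (\<Sum>j\<in>?I i. visc R ?I (cvec M (a n)) (W n) (U n) i j * \<eta> (U n j)) - (\<Sum>j\<in>?I i. cvec M (a n) i j \<bullet> ?V j)"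
    proof (rule ale_entropy_inequality[where I="?I" and c="cvec M (a n)" and m="mu n" and m'="mu (Suc n)" and s="overlap_mass M (a n) i",
          OF f R ent nb_finite[OF i] nb_self[OF i] nb_sym[OF i] U sum_cvec_zero[OF i] _ _ mu _ _ j0(2) s mass_pos[OF i] cfl[unfolded \<kappa>]])
      show "cvec M (a n) j i = - cvec M (a n) i j" if "j \<in> ?I i" for j
        using cvec_antisym[OF _ i] nb_dofs that by blast
    qed (use step i e[OF j0(1)] in \<open>auto simp: ale1_step_def\<close>)
    then show ?thesis unfolding flux_divergence_integral[OF i] .
  qed
  define aq where "aq l = move (a n) (Wgeo n) (\<tau> n * \<zeta> l)" for l
  let ?c = "cvec2 M L \<omega> aq"
  have v2: "1 / \<tau> n * (mass M (a (Suc n)) i * \<eta> (U (Suc n) i) - mass M (a n) i * \<eta> (U n i))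
      \<le> (\<Sum>j\<in>?I i. visc R ?I ?c (W n) (U n) i j * \<eta> (U n j))
        - (\<Sum>l\<in>L. \<omega> l * (LINT x:Omega M|lebesgue. dvg (\<lambda>x. \<Sum>j\<in>?I i. psi M (aq l) j x *\<^sub>R ?V j) x * psi M (aq l) i x))"
    if ale: "ale_version2 M f R L \<omega> \<zeta> \<tau> a Wgeo W U n"
      and cfl: "cfl (\<tau> n) (lam_i_max R ?I ?c (W n) (U n) i) (hmin2 M L aq i) (kappa2 M L \<omega> aq (?I i) i) (quad_mass M L \<omega> aq i / mass M (a (Suc n)) i)"
  proof -
    have q: "quadrature L \<omega> \<zeta> (CARD('d) - 1)" and step: "ale2_step M f R L \<omega> \<zeta> \<tau> a Wgeo W U n"
      using ale unfolding ale_version2_def by blast+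
    have \<tau>: "0 < \<tau> n" and anew: "\<And>g. g \<in> geo_dofs M \<Longrightarrow> a (Suc n) g = move (a n) (Wgeo n) (\<tau> n) g"
      and geo: "\<And>g. g \<in> geo_dofs M \<Longrightarrow> continuous_across_cells M (a n) (local_geo_shape M g)"
      and vel: "\<And>x. geo_velocity M (a n) (Wgeo n) x = velocity M (a n) (W n) x"
      and match: "\<And>s. s \<in> {0..\<tau> n} \<Longrightarrow> matching_mesh M (move (a n) (Wgeo n) s)"
      and update: "scheme_update f R ?I ?c (W n) (\<tau> n) (mass M (a n)) (mass M (a (Suc n))) (U n) (U (Suc n)) i"
      using step i unfolding ale2_step_def aq_def[abs_def] by blast+
    have L: "finite L" "\<And>l. l \<in> L \<Longrightarrow> 0 \<le> \<omega> l" and \<zeta>: "\<And>l. l \<in> L \<Longrightarrow> \<tau> n * \<zeta> l \<in> {0..\<tau> n}"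
      using q \<tau> mult_left_mono[of _ 1 "\<tau> n"] unfolding quadrature_def by auto
    have mesh: "mesh M (move (a n) (Wgeo n) s)" if "s \<in> {0..\<tau> n}" for s
      using adm match[OF that] by (rule mesh.intro)
    have meshq: "mesh M (aq l)" if "l \<in> L" for l
      unfolding aq_def by (rule mesh[OF \<zeta>[OF that]])
    have "move (a n) (Wgeo n) 0 = a n" by (simp add: move_def fun_eq_iff)
    then interpret mesh M "a n" using mesh[of 0] \<tau> by simp
    have nbq: "nb M (aq l) i = ?I i" if "l \<in> L" for l
      using mesh.nb_iff[OF meshq[OF that] i] nb_iff[OF i] by blast
    have sum\<omega>: "(\<Sum>l\<in>L. \<omega> l) = 1"
    proof -
      have "(\<Sum>l\<in>L. \<omega> l * poly [:1:] (\<zeta> l)) = (LINT s:{0..1}|lborel. poly [:1:] s)"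
        using q unfolding quadrature_def by (metis degree_pCons_0 le0)
      then show ?thesis by (simp add: set_lebesgue_integral_def)
    qed
    then have Lne: "L \<noteq> {}" by auto
    have qm: "0 < quad_mass M L \<omega> aq i"
    proof -
      obtain l0 where l0: "l0 \<in> L" "\<omega> l0 \<noteq> 0" using sum\<omega> by (metis sum.neutral zero_neq_one)
      have "0 < \<omega> l0 * mass M (aq l0) i"
        using l0 L(2)[OF l0(1)] mesh.mass_pos[OF meshq[OF l0(1)] i] by simp
      also have "\<dots> \<le> quad_mass M L \<omega> aq i"
        unfolding quad_mass_def using L l0(1) mesh.mass_pos[OF meshq i]
        by (intro member_le_sum) (auto simp: less_imp_le)
      finally show ?thesis .
    qed
    have mass_new: "mass M (a (Suc n)) i = mass M (move (a n) (Wgeo n) (\<tau> n)) i"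
      by (rule mass_cong[OF anew])
    have m': "0 < mass M (a (Suc n)) i"
      unfolding mass_new using \<tau> by (intro mesh.mass_pos[OF mesh i]) auto
    have cV: "(\<Sum>l\<in>L. \<omega> l * (\<Sum>j\<in>?I i. cvec M (aq l) i j \<bullet> V j)) = (\<Sum>j\<in>?I i. ?c i j \<bullet> V j)" for V
    proof -
      have "(\<Sum>l\<in>L. \<omega> l * (\<Sum>j\<in>?I i. cvec M (aq l) i j \<bullet> V j)) = (\<Sum>j\<in>?I i. \<Sum>l\<in>L. \<omega> l * (cvec M (aq l) i j \<bullet> V j))"
        unfolding sum_distrib_left by (rule sum.swap)
      then show ?thesis unfolding cvec2_def by (simp add: inner_sum_left)
    qed
    have mass_eq: "mass M (a (Suc n)) i = mass M (a n) i + \<tau> n * (\<Sum>j\<in>?I i. ?c i j \<bullet> W n j)"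
    proof -
      have "mass M (a (Suc n)) i - mass M (a n) i = \<tau> n * (\<Sum>l\<in>L. \<omega> l *
          (LINT x:Omega M|lebesgue. psi M (aq l) i x * dvg (velocity M (aq l) (W n)) x))"
        unfolding mass_new aq_def by (rule mass_evolution[OF adm \<tau> match geo vel q i])
      also have "\<dots> = \<tau> n * (\<Sum>l\<in>L. \<omega> l * (\<Sum>j\<in>?I i. cvec M (aq l) i j \<bullet> W n j))"
        using mesh.velocity_divergence_integral(2)[OF meshq i] nbq by simp
      finally show ?thesis unfolding cV by simp
    qed
    have c0: "(\<Sum>j\<in>?I i. ?c i j) = 0"
    proof -
      have "(\<Sum>j\<in>?I i. ?c i j) = (\<Sum>l\<in>L. \<omega> l *\<^sub>R (\<Sum>j\<in>?I i. cvec M (aq l) i j))"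
        unfolding cvec2_def scaleR_sum_right by (rule sum.swap)
      also have "\<dots> = 0"
        using mesh.sum_cvec_zero[OF meshq i] nbq by simp
      finally show ?thesis .
    qed
    have anti: "?c j i = - ?c i j" if "j \<in> ?I i" for j
    proof -
      have jd: "j \<in> dofs M" using nb_dofs that by blast
      show ?thesis
        unfolding cvec2_def sum_negf[symmetric] scaleR_minus_right[symmetric]
        by (intro sum.cong refl arg_cong2[where f=scaleR] mesh.cvec_antisym[OF meshq jd i])
    qed
    have "\<exists>e. \<forall>l\<in>L. \<forall>j\<in>?I i. 0 \<le> e l j \<and> hloc M (aq l) i j = 1 / ereal (e l j) \<and> norm (cvec M (aq l) i j) \<le> e l j * overlap_mass M (aq l) i j"
    proof -
      have "\<exists>e. l \<in> L \<longrightarrow> j \<in> ?I i \<longrightarrow> 0 \<le> e \<and> hloc M (aq l) i j = 1 / ereal e \<and> norm (cvec M (aq l) i j) \<le> e * overlap_mass M (aq l) i j" for l j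
        using mesh.cvec_hloc_bound[OF meshq i, of l j] nbq by metis
      then show ?thesis by metis
    qed
    then obtain e where e: "\<And>l j. l \<in> L \<Longrightarrow> j \<in> ?I i \<Longrightarrow> 0 \<le> e l j \<and> hloc M (aq l) i j = 1 / ereal (e l j) \<and> norm (cvec M (aq l) i j) \<le> e l j * overlap_mass M (aq l) i j"
      by blast
    have hq: "hmin M (aq l) i = Min (hloc M (aq l) i ` ?I i)" if "l \<in> L" for l
      unfolding hmin_def nbq[OF that] ..
    have "hmin2 M L aq i \<in> (\<lambda>l. hmin M (aq l) i) ` L"
      unfolding hmin2_def using L(1) Lne by (intro Min_in) auto
    then obtain l0 where l0: "l0 \<in> L" "hmin2 M L aq i = hmin M (aq l0) i" by blast
    have "hmin M (aq l0) i \<in> hloc M (aq l0) i ` ?I i"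
      unfolding hq[OF l0(1)] using nb_finite[OF i] nb_self[OF i] by (intro Min_in) auto
    then obtain j0 where j0: "j0 \<in> ?I i" "hmin2 M L aq i = 1 / ereal (e l0 j0)" using e[OF l0(1)] l0(2) by auto
    have bound: "norm (cvec M (aq l) i j) \<le> e l0 j0 * overlap_mass M (aq l) i j" if l: "l \<in> L" and j: "j \<in> ?I i" for l j
    proof -
      have "hmin2 M L aq i \<le> hmin M (aq l) i"
        unfolding hmin2_def using L(1) l by (intro Min_le) auto
      also have "\<dots> \<le> hloc M (aq l) i j"
        unfolding hq[OF l] using nb_finite[OF i] j by (intro Min_le) auto
      finally have "e l j \<le> e l0 j0" using ereal_inverse_le e[OF l j] e[OF l0(1) j0(1)] j0(2) by metis
      then have "e l j * overlap_mass M (aq l) i j \<le> e l0 j0 * overlap_mass M (aq l) i j"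
        using mesh.overlap_mass_bounds(1)[OF meshq[OF l] i] by (rule mult_right_mono)
      then show ?thesis using e[OF l j] by linarith
    qed
    define s where "s j = (\<Sum>l\<in>L. \<omega> l * overlap_mass M (aq l) i j)" for j
    have s: "norm (?c i j) \<le> e l0 j0 * s j" if j: "j \<in> ?I i" for j
    proof -
      have "norm (?c i j) \<le> (\<Sum>l\<in>L. \<omega> l * (e l0 j0 * overlap_mass M (aq l) i j))"
        unfolding cvec2_def
      proof (rule sum_norm_le)
        fix l assume l: "l \<in> L"
        have "norm (\<omega> l *\<^sub>R cvec M (aq l) i j) = \<omega> l * norm (cvec M (aq l) i j)" using L(2)[OF l] by simp
        also have "\<dots> \<le> \<omega> l * (e l0 j0 * overlap_mass M (aq l) i j)"
          by (rule mult_left_mono[OF bound[OF l j] L(2)[OF l]])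
        finally show "norm (\<omega> l *\<^sub>R cvec M (aq l) i j) \<le> \<omega> l * (e l0 j0 * overlap_mass M (aq l) i j)" .
      qed
      also have "\<dots> = e l0 j0 * s j" unfolding s_def by (simp add: sum_distrib_left mult_ac)
      finally show ?thesis .
    qed
    have \<kappa>: "kappa2 M L \<omega> aq (?I i) i = (\<Sum>j\<in>?I i - {i}. s j) / quad_mass M L \<omega> aq i"
      unfolding kappa2_def s_def ..
    have "1 / \<tau> n * (mass M (a (Suc n)) i * \<eta> (U (Suc n) i) - mass M (a n) i * \<eta> (U n i))
      \<le> (\<Sum>j\<in>?I i. visc R ?I ?c (W n) (U n) i j * \<eta> (U n j)) - (\<Sum>j\<in>?I i. ?c i j \<bullet> ?V j)"
      by (rule ale_entropy_inequality[where I="?I" and c="?c" and m="mass M (a n)" and m'="mass M (a (Suc n))" and s=s,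
          OF f R ent nb_finite[OF i] nb_self[OF i] nb_sym[OF i] U c0 anti \<tau> m' mass_eq update _ j0(2) s qm cfl[unfolded \<kappa>]])
        (use e[OF l0(1) j0(1)] in auto)
    also have "(\<Sum>j\<in>?I i. ?c i j \<bullet> ?V j) = (\<Sum>l\<in>L. \<omega> l * (LINT x:Omega M|lebesgue. dvg (\<lambda>x. \<Sum>j\<in>?I i. psi M (aq l) j x *\<^sub>R ?V j) x * psi M (aq l) i x))"
      unfolding cV[symmetric] using mesh.flux_divergence_integral[OF meshq i, of _ ?V] nbq
      by (intro sum.cong refl) simp
    finally show ?thesis .
  qed
  show ?thesis
    unfolding Let_def using v1 v2[unfolded aq_def[abs_def]] by blast
qed

end
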